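(* Let $m_1,m_2\ge 0$ and let $\widehat{\mathbb S}$ be the mixed type Nikishin system of functions associated with two Nikishin systems $S^1=\mathcal N(\sigma^1_0,\ldots,\sigma^1_{m_1})$ and $S^2=\mathcal N(\sigma^2_0,\ldots,\sigma^2_{m_2})$ with $\sigma^1_0=\sigma^2_0$. Then the matrix $\widehat{\mathbb S}$ is mixed type perfect. For each $\mathbf n=(\mathbf n_1;\mathbf n_2)\in\mathbb Z_+^{m_1+1}\times\mathbb Z_+^{m_2+1}$ with $|\mathbf n_1|=|\mathbf n_2|+1$, the mixed type vector polynomial $\mathbb A_{\mathbf n}$ relative to $\widehat{\mathbb S}$ and $\mathbf n$ is uniquely determined up to a constant factor.
   Context: For a bounded interval $\Delta\subset\mathbb R$, $\mathcal M(\Delta)$ is the class of finite Borel measures $s$ of constant sign (positive or negative) on $\mathbb R$ whose support is compact and infinite and such that $\Delta=\mathrm{Co}(\mathrm{supp}\,s)$ (convex hull). The Cauchy transform is $\widehat s(z)=\int\frac{ds(x)}{z-x}$. If $\Delta_\alpha\cap\Delta_\beta=\emptyset$, $\sigma_\alpha\in\mathcal M(\Delta_\alpha)$, $\sigma_\beta\in\mathcal M(\Delta_\beta)$, then $d\langle\sigma_\alpha,\sigma_\beta\rangle(x)=\widehat\sigma_\beta(x)\,d\sigma_\alpha(x)$. Nikishin system: given $\sigma_j\in\mathcal M(\Delta_j)$, $j=0,\ldots,m$, with $\Delta_j\cap\Delta_{j+1}=\emptyset$, put $s_{j,j}=\sigma_j$ and $s_{j,k}=\langle\sigma_j,\ldots,\sigma_k\rangle=\langle\sigma_j,\langle\sigma_{j+1},\ldots,\sigma_k\rangle\rangle$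 for $j<k$; then $\mathcal N(\sigma_0,\ldots,\sigma_m)=(s_{0,0},\ldots,s_{0,m})$. For $S^1,S^2$ the corresponding measures are denoted $s^1_{j,k}$, $s^2_{j,k}$. Mixed type Nikishin system of functions: put $\mathbb U=(1,\widehat s^{\,2}_{1,1},\ldots,\widehat s^{\,2}_{1,m_2})$, $\mathbb V=(1,\widehat s^{\,1}_{1,1},\ldots,\widehat s^{\,1}_{1,m_1})$ (superscripts are indices, not powers), $\mathbb W=\mathbb U^t\mathbb V$ (an $(m_2+1)\times(m_1+1)$ matrix function), and $$\widehat{\mathbb S}(z)=\int\frac{\mathbb W(x)\,d\sigma^2_0(x)}{z-x},$$ the integral taken entrywise. Mixed type polynomials: let $\mathbb F$ be an $(m_2+1)\times(m_1+1)$ matrix of functions analytic in a domain of the extended complex plane containing $\infty$, and let $\mathbf n=(\mathbf n_1;\mathbf n_2)$, $\mathbf n_i=(n_{i,0},\ldots,n_{i,m_i})\in\mathbb Z_+^{m_i+1}$, $|\mathbf n_i|=\sum_j n_{i,j}$, $|\mathbf n_1|=|\mathbf n_2|+1$. A mixed type vector polynomial relative to $\mathbb F$ and $\mathbf n$ is a vector of polynomials $\mathbb A_{\mathbf n}=(a_{\mathbf n,0},\ldots,a_{\mathbf n,m_1})\not\equiv\mathbf 0$ with $\deg a_{\mathbf n,k}\le n_{1,k}-1$, $k=0,\ldots,m_1$ ($\deg\le -1$ means $\equiv0$), such that for some $(m_2+1)$-dimensional vector polynomial $\mathbb D_{\mathbf n}$ the $j$-th component of $(\mathbb F\mathbb A_{\mathbf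 n}^t-\mathbb D_{\mathbf n}^t)(z)$ is $\mathcal O(1/z^{n_{2,j}+1})$ as $z\to\infty$, $j=0,\ldots,m_2$. Such a vector always exists. The multi-index $\mathbf n$ is mixed type normal if $\deg a_{\mathbf n,k}=n_{1,k}-1$, $k=0,\ldots,m_1$ (degree $-1$ meaning the zero polynomial), for every such $\mathbb A_{\mathbf n}$. $\mathbb F$ is mixed type perfect if all multi-indices in $\mathbb Z_+^{m_1+1}\times\mathbb Z_+^{m_2+1}$ with $|\mathbf n_1|=|\mathbf n_2|+1$ are mixed type normal. *)

theory Defs
  imports "HOL-Analysis.Analysis" "HOL-Library.Landau_Symbols"
    "HOL-Computational_Algebra.Polynomial"
begin

text \<open>
  A real signed Borel measure is represented as \<open>g d\<mu>\<close>, where \<open>\<mu>\<close> is a positive finite Borel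
  measure and \<open>g\<close> a real density. Every finite measure of constant sign is of this form, with
  \<open>g\<close> the constant 1 or -1, and the representation is stable under multiplication by a real
  function.
\<close>

type_synonym smeasure = "real measure \<times> (real \<Rightarrow> real)"

definition sintegral ::
    "smeasure \<Rightarrow> (real \<Rightarrow> 'a) \<Rightarrow> 'a::{banach, second_countable_topology}" where
  "sintegral s f = (\<integral>x. snd s x *\<^sub>R f x \<partial>fst s)"

definition total_variation :: "smeasure \<Rightarrow> real measure" where
  "total_variation s = density (fst s) (\<lambda>x. ennreal \<bar>snd s x\<bar>)"

definition supp :: "smeasure \<Rightarrow> real set" where
  "supp s = {x. \<forall>U. open U \<and> x \<in> U \<longrightarrow> emeasure (total_variation s) U \<noteq> 0}"

definition constant_sign :: "smeasure \<Rightarrow> bool" where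
  "constant_sign s \<longleftrightarrow> (AE x in fst s. 0 \<le> snd s x) \<or> (AE x in fst s. snd s x \<le> 0)"

text \<open>
  The class \<open>\<M>(\<Delta>)\<close>. That \<open>\<Delta>\<close> is a bounded (indeed compact, nondegenerate) interval
  follows from the last three conditions.
\<close>

definition measure_class :: "real set \<Rightarrow> smeasure set" where
  "measure_class \<Delta> = {s. sets (fst s) = sets borel \<and> finite_measure (fst s)
      \<and> integrable (fst s) (snd s) \<and> constant_sign s
      \<and> compact (supp s) \<and> infinite (supp s) \<and> \<Delta> = convex hull (supp s)}"

text \<open>Used both on the real line (\<open>'a = real\<close>) and in the complex plane.\<close>

definition cauchy_transform ::
    "smeasure \<Rightarrow> 'a \<Rightarrow> 'a::{real_normed_field, banach, second_countable_topology}" where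
  "cauchy_transform s z = sintegral s (\<lambda>x. 1 / (z - of_real x))"

definition bracket :: "smeasure \<Rightarrow> smeasure \<Rightarrow> smeasure" where
  "bracket s t = (fst s, \<lambda>x. cauchy_transform t x * snd s x)"

text \<open>\<open>\<langle>\<sigma>\<^sub>j, \<dots>, \<sigma>\<^sub>k\<rangle>\<close>; the empty list is irrelevant.\<close>

fun bracket_list :: "smeasure list \<Rightarrow> smeasure" where
  "bracket_list [] = (null_measure borel, \<lambda>_. 0)"
| "bracket_list [s] = s"
| "bracket_list (s # t # ts) = bracket s (bracket_list (t # ts))"

definition nikishin_measure :: "(nat \<Rightarrow> smeasure) \<Rightarrow> nat \<Rightarrow> nat \<Rightarrow> smeasure" where
  "nikishin_measure \<sigma> j k = bracket_list (map \<sigma> [j..<Suc k])"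

text \<open>\<open>\<sigma>\<^sub>0, \<dots>, \<sigma>\<^sub>m\<close> generate a Nikishin system, with \<open>\<Delta>\<^sub>j\<close> the convex hull of the support of \<open>\<sigma>\<^sub>j\<close>.\<close>

definition nikishin_generators ::
    "nat \<Rightarrow> (nat \<Rightarrow> real set) \<Rightarrow> (nat \<Rightarrow> smeasure) \<Rightarrow> bool" where
  "nikishin_generators m \<Delta> \<sigma> \<longleftrightarrow>
     (\<forall>j\<le>m. \<sigma> j \<in> measure_class (\<Delta> j)) \<and> (\<forall>j<m. \<Delta> j \<inter> \<Delta> (Suc j) = {})"

text \<open>The vectors \<open>\<U>\<close> (from \<open>S\<^sup>2\<close>) and \<open>\<V>\<close> (from \<open>S\<^sup>1\<close>).\<close>

definition nikishin_vector :: "(nat \<Rightarrow> smeasure) \<Rightarrow> nat \<Rightarrow> real \<Rightarrow> real" where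
  "nikishin_vector \<sigma> j x = (if j = 0 then 1 else cauchy_transform (nikishin_measure \<sigma> 1 j) x)"

definition mixed_weight ::
    "(nat \<Rightarrow> smeasure) \<Rightarrow> (nat \<Rightarrow> smeasure) \<Rightarrow> nat \<Rightarrow> nat \<Rightarrow> real \<Rightarrow> real" where
  "mixed_weight \<sigma>1 \<sigma>2 j k x = nikishin_vector \<sigma>2 j x * nikishin_vector \<sigma>1 k x"

definition mixed_nikishin ::
    "(nat \<Rightarrow> smeasure) \<Rightarrow> (nat \<Rightarrow> smeasure) \<Rightarrow> nat \<Rightarrow> nat \<Rightarrow> complex \<Rightarrow> complex" where
  "mixed_nikishin \<sigma>1 \<sigma>2 j k z =
     sintegral (\<sigma>2 0) (\<lambda>x. of_real (mixed_weight \<sigma>1 \<sigma>2 j k x) / (z - of_real x))"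

text \<open>
  Matrices, vectors and multi-indices are functions on \<open>nat\<close>; only the rows \<open>j \<le> m2\<close> and the
  columns \<open>k \<le> m1\<close> matter.
\<close>

definition pdeg :: "complex poly \<Rightarrow> int" where
  "pdeg p = (if p = 0 then -1 else int (degree p))"

definition mixed_type_poly ::
    "nat \<Rightarrow> nat \<Rightarrow> (nat \<Rightarrow> nat \<Rightarrow> complex \<Rightarrow> complex) \<Rightarrow> (nat \<Rightarrow> nat) \<Rightarrow> (nat \<Rightarrow> nat)
      \<Rightarrow> (nat \<Rightarrow> complex poly) \<Rightarrow> bool" where
  "mixed_type_poly m1 m2 F n1 n2 a \<longleftrightarrow>
     (\<exists>k\<le>m1. a k \<noteq> 0) \<and>
     (\<forall>k\<le>m1. pdeg (a k) \<le> int (n1 k) - 1) \<and>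
     (\<exists>d :: nat \<Rightarrow> complex poly. \<forall>j\<le>m2.
        (\<lambda>z. (\<Sum>k\<le>m1. F j k z * poly (a k) z) - poly (d j) z)
          \<in> O[at_infinity](\<lambda>z. 1 / z ^ (n2 j + 1)))"

definition admissible_index :: "nat \<Rightarrow> nat \<Rightarrow> (nat \<Rightarrow> nat) \<Rightarrow> (nat \<Rightarrow> nat) \<Rightarrow> bool" where
  "admissible_index m1 m2 n1 n2 \<longleftrightarrow> (\<Sum>k\<le>m1. n1 k) = (\<Sum>j\<le>m2. n2 j) + 1"

definition mixed_type_normal ::
    "nat \<Rightarrow> nat \<Rightarrow> (nat \<Rightarrow> nat \<Rightarrow> complex \<Rightarrow> complex) \<Rightarrow> (nat \<Rightarrow> nat) \<Rightarrow> (nat \<Rightarrow> nat) \<Rightarrow> bool" where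
  "mixed_type_normal m1 m2 F n1 n2 \<longleftrightarrow>
     (\<forall>a. mixed_type_poly m1 m2 F n1 n2 a \<longrightarrow> (\<forall>k\<le>m1. pdeg (a k) = int (n1 k) - 1))"

definition mixed_type_perfect ::
    "nat \<Rightarrow> nat \<Rightarrow> (nat \<Rightarrow> nat \<Rightarrow> complex \<Rightarrow> complex) \<Rightarrow> bool" where
  "mixed_type_perfect m1 m2 F \<longleftrightarrow>
     (\<forall>n1 n2. admissible_index m1 m2 n1 n2 \<longrightarrow> mixed_type_normal m1 m2 F n1 n2)"

end

theory Submission
  imports Defs "HOL-Real_Asymp.Real_Asymp"
begin

text \<open>
  Comparing coefficients at infinity turns the order conditions into orthogonality: the linear form
  \<open>A = \<Sum>\<^sub>k a\<^sub>k V\<^sub>k\<close> satisfies \<open>\<integral> x^l U\<^sub>j A d\<sigma> = 0\<close> for all \<open>j \<le> m2\<close> and \<open>l < n2 j\<close>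
  (\<open>order_condition_iff_moments\<close>). The theorem follows from one statement
  (\<open>orthogonal_form_vanishes\<close>): such a form is zero as soon as it has at most \<open>|n2|\<close> free
  coefficients. Indeed, if the top coefficient of some \<open>a\<^sub>k\<close> were zero, only
  \<open>|n1| - 1 = |n2|\<close> free coefficients would remain; this gives normality, and uniqueness after
  cancelling one top coefficient in a difference of two solutions.

  The vanishing statement rests on a Chebyshev property (\<open>nikishin_chebyshev\<close>): for every
  multi-index \<open>n\<close>, with no order imposed on its entries, a nonzero form \<open>\<Sum>\<^sub>k p\<^sub>k V\<^sub>k\<close> with
  \<open>deg p\<^sub>k < n k\<close> has fewer than \<open>|n|\<close> zeros on the base interval. A nonzero form \<open>A\<close> as above
  thus changes sign at fewer than \<open>|n2|\<close> points, and by the same property for the second system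
  some form \<open>B = \<Sum>\<^sub>j q\<^sub>j U\<^sub>j\<close> changes sign exactly at those points. Then \<open>A B\<close> has constant sign,
  while orthogonality says that its integral is zero.

  The Chebyshev property involves only finitely many points. Exact quadrature with positive weights
  (\<open>exact_quadrature_many_nodes\<close>) replaces the generating measures, one level after the other, by
  finite sums of point masses without changing the functions at these points
  (\<open>reduction_to_atomic\<close>), so that only sums of partial fractions remain. For them the proof
  divides by one column at a time. Choose the column \<open>j\<close> with the largest \<open>n j\<close>, the first one in
  case of a tie. If the ratios with the other columns have the form
  \<open>W\<^sub>k/W\<^sub>j = l\<^sub>0 + l\<^sub>1 x + \<Sum>\<^sub>y W'\<^sub>k(y) \<tau>(y)/(x - y)\<close>, with positive \<open>\<tau>\<close> and nodes in the next
  interval, then the zeros of \<open>\<Sum>\<^sub>k p\<^sub>k W\<^sub>k\<close> make \<open>\<Sum>\<^sub>k p\<^sub>k W'\<^sub>k\<close>, where \<open>k\<close> now differs from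
  \<open>j\<close>, orthogonal to polynomials of low degree. Hence this shorter form has \<open>|n| - n j\<close> zeros in
  the next interval, and induction applies (\<open>chebyshev_good\<close>).

  If the columns are removed from left to right, \<open>W'\<close> is simply the next row of Cauchy transforms.
  For an arbitrary order one has to divide by columns that are themselves Cauchy sums. This is
  possible because the reciprocal of a Cauchy sum with positive masses is an affine function plus
  a Cauchy sum with negative masses (\<open>reciprocal_of_cauchy_sum\<close>); \<open>eliminate\<close> derives the
  expansion of all ratios from it. The vectors \<open>W\<close> that arise are, up to a scalar factor, vectors
  of minors of the triangular matrix of Cauchy sums. Two properties of these minors keep the
  division going: they do not vanish off the next interval (\<open>valid_nonvanishing\<close>), and later
  columns grow more slowly at infinity than \<open>x\<close> times earlier ones
  (\<open>later_column_grows_slower\<close>).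
\<close>

section \<open>Linear systems, sign patterns and forced zeros\<close>

lemma homogeneous_system_solvable:
  fixes M :: "'a \<Rightarrow> 'b \<Rightarrow> 'f::field"
  assumes "finite A" "finite B" "card A < card B"
  shows "\<exists>x. (\<exists>b\<in>B. x b \<noteq> 0) \<and> (\<forall>b. b \<notin> B \<longrightarrow> x b = 0) \<and> (\<forall>a\<in>A. (\<Sum>b\<in>B. M a b * x b) = 0)"
  using assms
proof (induction A arbitrary: B M rule: finite_induct)
  case empty
  then obtain b where "b \<in> B" by fastforce
  then show ?case by (intro exI[of _ "\<lambda>i. if i = b then 1 else 0"]) auto
next
  case (insert a A)
  show ?case
  proof (cases "\<forall>b\<in>B. M a b = 0")
    case True
    obtain x where x: "\<exists>b\<in>B. x b \<noteq> 0" "\<forall>b. b \<notin> B \<longrightarrow> x b = 0" "\<forall>a\<in>A. (\<Sum>b\<in>B. M a b * x b) = 0"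
      using insert.IH[of B M] insert.prems insert.hyps by auto
    then show ?thesis using True by (intro exI[of _ x]) auto
  next
    case False
    then obtain p where p: "p \<in> B" "M a p \<noteq> 0" by auto
    define M' where "M' i b = M i b - M i p * M a b / M a p" for i b
    have "card A < card (B - {p})" using insert p by (simp add: card_Diff_singleton)
    then obtain x where x: "\<exists>b\<in>B-{p}. x b \<noteq> 0" "\<forall>b. b \<notin> B-{p} \<longrightarrow> x b = 0"
        "\<forall>i\<in>A. (\<Sum>b\<in>B-{p}. M' i b * x b) = 0"
      using insert.IH[of "B - {p}" M'] insert.prems by auto
    define s where "s = (\<Sum>b\<in>B-{p}. M a b * x b) / M a p"
    define y where "y = (\<lambda>b. if b = p then - s else x b)"
    have sumy: "(\<Sum>b\<in>B. M i b * y b) = - M i p * s + (\<Sum>b\<in>B-{p}. M i b * x b)" for i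
      using p insert.prems by (simp add: sum.remove[of B p] y_def)
    have "(\<Sum>b\<in>B. M i b * y b) = 0" if "i \<in> insert a A" for i
    proof (cases "i = a")
      case True
      then show ?thesis using p by (simp add: sumy s_def)
    next
      case False
      then have "0 = (\<Sum>b\<in>B-{p}. M' i b * x b)" using x that by auto
      also have "\<dots> = (\<Sum>b\<in>B-{p}. M i b * x b - (M i p / M a p) * (M a b * x b))"
        by (intro sum.cong) (auto simp: M'_def algebra_simps)
      also have "\<dots> = (\<Sum>b\<in>B-{p}. M i b * x b) - M i p * s"
        by (simp add: sum_subtractf sum_distrib_left s_def sum_divide_distrib)
      finally show ?thesis by (simp add: sumy)
    qed
    moreover have "\<exists>b\<in>B. y b \<noteq> 0" using x(1) unfolding y_def by auto
    moreover have "\<forall>b. b \<notin> B \<longrightarrow> y b = 0" using x(2) p unfolding y_def by auto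
    ultimately show ?thesis by blast
  qed
qed

text \<open>
  \<open>T\<close> collects the points at which \<open>g\<close> changes sign. The induction removes the largest point of
  \<open>Z\<close>: to its right the sign is constant by the intermediate value theorem, and the point enters
  \<open>T\<close> when this sign differs from the one on the left.
\<close>

lemma sign_pattern_of_nonvanishing:
  fixes g :: "real \<Rightarrow> real"
  assumes "finite Z" "is_interval I" "continuous_on (I - Z) g" "\<And>x. x \<in> I - Z \<Longrightarrow> g x \<noteq> 0"
  shows "\<exists>T \<epsilon>. T \<subseteq> Z \<and> (\<epsilon> = 1 \<or> \<epsilon> = -1) \<and> (\<forall>x\<in>I-Z. \<epsilon> * g x * (\<Prod>t\<in>T. x - t) > 0)"
  using assms
proof (induction Z arbitrary: I rule: finite_linorder_max_induct)
  case empty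
  have conn: "connected (g ` I)"
    using empty is_interval_connected[of I] by (intro connected_continuous_image) auto
  have "(\<forall>x\<in>I. g x > 0) \<or> (\<forall>x\<in>I. g x < 0)"
  proof (rule ccontr)
    assume "\<not> ?thesis"
    then obtain x y where xy: "x \<in> I" "y \<in> I" "g x \<le> 0" "g y \<ge> 0" by force
    then have "0 \<in> g ` I" using connectedD_interval[OF conn, of "g x" "g y" 0] by auto
    then show False using empty by auto
  qed
  then show ?case by (elim disjE; intro exI[of _ "{}"]) (auto intro: exI[of _ 1] exI[of _ "-1::real"])
next
  case (insert z Z)
  let ?I1 = "I \<inter> {..<z}" and ?I2 = "I \<inter> {z<..}"
  have int: "is_interval ?I1" "is_interval ?I2"
    using insert.prems(1) by (auto simp: is_interval_1)
  have "continuous_on (?I1 - Z) g"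
    by (rule continuous_on_subset[OF insert.prems(2)]) auto
  then obtain T \<epsilon> where T: "T \<subseteq> Z" "\<epsilon> = 1 \<or> \<epsilon> = (-1::real)"
      "\<forall>x\<in>?I1-Z. \<epsilon> * g x * (\<Prod>t\<in>T. x - t) > 0"
    using insert.IH[OF int(1)] insert.prems(3) by auto
  have "continuous_on ?I2 g"
    by (rule continuous_on_subset[OF insert.prems(2)]) (use insert.hyps in auto)
  then have conn: "connected (g ` ?I2)"
    by (rule connected_continuous_image) (rule is_interval_connected[OF int(2)])
  have nz2: "\<forall>x\<in>?I2. g x \<noteq> 0"
  proof
    fix x assume "x \<in> ?I2"
    then have "x \<in> I - insert z Z" using insert.hyps by auto
    then show "g x \<noteq> 0" by (rule insert.prems(3))
  qed
  have "(\<forall>x\<in>?I2. g x > 0) \<or> (\<forall>x\<in>?I2. g x < 0)"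
  proof (rule ccontr)
    assume "\<not> ?thesis"
    then obtain x y where xy: "x \<in> ?I2" "y \<in> ?I2" "g x \<le> 0" "g y \<ge> 0" by force
    then have "0 \<in> g ` ?I2" using connectedD_interval[OF conn, of "g x" "g y" 0] by blast
    then show False using nz2 by auto
  qed
  then obtain \<delta> where \<delta>: "\<delta> = 1 \<or> \<delta> = (-1::real)" "\<forall>x\<in>?I2. \<delta> * g x > 0"
    by (metis mult_1 mult_minus1 neg_0_less_iff_less)
  have pos2: "(\<Prod>t\<in>T. x - t) > 0" if "x > z" for x
    using T(1) insert.hyps that by (intro prod_pos) force
  have fT: "finite T" "z \<notin> T" using T(1) insert.hyps finite_subset by auto
  show ?case
  proof (cases "\<epsilon> = \<delta>")
    case True
    have "\<epsilon> * g x * (\<Prod>t\<in>T. x - t) > 0" if "x \<in> I - insert z Z" for x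
    proof (cases "x < z")
      case False
      then have "x > z" using that by auto
      then show ?thesis using \<delta>(2) pos2[of x] that True by simp
    qed (use T that in auto)
    then show ?thesis using T by (intro exI[of _ T] exI[of _ \<epsilon>]) auto
  next
    case False
    then have e: "\<epsilon> = - \<delta>" using T(2) \<delta>(1) by auto
    have "\<delta> * g x * (\<Prod>t\<in>insert z T. x - t) > 0" if "x \<in> I - insert z Z" for x
    proof (cases "x < z")
      case False
      then have "x > z" using that by auto
      then show ?thesis using \<delta>(2) pos2[of x] that fT by simp
    next
      case True
      then have "\<epsilon> * g x * (\<Prod>t\<in>T. x - t) > 0" using T that by auto
      then have "(\<epsilon> * g x * (\<Prod>t\<in>T. x - t)) * (z - x) > 0" using True by simp
      then show ?thesis using fT e by (simp add: algebra_simps)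
    qed
    then show ?thesis using T \<delta>(1) by (intro exI[of _ "insert z T"] exI[of _ \<delta>]) auto
  qed
qed

text \<open>
  With fewer than \<open>N\<close> zeros, the polynomial with simple zeros at the sign changes of \<open>\<Phi>\<close> would be
  an admissible test polynomial, and all terms of the sum would have the same sign.
\<close>

lemma many_zeros_of_orthogonal:
  fixes \<Phi> \<tau> :: "real \<Rightarrow> real"
  assumes "finite Z" "Z \<subseteq> {a..b}" "\<And>y. y \<in> Z \<Longrightarrow> \<tau> y > 0" "continuous_on {a..b} \<Phi>" "N \<le> card Z"
    and orth: "\<And>g. degree g < N \<Longrightarrow> (\<Sum>y\<in>Z. poly g y * \<Phi> y * \<tau> y) = 0"
  shows "\<exists>X. finite X \<and> X \<subseteq> {a..b} \<and> card X = N \<and> (\<forall>x\<in>X. \<Phi> x = 0)"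
proof -
  define X0 where "X0 = {x\<in>{a..b}. \<Phi> x = 0}"
  have "\<not> (finite X0 \<and> card X0 < N)"
  proof
    assume X0: "finite X0 \<and> card X0 < N"
    obtain T \<epsilon> where T: "T \<subseteq> X0" "\<epsilon> = 1 \<or> \<epsilon> = (-1::real)"
        "\<forall>x\<in>{a..b}-X0. \<epsilon> * \<Phi> x * (\<Prod>t\<in>T. x - t) > 0"
    proof -
      have "continuous_on ({a..b} - X0) \<Phi>" by (rule continuous_on_subset[OF assms(4)]) auto
      moreover have "\<And>x. x \<in> {a..b} - X0 \<Longrightarrow> \<Phi> x \<noteq> 0" by (simp add: X0_def)
      ultimately show ?thesis
        using sign_pattern_of_nonvanishing[of X0 "{a..b}" \<Phi>] X0 that is_interval_cc by blast
    qed
    define g where "g = (\<Prod>t\<in>T. [:-t, 1:])"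
    have fT: "finite T" using T X0 finite_subset by blast
    have "degree g = card T" unfolding g_def using fT by (subst degree_prod_eq_sum_degree) auto
    then have "degree g < N" using X0 T card_mono[of X0 T] by simp
    then have "(\<Sum>y\<in>Z. poly g y * \<Phi> y * \<tau> y) = 0" by (rule orth)
    then have "(\<Sum>y\<in>Z. \<epsilon> * (poly g y * \<Phi> y * \<tau> y)) = 0" by (simp add: sum_distrib_left[symmetric])
    moreover have nn: "\<epsilon> * (poly g y * \<Phi> y * \<tau> y) \<ge> 0" "\<Phi> y \<noteq> 0 \<Longrightarrow> \<epsilon> * (poly g y * \<Phi> y * \<tau> y) > 0" if "y \<in> Z" for y
    proof -
      have pg: "poly g y = (\<Prod>t\<in>T. y - t)" by (simp add: g_def poly_prod)
      show "\<epsilon> * (poly g y * \<Phi> y * \<tau> y) > 0" if "\<Phi> y \<noteq> 0"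
      proof -
        have "\<epsilon> * \<Phi> y * (\<Prod>t\<in>T. y - t) > 0" using T(3) \<open>y \<in> Z\<close> assms(2) that by (auto simp: X0_def)
        then have "\<epsilon> * \<Phi> y * (\<Prod>t\<in>T. y - t) * \<tau> y > 0" using assms(3)[OF \<open>y \<in> Z\<close>] by simp
        then show ?thesis by (simp add: pg algebra_simps)
      qed
      then show "\<epsilon> * (poly g y * \<Phi> y * \<tau> y) \<ge> 0" by (cases "\<Phi> y = 0") auto
    qed
    ultimately have "\<forall>y\<in>Z. \<epsilon> * (poly g y * \<Phi> y * \<tau> y) = 0"
      using sum_nonneg_eq_0_iff[OF \<open>finite Z\<close>, of "\<lambda>y. \<epsilon> * (poly g y * \<Phi> y * \<tau> y)"] by auto
    then have "Z \<subseteq> X0" using nn(2) assms(2) unfolding X0_def by force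
    then show False using X0 assms(5) card_mono[of X0 Z] by simp
  qed
  then have "\<exists>X\<subseteq>X0. finite X \<and> card X = N"
  proof (cases "finite X0")
    case True
    then have "N \<le> card X0" using \<open>\<not> (finite X0 \<and> card X0 < N)\<close> by simp
    then show ?thesis by (meson obtain_subset_with_card_n)
  next
    case False
    then show ?thesis using infinite_arbitrarily_large by blast
  qed
  then show ?thesis unfolding X0_def by blast
qed

section \<open>Partial fractions and the passage of zeros to a density\<close>

lemma lagrange_interpolation:
  fixes Q :: "'a::field poly"
  assumes "finite X" "degree Q < card X"
  shows "Q = (\<Sum>x\<in>X. smult (poly Q x / (\<Prod>u\<in>X-{x}. x - u)) (\<Prod>u\<in>X-{x}. [:-u, 1:]))"
    (is "Q = ?R")
proof (rule poly_eqI_degree)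
  fix z assume "z \<in> X"
  have "poly ?R z = (\<Sum>x\<in>X. if x = z then poly Q z else 0)"
    unfolding poly_sum
  proof (intro sum.cong refl)
    fix x assume "x \<in> X"
    show "poly (smult (poly Q x / (\<Prod>u\<in>X-{x}. x - u)) (\<Prod>u\<in>X-{x}. [:-u, 1:])) z = (if x = z then poly Q z else 0)"
    proof (cases "x = z")
      case True
      have "(\<Prod>u\<in>X-{x}. x - u) \<noteq> 0" using assms by auto
      then show ?thesis using True by (simp add: poly_prod)
    next
      case False
      then have "(\<Prod>u\<in>X-{x}. z - u) = 0" using \<open>z \<in> X\<close> assms by auto
      then show ?thesis using False by (simp add: poly_prod)
    qed
  qed
  then show "poly Q z = poly ?R z" using \<open>z \<in> X\<close> assms by simp
next
  have "degree (smult (poly Q x / (\<Prod>u\<in>X-{x}. x - u)) (\<Prod>u\<in>X-{x}. [:-u, 1:])) \<le> card X - 1"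
    if "x \<in> X" for x
  proof -
    have "degree (\<Prod>u\<in>X-{x}. [:-u, 1:]) = card (X - {x})"
      using assms by (subst degree_prod_eq_sum_degree) auto
    then show ?thesis using that assms by (metis card_Diff_singleton degree_smult_le)
  qed
  then have "degree ?R \<le> card X - 1" using assms by (intro degree_sum_le) auto
  then show "degree ?R < card X" using assms(2) by linarith
qed (use assms in auto)

lemma lagrange_partial_fractions:
  fixes Q :: "'a::field poly"
  assumes "finite X" "degree Q < card X" "y \<notin> X"
  shows "poly Q y / (\<Prod>u\<in>X. y - u) = (\<Sum>x\<in>X. poly Q x / (\<Prod>u\<in>X-{x}. x - u) / (y - x))"
proof -
  have "poly Q y = (\<Sum>x\<in>X. poly Q x / (\<Prod>u\<in>X-{x}. x - u) * (\<Prod>u\<in>X-{x}. y - u))"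
    by (subst lagrange_interpolation[OF assms(1,2)]) (simp add: poly_sum poly_prod)
  also have "\<dots> / (\<Prod>u\<in>X. y - u) = (\<Sum>x\<in>X. poly Q x / (\<Prod>u\<in>X-{x}. x - u) / (y - x))"
    unfolding sum_divide_distrib
  proof (intro sum.cong refl)
    fix x assume "x \<in> X"
    have "(\<Prod>u\<in>X. y - u) = (y - x) * (\<Prod>u\<in>X-{x}. y - u)" using \<open>x \<in> X\<close> assms by (simp add: prod.remove)
    moreover have "(\<Prod>u\<in>X-{x}. y - u) \<noteq> 0" using assms by auto
    ultimately show "poly Q x / (\<Prod>u\<in>X-{x}. x - u) * (\<Prod>u\<in>X-{x}. y - u) / (\<Prod>u\<in>X. y - u)
       = poly Q x / (\<Prod>u\<in>X-{x}. x - u) / (y - x)" by simp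
  qed
  finally show ?thesis .
qed

lemma sum_divided_differences_zero:
  fixes Q :: "real poly"
  assumes "finite X" "degree Q + 1 < card X"
  shows "(\<Sum>x\<in>X. poly Q x / (\<Prod>u\<in>X-{x}. x - u)) = 0"
proof -
  obtain y where y: "y \<notin> X" using assms ex_new_if_finite infinite_UNIV_char_0 by blast
  let ?Q = "Q * [:-y, 1:]"
  have "degree ?Q < card X" using degree_mult_le[of Q "[:-y, 1:]"] assms(2) by simp
  from lagrange_partial_fractions[OF assms(1) this y]
  have "0 = (\<Sum>x\<in>X. poly ?Q x / (\<Prod>u\<in>X-{x}. x - u) / (y - x))" by simp
  also have "\<dots> = (\<Sum>x\<in>X. - (poly Q x / (\<Prod>u\<in>X-{x}. x - u)))"
    using y by (intro sum.cong) (auto simp: divide_simps algebra_simps split: if_splits)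
  finally show ?thesis by (simp add: sum_negf)
qed

lemma interpolation_sum_of_cauchy_kernel:
  fixes g :: "real poly"
  assumes "finite X" "degree g < card X" "y \<notin> X"
  shows "(\<Sum>x\<in>X. poly g x / (\<Prod>u\<in>X-{x}. x - u) * (1 / (x - y))) = - (poly g y / (\<Prod>u\<in>X. y - u))"
proof -
  have "(\<Sum>x\<in>X. poly g x / (\<Prod>u\<in>X-{x}. x - u) * (1 / (x - y))) = (\<Sum>x\<in>X. - (poly g x / (\<Prod>u\<in>X-{x}. x - u) / (y - x)))"
  proof (intro sum.cong refl)
    fix x assume "x \<in> X"
    then have "x - y \<noteq> 0" using assms by auto
    then show "poly g x / (\<Prod>u\<in>X-{x}. x - u) * (1 / (x - y)) = - (poly g x / (\<Prod>u\<in>X-{x}. x - u) / (y - x))"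
      by (metis minus_diff_eq divide_minus_right mult.right_neutral times_divide_eq_right)
  qed
  then show ?thesis using lagrange_partial_fractions[OF assms] by (simp add: sum_negf)
qed

text \<open>
  Multiply the equation at \<open>x\<close> by \<open>g(x)/w'(x)\<close>, where \<open>w\<close> is the nodal polynomial of \<open>X\<close>, and add.
  The polynomial part disappears since divided differences annihilate low degrees, and the Cauchy
  kernels add up to \<open>g/w\<close>.
\<close>

lemma orthogonality_from_zeros:
  fixes \<alpha> :: "real \<Rightarrow> real" and g P :: "real poly"
  assumes "finite X" "X \<inter> Z = {}"
    and zero: "\<And>x. x \<in> X \<Longrightarrow> poly P x + (\<Sum>y\<in>Z. \<alpha> y / (x - y)) = 0"
    and deg: "degree g < card X" "P = 0 \<or> degree g + degree P + 1 < card X"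
  shows "(\<Sum>y\<in>Z. poly g y * \<alpha> y / (\<Prod>x\<in>X. y - x)) = 0"
proof -
  let ?c = "\<lambda>x. poly g x / (\<Prod>u\<in>X-{x}. x - u)"
  have P0: "(\<Sum>x\<in>X. ?c x * poly P x) = 0"
  proof (cases "P = 0")
    case False
    then have "degree (g * P) + 1 < card X" using deg degree_mult_le[of g P] by linarith
    from sum_divided_differences_zero[OF assms(1) this] show ?thesis by (simp add: mult.commute)
  qed simp
  have "0 = (\<Sum>x\<in>X. ?c x * (poly P x + (\<Sum>y\<in>Z. \<alpha> y / (x - y))))"
    using zero by simp
  also have "\<dots> = (\<Sum>x\<in>X. ?c x * (\<Sum>y\<in>Z. \<alpha> y / (x - y)))"
    using P0 by (simp only: distrib_left sum.distrib)
  also have "\<dots> = (\<Sum>x\<in>X. \<Sum>y\<in>Z. \<alpha> y * (?c x * (1 / (x - y))))"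
    unfolding sum_distrib_left by (intro sum.cong refl) simp
  also have "\<dots> = (\<Sum>y\<in>Z. \<alpha> y * (\<Sum>x\<in>X. ?c x * (1 / (x - y))))"
    unfolding sum_distrib_left by (rule sum.swap)
  also have "\<dots> = (\<Sum>y\<in>Z. - (poly g y * \<alpha> y / (\<Prod>x\<in>X. y - x)))"
  proof (intro sum.cong refl)
    fix y assume "y \<in> Z"
    then have "y \<notin> X" using assms by auto
    from interpolation_sum_of_cauchy_kernel[OF assms(1) deg(1) this]
    show "\<alpha> y * (\<Sum>x\<in>X. ?c x * (1 / (x - y))) = - (poly g y * \<alpha> y / (\<Prod>x\<in>X. y - x))"
      by simp
  qed
  finally show ?thesis by (simp add: sum_negf)
qed

lemma nodal_product_constant_sign:
  fixes X :: "real set"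
  assumes "X \<inter> {a..b} = {}"
  shows "\<exists>\<epsilon>. \<forall>y\<in>{a..b}. \<epsilon> / (\<Prod>x\<in>X. y - x) > (0::real)"
proof (cases "finite X")
  case True
  have "(\<Prod>x\<in>X. y - x) * (\<Prod>x\<in>X. a - x) > 0" if y: "y \<in> {a..b}" for y
  proof -
    have "(y - x) * (a - x) > 0" if "x \<in> X" for x
    proof (cases "x < a")
      case False
      then have "x > b" using assms that y by force
      then show ?thesis using y by (intro mult_neg_neg) auto
    qed (use y in auto)
    then have "(\<Prod>x\<in>X. (y - x) * (a - x)) > 0" by (intro prod_pos) auto
    then show ?thesis by (simp add: prod.distrib)
  qed
  then have "\<forall>y\<in>{a..b}. (\<Prod>x\<in>X. a - x) / (\<Prod>x\<in>X. y - x) > 0"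
    by (metis mult.commute zero_less_divide_iff zero_less_mult_iff)
  then show ?thesis by blast
qed (auto intro: exI[of _ 1])

text \<open>
  The step behind every induction on levels: zeros outside an interval of a polynomial plus a Cauchy
  sum become zeros, inside the interval, of the density \<open>\<Phi>\<close>. By \<open>orthogonality_from_zeros\<close>, \<open>\<Phi>\<close> is
  orthogonal with respect to the masses divided by the nodal polynomial of \<open>X\<close>, which have constant
  sign. The polynomial \<open>P\<close> costs \<open>degree P + 1\<close> zeros; if \<open>P = 0\<close> and the total mass
  of \<open>\<Phi> \<tau>\<close> is zero, then infinity is an additional zero.
\<close>

lemma zeros_pass_to_density:
  fixes \<Phi> \<tau> :: "real \<Rightarrow> real" and P :: "real poly"
  assumes Z: "finite Z" "Z \<subseteq> {a..b}" "\<And>y. y \<in> Z \<Longrightarrow> \<tau> y > 0" "continuous_on {a..b} \<Phi>" "N \<le> card Z"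
    and X: "finite X" "X \<inter> {a..b} = {}"
    and zero: "\<And>x. x \<in> X \<Longrightarrow> poly P x + (\<Sum>y\<in>Z. \<Phi> y * \<tau> y / (x - y)) = 0"
    and N: "P = 0 \<and> N \<le> card X \<or> N + degree P + 1 \<le> card X
      \<or> (P = 0 \<and> (\<Sum>y\<in>Z. \<Phi> y * \<tau> y) = 0 \<and> N \<le> card X + 1)"
  shows "\<exists>X'. finite X' \<and> X' \<subseteq> {a..b} \<and> card X' = N \<and> (\<forall>x\<in>X'. \<Phi> x = 0)"
proof -
  obtain \<epsilon> where \<epsilon>: "\<forall>y\<in>{a..b}. \<epsilon> / (\<Prod>x\<in>X. y - x) > 0"
    using nodal_product_constant_sign[OF X(2)] by blast
  define \<tau>' where "\<tau>' y = \<tau> y * (\<epsilon> / (\<Prod>x\<in>X. y - x))" for y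
  have XZ: "X \<inter> Z = {}" using X Z by auto
  have orth: "(\<Sum>y\<in>Z. poly g y * (\<Phi> y * \<tau> y) / (\<Prod>x\<in>X. y - x)) = 0" if g: "degree g < N" for g
  proof (cases "degree g < card X \<and> (P = 0 \<or> degree g + degree P + 1 < card X)")
    case True
    then show ?thesis by (intro orthogonality_from_zeros[OF X(1) XZ zero]) auto
  next
    case False
    then have P: "P = 0" "(\<Sum>y\<in>Z. \<Phi> y * \<tau> y) = 0" "degree g = card X" using N g by auto
    \<comment> \<open>The degree of \<open>g\<close> is that of the nodal polynomial \<open>w\<close>: a multiple of
      \<open>w\<close> contributes the total mass, the rest has lower degree.\<close>
    define w where "w = (\<Prod>x\<in>X. [:-x, 1:])"
    have w: "degree w = card X" "lead_coeff w = 1"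
    proof -
      show "degree w = card X" unfolding w_def by (subst degree_prod_eq_sum_degree) auto
      show "lead_coeff w = 1" unfolding w_def by (subst lead_coeff_prod) auto
    qed
    define h where "h = g - smult (lead_coeff g) w"
    have hZ: "(\<Sum>y\<in>Z. poly h y * (\<Phi> y * \<tau> y) / (\<Prod>x\<in>X. y - x)) = 0"
    proof (cases "h = 0")
      case False
      have "degree h \<le> card X" unfolding h_def using P w
        by (intro degree_diff_le) (auto intro: order_trans[OF degree_smult_le])
      moreover have "coeff h (card X) = 0" using P w by (simp add: h_def)
      ultimately have "degree h < card X" using False
        by (metis le_neq_implies_less leading_coeff_0_iff)
      then show ?thesis by (intro orthogonality_from_zeros[OF X(1) XZ zero]) (auto simp: P)
    qed simp
    have "poly g y * (\<Phi> y * \<tau> y) / (\<Prod>x\<in>X. y - x)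
        = poly h y * (\<Phi> y * \<tau> y) / (\<Prod>x\<in>X. y - x) + lead_coeff g * (\<Phi> y * \<tau> y)" if "y \<in> Z" for y
    proof -
      have "(\<Prod>x\<in>X. y - x) \<noteq> 0" using X XZ that by auto
      moreover have "poly w y = (\<Prod>x\<in>X. y - x)" by (simp add: w_def poly_prod)
      ultimately show ?thesis by (simp add: h_def divide_simps) (simp add: algebra_simps)
    qed
    then have "(\<Sum>y\<in>Z. poly g y * (\<Phi> y * \<tau> y) / (\<Prod>x\<in>X. y - x))
       = (\<Sum>y\<in>Z. poly h y * (\<Phi> y * \<tau> y) / (\<Prod>x\<in>X. y - x)) + lead_coeff g * (\<Sum>y\<in>Z. \<Phi> y * \<tau> y)"
      by (simp add: sum.distrib sum_distrib_left)
    then show ?thesis using hZ P by simp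
  qed
  show ?thesis
  proof (rule many_zeros_of_orthogonal[OF Z(1,2) _ Z(4,5)])
    show "\<tau>' y > 0" if "y \<in> Z" for y
      using \<epsilon> Z(2) Z(3)[OF that] that unfolding \<tau>'_def by (intro mult_pos_pos) auto
    show "(\<Sum>y\<in>Z. poly g y * \<Phi> y * \<tau>' y) = 0" if "degree g < N" for g
    proof -
      have "(\<Sum>y\<in>Z. poly g y * \<Phi> y * \<tau>' y) = \<epsilon> * (\<Sum>y\<in>Z. poly g y * (\<Phi> y * \<tau> y) / (\<Prod>x\<in>X. y - x))"
        unfolding sum_distrib_left by (intro sum.cong) (auto simp: \<tau>'_def)
      then show ?thesis using orth[OF that] by simp
    qed
  qed
qed

section \<open>The reciprocal of a Cauchy sum\<close>

text \<open>
  Write \<open>f = Q/P\<close> with the nodal polynomial \<open>P\<close> of \<open>Z\<close>. The values of \<open>Q\<close> on \<open>Z\<close> are \<open>\<rho>\<close> times those of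
  \<open>P'\<close>, which makes \<open>Q\<close> orthogonal to low degrees for positive weights; hence \<open>Q\<close> has at least
  \<open>card Z - 1\<close> zeros in the interval. As \<open>Q\<close> has degree at most \<open>card Z\<close> and \<open>f\<close> does not vanish
  outside, all its zeros are real and in the interval. At a zero, \<open>f' = - \<Sum> \<rho>/(z - y)\<^sup>2\<close> is
  negative, so the zeros are simple and the residues \<open>1/f'(z)\<close> of \<open>P/Q\<close> are negative.
\<close>

lemma reciprocal_of_cauchy_sum:
  fixes \<rho> :: "real \<Rightarrow> real" and c :: real and Z :: "real set"
  defines "f \<equiv> \<lambda>x. c + (\<Sum>y\<in>Z. \<rho> y / (x - y))"
  assumes Z: "finite Z" "Z \<noteq> {}" "Z \<subseteq> {a..b}" and pos: "\<And>y. y \<in> Z \<Longrightarrow> \<rho> y > 0"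
    and nz: "\<And>x. x \<notin> {a..b} \<Longrightarrow> f x \<noteq> 0"
  shows "\<exists>Z' \<tau> l0 l1. finite Z' \<and> Z' \<subseteq> {a..b} \<and> card Z \<le> card Z' + 1 \<and> (\<forall>z\<in>Z'. \<tau> z < 0) \<and>
    (\<forall>x. x \<notin> Z \<longrightarrow> x \<notin> Z' \<longrightarrow> f x \<noteq> 0 \<and> 1 / f x = l0 + l1 * x + (\<Sum>z\<in>Z'. \<tau> z / (x - z)))"
proof -
  define n where "n = card Z"
  have n: "n \<ge> 1" using Z by (simp add: n_def Suc_le_eq card_gt_0_iff)
  define P :: "real poly" where "P = (\<Prod>y\<in>Z. [:-y, 1:])"
  define Py :: "real \<Rightarrow> real poly" where "Py y = (\<Prod>u\<in>Z-{y}. [:-u, 1:])" for y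
  define Q where "Q = smult c P + (\<Sum>y\<in>Z. smult (\<rho> y) (Py y))"
  have PPy: "P = [:-y, 1:] * Py y" if "y \<in> Z" for y
    using that Z by (simp add: P_def Py_def prod.remove)
  have degP: "degree P = n" unfolding P_def n_def by (subst degree_prod_eq_sum_degree) auto
  have degPy: "degree (Py y) = n - 1" if "y \<in> Z" for y
    unfolding Py_def n_def using that Z by (subst degree_prod_eq_sum_degree) auto
  have degS: "degree (\<Sum>y\<in>Z. smult (\<rho> y) (Py y)) \<le> n - 1"
    using Z degPy by (intro degree_sum_le) (auto intro: order_trans[OF degree_smult_le])
  have degQ: "degree Q \<le> (if c = 0 then n - 1 else n)"
    using degS degP unfolding Q_def by (auto intro!: degree_add_le order_trans[OF degree_smult_le])
  have polyP: "poly P x \<noteq> 0" if "x \<notin> Z" for x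
    using that Z by (auto simp: P_def poly_prod)
  have PyP: "poly (Py y) x = poly P x / (x - y)" if "y \<in> Z" "x \<notin> Z" for x y
  proof -
    have "x - y \<noteq> 0" using that by auto
    then show ?thesis using PPy[OF that(1)] by (simp add: divide_simps) (simp add: algebra_simps)
  qed
  have Qf: "poly Q x = f x * poly P x" if "x \<notin> Z" for x
    using that by (simp add: Q_def f_def poly_sum PyP distrib_right sum_distrib_right)
  have Py_at: "poly (Py y) z = (if z = y then (\<Prod>u\<in>Z-{y}. y - u) else 0)" if "y \<in> Z" "z \<in> Z" for y z
    using that Z by (auto simp: Py_def poly_prod)
  have QZ: "poly Q y = \<rho> y * (\<Prod>u\<in>Z-{y}. y - u)" if "y \<in> Z" for y
  proof -
    have "poly P y = 0" using PPy[OF that] by simp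
    then have "poly Q y = (\<Sum>z\<in>Z. \<rho> z * poly (Py z) y)" by (simp add: Q_def poly_sum)
    also have "\<dots> = (\<Sum>z\<in>Z. if z = y then \<rho> y * (\<Prod>u\<in>Z-{y}. y - u) else 0)"
      by (intro sum.cong) (use that Py_at in auto)
    finally show ?thesis using that Z by simp
  qed
  have prodnz: "(\<Prod>u\<in>Z-{y}. y - u) \<noteq> 0" for y using Z by auto
  have root_notin: "x \<notin> Z" if "poly Q x = 0" for x
    using QZ[of x] that pos[of x] prodnz[of x] by auto
  have root_in: "x \<in> {a..b}" if "poly Q x = 0" for x
    using Qf[of x] nz[of x] polyP[of x] root_notin[OF that] that by auto
  have root_f: "f x = 0" if "poly Q x = 0" for x
    using Qf[of x] polyP[of x] root_notin[OF that] that by auto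
  \<comment> \<open>At a zero \<open>z\<close> of \<open>Q\<close>, the polynomial \<open>- G z\<close> is the cofactor
    of \<open>x - z\<close>; its value at \<open>z\<close> decides simplicity.\<close>
  define G where "G z = (\<Sum>y\<in>Z. smult (\<rho> y / (z - y)) (Py y))" for z
  have G: "Q = [:-z, 1:] * (- G z)" if "poly Q z = 0" for z
  proof -
    have "[:-z, 1:] * G z = (\<Sum>y\<in>Z. smult (\<rho> y / (z - y)) P - smult (\<rho> y) (Py y))"
      unfolding G_def sum_distrib_left
    proof (intro sum.cong refl)
      fix y assume "y \<in> Z"
      then have zy: "z - y \<noteq> 0" using root_notin[OF that] by auto
      have "[:-z, 1:] * Py y = [:-y, 1:] * Py y + smult (y - z) (Py y)"
        by (simp add: smult_diff_left)
      then have "[:-z, 1:] * smult (\<rho> y / (z - y)) (Py y)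
         = smult (\<rho> y / (z - y)) ([:-y, 1:] * Py y) + smult ((y - z) * (\<rho> y / (z - y))) (Py y)"
        by (simp only: mult_smult_right smult_add_right smult_smult mult.commute)
      also have "(y - z) * (\<rho> y / (z - y)) = - \<rho> y" using zy by (simp add: divide_simps) (simp add: algebra_simps)
      finally show "[:-z, 1:] * smult (\<rho> y / (z - y)) (Py y) = smult (\<rho> y / (z - y)) P - smult (\<rho> y) (Py y)"
        using PPy[OF \<open>y \<in> Z\<close>] by simp
    qed
    also have "\<dots> = smult (\<Sum>y\<in>Z. \<rho> y / (z - y)) P - (\<Sum>y\<in>Z. smult (\<rho> y) (Py y))"
      by (simp add: sum_subtractf smult_sum)
    also have "(\<Sum>y\<in>Z. \<rho> y / (z - y)) = - c" using root_f[OF that] by (simp add: f_def)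
    finally have "[:-z, 1:] * G z = - Q" by (simp add: Q_def)
    then show ?thesis by simp
  qed
  \<comment> \<open>This is minus the derivative of \<open>f\<close> at \<open>z\<close>.\<close>
  define S where "S z = (\<Sum>y\<in>Z. \<rho> y / (z - y)^2)" for z
  have S: "S z > 0" if "poly Q z = 0" for z
    unfolding S_def
  proof (intro sum_pos Z)
    fix y assume "y \<in> Z"
    then have "z - y \<noteq> 0" "\<rho> y > 0" using pos root_notin[OF that] by auto
    then show "\<rho> y / (z - y)^2 > 0" by simp
  qed
  have polyG: "poly (G z) z = poly P z * S z" if "poly Q z = 0" for z
    using root_notin[OF that]
    by (simp add: G_def S_def poly_sum PyP sum_distrib_left power2_eq_square mult.commute)
  obtain X where X: "finite X" "card X = n - 1" "\<forall>x\<in>X. poly Q x = 0"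
  proof -
    have "\<exists>X. finite X \<and> X \<subseteq> {a..b} \<and> card X = n - 1 \<and> (\<forall>x\<in>X. poly Q x = 0)"
    \<comment> \<open>With these weights the sum is a divided difference of \<open>g\<close>.\<close>
    proof (rule many_zeros_of_orthogonal[of Z _ _ "\<lambda>y. 1 / (\<rho> y * (\<Prod>u\<in>Z-{y}. y - u)^2)"])
      show "1 / (\<rho> y * (\<Prod>u\<in>Z-{y}. y - u)^2) > 0" if "y \<in> Z" for y
        using pos[OF that] prodnz[of y] by (simp add: zero_less_divide_iff zero_less_mult_iff)
      show "(\<Sum>y\<in>Z. poly g y * poly Q y * (1 / (\<rho> y * (\<Prod>u\<in>Z-{y}. y - u)^2))) = 0"
        if g: "degree g < n - 1" for g
      proof -
      have "(\<Sum>y\<in>Z. poly g y * poly Q y * (1 / (\<rho> y * (\<Prod>u\<in>Z-{y}. y - u)^2)))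
          = (\<Sum>y\<in>Z. poly g y / (\<Prod>u\<in>Z-{y}. y - u))"
      proof (intro sum.cong refl)
        fix y assume "y \<in> Z"
        then have "\<rho> y \<noteq> 0" using pos by force
        then show "poly g y * poly Q y * (1 / (\<rho> y * (\<Prod>u\<in>Z-{y}. y - u)^2)) = poly g y / (\<Prod>u\<in>Z-{y}. y - u)"
          using QZ[OF \<open>y \<in> Z\<close>] prodnz[of y] by (simp add: power2_eq_square)
      qed
      also have "\<dots> = 0" using g by (intro sum_divided_differences_zero Z) (simp add: n_def)
      finally show ?thesis .
      qed
      show "continuous_on {a..b} (poly Q)"
        by (intro continuous_at_imp_continuous_on ballI poly_isCont)
    qed (use Z in \<open>auto simp: n_def\<close>)
    then show ?thesis using that by blast
  qed
  have Q0: "Q \<noteq> 0" using QZ pos prodnz Z by (metis all_not_in_conv less_irrefl mult_eq_0_iff poly_0)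
  define w :: "real poly" where "w = (\<Prod>x\<in>X. [:-x, 1:])"
  have w: "w \<noteq> 0" "degree w = n - 1" "\<And>x. x \<in> X \<Longrightarrow> poly w x = 0"
  proof -
    show "w \<noteq> 0" unfolding w_def using X by (auto simp: prod_zero_iff)
    show "degree w = n - 1" unfolding w_def X(2)[symmetric] by (subst degree_prod_eq_sum_degree) auto
    show "\<And>x. x \<in> X \<Longrightarrow> poly w x = 0" unfolding w_def using X by (auto simp: poly_prod)
  qed
  \<comment> \<open>The cofactor \<open>q\<close> of the zeros found so far has degree at most 1 and supplies at most
    one more zero.\<close>
  define q where "q = Q div w"
  have Qqw: "Q = q * w"
  proof -
    have "Q mod w = 0"
    proof (cases "degree w = 0")
      case True
      then show ?thesis using w(1) by (metis mod_eq_0_iff_dvd is_unit_iff_degree unit_imp_dvd)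
    next
      case False
      then have d: "degree (Q mod w) < card X" using degree_mod_less[OF w(1), of Q] w(2) X(2) by auto
      have "poly (Q mod w) x = poly 0 x" if "x \<in> X" for x
      proof -
        have "poly Q x = poly (Q div w) x * poly w x + poly (Q mod w) x"
          by (metis div_mult_mod_eq poly_add poly_mult)
        then show ?thesis using w(3)[OF that] X(3) that by simp
      qed
      then show ?thesis using d by (intro poly_eqI_degree[of X]) auto
    qed
    then show ?thesis unfolding q_def by (metis add.right_neutral div_mult_mod_eq)
  qed
  have q0: "q \<noteq> 0" using Q0 Qqw by auto
  have degq: "degree q \<le> (if c = 0 then 0 else 1)"
  proof -
    have "degree q + (n - 1) = degree Q" unfolding Qqw using q0 w by (simp add: degree_mult_eq)
    then show ?thesis using degQ n by (auto split: if_splits)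
  qed
  obtain Z' \<kappa> where Z': "finite Z'" "\<And>z. z \<in> Z' \<Longrightarrow> poly Q z = 0" "Q = smult \<kappa> (\<Prod>z\<in>Z'. [:-z, 1:])" "card Z' \<ge> n - 1" "\<kappa> \<noteq> 0"
  proof (cases "degree q = 0")
    case True
    then obtain k where k: "q = [:k:]" by (rule degree_eq_zeroE)
    then show ?thesis using that[of X k] X Qqw q0 by (auto simp: w_def)
  next
    case False
    then have "degree q = 1" using degq by (auto split: if_splits)
    then obtain k0 k1 where k: "q = [:k0, k1:]" "k1 \<noteq> 0" using degree1_coeffs by blast
    define \<xi> where "\<xi> = - k0 / k1"
    have q: "q = smult k1 [:-\<xi>, 1:]" using k by (simp add: \<xi>_def)
    have Q\<xi>: "poly Q \<xi> = 0" by (simp add: Qqw q)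
    have "\<xi> \<notin> X"
    proof
      assume "\<xi> \<in> X"
      then have "w = [:-\<xi>, 1:] * (\<Prod>x\<in>X-{\<xi>}. [:-x, 1:])" unfolding w_def using X by (simp add: prod.remove)
      then have "[:-\<xi>, 1:] * (- G \<xi>) = [:-\<xi>, 1:] * (q * (\<Prod>x\<in>X-{\<xi>}. [:-x, 1:]))"
        using G[OF Q\<xi>] Qqw by (simp add: mult_ac)
      then have "- G \<xi> = q * (\<Prod>x\<in>X-{\<xi>}. [:-x, 1:])" by (subst (asm) mult_cancel_left) auto
      then have "poly (- G \<xi>) \<xi> = 0" by (simp add: q)
      then show False using polyG[OF Q\<xi>] S[OF Q\<xi>] polyP[OF root_notin[OF Q\<xi>]] by simp
    qed
    then have "(\<Prod>z\<in>insert \<xi> X. [:-z, 1:]) = [:-\<xi>, 1:] * w"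
      unfolding w_def using X by (intro prod.insert) auto
    then have "Q = smult k1 (\<Prod>z\<in>insert \<xi> X. [:-z, 1:])" by (simp only: Qqw q mult_smult_left)
    then show ?thesis using that[of "insert \<xi> X" k1] X Q\<xi> k(2) \<open>\<xi> \<notin> X\<close> by auto
  qed
  define W :: "real poly" where "W = (\<Prod>z\<in>Z'. [:-z, 1:])"
  have W: "W \<noteq> 0" "degree W = card Z'"
  proof -
    show "W \<noteq> 0" unfolding W_def using Z' by (auto simp: prod_zero_iff)
    show "degree W = card Z'" unfolding W_def by (subst degree_prod_eq_sum_degree) auto
  qed
  define l r where "l = P div W" and "r = P mod W"
  have Plr: "P = l * W + r" by (simp add: l_def r_def)
  have r: "r = 0 \<or> degree r < card Z'" using degree_mod_less[OF W(1), of P] W(2) by (auto simp: r_def)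
  have degl: "degree l \<le> 1"
  proof -
    have "card Z' \<le> n" using degQ W Z'(3,5) n by (auto simp: W_def split: if_splits)
    show ?thesis
    proof (cases "l = 0")
      case False
      have "degree (l * W + r) = degree (l * W)" if "r \<noteq> 0"
        using r that False W by (intro degree_add_eq_left) (simp add: degree_mult_eq)
      then have "degree P = degree l + degree W" using Plr False W(1) by (cases "r = 0") (auto simp: degree_mult_eq)
      then show ?thesis using degP W(2) Z'(4) by simp
    qed simp
  qed
  then have polyl: "poly l x = coeff l 0 + coeff l 1 * x" for x

    by (cases l) (use degl in \<open>auto simp: degree_pCons_eq_if split: if_splits elim!: degree_eq_zeroE\<close>)
  define \<tau> where "\<tau> z = - 1 / S z" for z
  have rz: "poly r z = poly P z" if "z \<in> Z'" for z
  proof -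
    have "poly W z = 0" using that Z' by (auto simp: W_def poly_prod)
    then show ?thesis using arg_cong[OF Plr, of "\<lambda>p. poly p z"] by simp
  qed
  have W': "\<kappa> * (\<Prod>u\<in>Z'-{z}. z - u) = - poly P z * S z" if "z \<in> Z'" for z
  proof -
    have "[:-z, 1:] * (- G z) = [:-z, 1:] * smult \<kappa> (\<Prod>u\<in>Z'-{z}. [:-u, 1:])"
      using G[OF Z'(2)[OF that]] Z'(1,3) that by (simp add: prod.remove)
    then have "- G z = smult \<kappa> (\<Prod>u\<in>Z'-{z}. [:-u, 1:])" by (subst (asm) mult_cancel_left) auto
    then have "poly (- G z) z = \<kappa> * (\<Prod>u\<in>Z'-{z}. z - u)" by (simp add: poly_prod)
    then show ?thesis using polyG[OF Z'(2)[OF that]] by simp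
  qed
  have main: "f x \<noteq> 0 \<and> 1 / f x = coeff l 0 / \<kappa> + coeff l 1 / \<kappa> * x + (\<Sum>z\<in>Z'. \<tau> z / (x - z))"
    if x: "x \<notin> Z" "x \<notin> Z'" for x
  proof -
    have Wx: "poly W x = (\<Prod>u\<in>Z'. x - u)" by (simp add: W_def poly_prod)
    then have Wx0: "poly W x \<noteq> 0" using x Z' by auto
    have QW: "poly Q x = \<kappa> * poly W x" using Z'(3) by (simp add: W_def)
    then have fx: "f x \<noteq> 0" using Qf[OF x(1)] Wx0 Z'(5) by auto
    have "1 / f x = poly P x / poly Q x" using Qf[OF x(1)] polyP[OF x(1)] fx by simp
    also have "\<dots> = (poly l x * poly W x + poly r x) / (\<kappa> * poly W x)"
      using QW arg_cong[OF Plr, of "\<lambda>p. poly p x"] by simp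
    also have "\<dots> = poly l x / \<kappa> + (poly r x / (\<Prod>u\<in>Z'. x - u)) / \<kappa>"
      using Wx Wx0 Z'(5) by (simp add: add_divide_distrib)
    also have "poly r x / (\<Prod>u\<in>Z'. x - u) = (\<Sum>z\<in>Z'. poly r z / (\<Prod>u\<in>Z'-{z}. z - u) / (x - z))"
      using r lagrange_partial_fractions[OF Z'(1) _ x(2), of r] by auto
    also have "\<dots> / \<kappa> = (\<Sum>z\<in>Z'. \<tau> z / (x - z))"
      unfolding sum_divide_distrib
    proof (intro sum.cong refl)
      fix z assume z: "z \<in> Z'"
      have "poly r z / (\<kappa> * (\<Prod>u\<in>Z'-{z}. z - u)) = \<tau> z"
        unfolding W'[OF z] rz[OF z] \<tau>_def using S[OF Z'(2)[OF z]] polyP[OF root_notin[OF Z'(2)[OF z]]] by simp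
      then show "poly r z / (\<Prod>u\<in>Z'-{z}. z - u) / (x - z) / \<kappa> = \<tau> z / (x - z)"
        by (metis divide_divide_eq_left mult.commute)
    qed
    finally show ?thesis using fx by (simp add: polyl add_divide_distrib)
  qed
  have "card Z \<le> card Z' + 1" using Z'(4) by (simp add: n_def)
  moreover have "Z' \<subseteq> {a..b}" using Z'(2) root_in by auto
  moreover have "\<forall>z\<in>Z'. \<tau> z < 0" using S[OF Z'(2)] by (simp add: \<tau>_def)
  ultimately show ?thesis using Z'(1) main by blast
qed

section \<open>Towers of Cauchy sums over finite sets\<close>

text \<open>
  The recursion descends from the level \<open>k\<close>: after \<open>n\<close> steps the measures at the levels
  \<open>k - n + 1, \<dots>, k\<close> have been summed.
\<close>

primrec iterated_cauchy_sum :: "(nat \<Rightarrow> real set) \<Rightarrow> (nat \<Rightarrow> real \<Rightarrow> real) \<Rightarrow> nat \<Rightarrow> nat \<Rightarrow> real \<Rightarrow> real" where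
  "iterated_cauchy_sum Y \<mu> 0 k x = 1"
| "iterated_cauchy_sum Y \<mu> (Suc n) k x =
     (\<Sum>y\<in>Y (k - n). \<mu> (k - n) y * iterated_cauchy_sum Y \<mu> n k y / (x - y))"

text \<open>
  The discrete analogue of the transforms of \<open>\<langle>\<sigma>\<^sub>q\<^sub>+\<^sub>1, \<dots>, \<sigma>\<^sub>k\<rangle>\<close>. The values 1 on the
  diagonal and 0 below it make the matrix with rows \<open>q\<close> and columns \<open>k\<close> unitriangular.
\<close>

definition cauchy_tower :: "(nat \<Rightarrow> real set) \<Rightarrow> (nat \<Rightarrow> real \<Rightarrow> real) \<Rightarrow> nat \<Rightarrow> nat \<Rightarrow> real \<Rightarrow> real" where
  "cauchy_tower Y \<mu> q k x = (if k < q then 0 else iterated_cauchy_sum Y \<mu> (k - q) k x)"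

lemma cauchy_tower_less: "k < q \<Longrightarrow> cauchy_tower Y \<mu> q k x = 0"
  by (simp add: cauchy_tower_def)

lemma cauchy_tower_same [simp]: "cauchy_tower Y \<mu> q q x = 1"
  by (simp add: cauchy_tower_def)

lemma cauchy_tower_step:
  assumes "q < k"
  shows "cauchy_tower Y \<mu> q k x = (\<Sum>y\<in>Y (Suc q). \<mu> (Suc q) y * cauchy_tower Y \<mu> (Suc q) k y / (x - y))"
proof -
  have "k - q = Suc (k - Suc q)" "k - (k - Suc q) = Suc q" using assms by auto
  then show ?thesis using assms by (simp add: cauchy_tower_def)
qed

lemma dual_vector_exists:
  fixes M :: "'a \<Rightarrow> 'b \<Rightarrow> 'f::field"
  assumes "finite P" "finite S" "card P = card S"
    and inj: "\<And>c. (\<And>p. p \<in> P \<Longrightarrow> (\<Sum>k\<in>S. M p k * c k) = 0) \<Longrightarrow> \<forall>k\<in>S. c k = 0"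
    and p: "p \<in> P"
  shows "\<exists>c. \<forall>p'\<in>P. (\<Sum>k\<in>S. M p' k * c k) = (if p' = p then 1 else 0)"
proof -
  have "card (P - {p}) < card S" using assms(1,3) p by (metis card_Diff1_less)
  then obtain x where x: "\<exists>b\<in>S. x b \<noteq> 0" "\<forall>a\<in>P-{p}. (\<Sum>b\<in>S. M a b * x b) = 0"
    using homogeneous_system_solvable[of "P - {p}" S M] assms(1,2) by auto
  define d where "d = (\<Sum>k\<in>S. M p k * x k)"
  have "d \<noteq> 0" using inj[of x] x by (auto simp: d_def)
  have "(\<Sum>k\<in>S. M p' k * (x k / d)) = (\<Sum>k\<in>S. M p' k * x k) / d" for p'
    by (simp add: sum_divide_distrib)
  then show ?thesis using x(2) \<open>d \<noteq> 0\<close> by (intro exI[of _ "\<lambda>k. x k / d"]) (auto simp: d_def)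
qed

text \<open>
  Positive point masses \<open>\<mu> q\<close> on \<open>Y q\<close> at the levels \<open>1, \<dots>, m\<close>. Zero counts need many nodes, so \<open>K\<close>
  bounds their number from below. The set \<open>I q\<close> is empty at all other levels, which lets
  statements about \<open>I (Suc q)\<close> include the last level without a separate case.
\<close>

locale atomic_nikishin =
  fixes m :: nat and lo hi :: "nat \<Rightarrow> real" and Y :: "nat \<Rightarrow> real set" and \<mu> :: "nat \<Rightarrow> real \<Rightarrow> real" and K :: nat
  fixes I :: "nat \<Rightarrow> real set"
  defines "I q \<equiv> (if 1 \<le> q \<and> q \<le> m then {lo q..hi q} else {})"
  assumes finite_Y [simp]: "finite (Y q)"
    and Y_subset: "Y q \<subseteq> I q"
    and I_disjoint: "I q \<inter> I (Suc q) = {}"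
    and card_Y: "1 \<le> q \<Longrightarrow> q \<le> m \<Longrightarrow> K \<le> card (Y q)"
    and mass_pos: "y \<in> Y q \<Longrightarrow> \<mu> q y > 0"
    and K_large: "m + 1 \<le> K"
begin

abbreviation v where "v \<equiv> cauchy_tower Y \<mu>"

lemma Y_beyond: "q > m \<Longrightarrow> Y q = {}"
  using Y_subset[of q] by (simp add: I_def)

lemma Y_disjoint: "Y q \<inter> I (Suc q) = {}" "I q \<inter> Y (Suc q) = {}" "Y q \<inter> Y (Suc q) = {}"
  using Y_subset[of q] Y_subset[of "Suc q"] I_disjoint[of q] by auto

lemma v_rec: "k \<le> m \<Longrightarrow> v q k x = (if k = q then 1 else 0) + (\<Sum>y\<in>Y (Suc q). \<mu> (Suc q) y * v (Suc q) k y / (x - y))"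
  by (cases k q rule: linorder_cases) (auto simp: cauchy_tower_less cauchy_tower_step)

lemma continuous_on_cauchy_sum:
  fixes g :: "real \<Rightarrow> real"
  assumes "finite Z"
  shows "continuous_on (- Z) (\<lambda>x. \<Sum>y\<in>Z. g y / (x - y))"
  using assms by (intro continuous_intros) auto

lemma continuous_on_v: "continuous_on (- Y (Suc q)) (v q k)"
proof (cases k q rule: linorder_cases)
  case less
  then show ?thesis by (simp add: cauchy_tower_less cong: continuous_on_cong)
next
  case equal
  then show ?thesis by (simp cong: continuous_on_cong)
next
  case greater
  then show ?thesis
    using continuous_on_cauchy_sum[OF finite_Y, of "Suc q" "\<lambda>y. \<mu> (Suc q) y * v (Suc q) k y"]
    by (simp add: cauchy_tower_step cong: continuous_on_cong)
qed

lemma combination_rec: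
  assumes "S \<subseteq> {..m}"
  shows "(\<Sum>k\<in>S. c k * v q k x) = (if q \<in> S then c q else 0)
    + (\<Sum>y\<in>Y (Suc q). \<mu> (Suc q) y * (\<Sum>k\<in>S. c k * v (Suc q) k y) / (x - y))"
proof -
  have fS: "finite S" using assms finite_subset by blast
  have "(\<Sum>k\<in>S. c k * v q k x)
     = (\<Sum>k\<in>S. (if k = q then c q else 0) + c k * (\<Sum>y\<in>Y (Suc q). \<mu> (Suc q) y * v (Suc q) k y / (x - y)))"
  proof (intro sum.cong refl)
    fix k assume "k \<in> S"
    then have "k \<le> m" using assms by auto
    then show "c k * v q k x = (if k = q then c q else 0) + c k * (\<Sum>y\<in>Y (Suc q). \<mu> (Suc q) y * v (Suc q) k y / (x - y))"
      using v_rec[of k q x] by (simp add: distrib_left)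
  qed
  also have "\<dots> = (if q \<in> S then c q else 0) + (\<Sum>k\<in>S. \<Sum>y\<in>Y (Suc q). c k * (\<mu> (Suc q) y * v (Suc q) k y / (x - y)))"
    using fS by (simp add: sum.distrib sum_distrib_left)
  also have "(\<Sum>k\<in>S. \<Sum>y\<in>Y (Suc q). c k * (\<mu> (Suc q) y * v (Suc q) k y / (x - y)))
     = (\<Sum>y\<in>Y (Suc q). \<mu> (Suc q) y * (\<Sum>k\<in>S. c k * v (Suc q) k y) / (x - y))"
    by (subst sum.swap) (simp add: sum_distrib_left sum_divide_distrib mult_ac)
  finally show ?thesis .
qed

lemma zeros_descend:
  fixes P :: "real poly"
  assumes q: "Suc q \<le> m" and cont: "continuous_on (I (Suc q)) \<Phi>" and "N \<le> m + 1"
    and X: "finite X" "X \<inter> I (Suc q) = {}"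
    and zero: "\<And>x. x \<in> X \<Longrightarrow> poly P x + (\<Sum>y\<in>Y (Suc q). \<mu> (Suc q) y * \<Phi> y / (x - y)) = 0"
    and N: "P = 0 \<and> N \<le> card X \<or> N + degree P + 1 \<le> card X
      \<or> (P = 0 \<and> (\<Sum>y\<in>Y (Suc q). \<mu> (Suc q) y * \<Phi> y) = 0 \<and> N \<le> card X + 1)"
  shows "\<exists>X'. finite X' \<and> X' \<subseteq> I (Suc q) \<and> card X' = N \<and> (\<forall>x\<in>X'. \<Phi> x = 0)"
proof -
  have I: "I (Suc q) = {lo (Suc q)..hi (Suc q)}" using q by (simp add: I_def)
  show ?thesis unfolding I
  proof (rule zeros_pass_to_density[where Z = "Y (Suc q)" and \<tau> = "\<mu> (Suc q)" and X = X and P = P])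
    show "N \<le> card (Y (Suc q))" using card_Y[of "Suc q"] q K_large assms(3) by auto
    show "Y (Suc q) \<subseteq> {lo (Suc q)..hi (Suc q)}" using Y_subset[of "Suc q"] I by simp
    show "X \<inter> {lo (Suc q)..hi (Suc q)} = {}" "continuous_on {lo (Suc q)..hi (Suc q)} \<Phi>"
      using X(2) cont I by simp_all
    show "poly P x + (\<Sum>y\<in>Y (Suc q). \<Phi> y * \<mu> (Suc q) y / (x - y)) = 0" if "x \<in> X" for x
      using zero[OF that] by (simp add: mult.commute)
    show "P = 0 \<and> N \<le> card X \<or> N + degree P + 1 \<le> card X \<or>
        P = 0 \<and> (\<Sum>y\<in>Y (Suc q). \<Phi> y * \<mu> (Suc q) y) = 0 \<and> N \<le> card X + 1"
      using N by (subst mult.commute)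
  qed (use mass_pos X(1) finite_Y in blast)+
qed

text \<open>
  The Chebyshev property for constant coefficients. Passing to the next level removes the column \<open>q\<close>,
  and its constant coefficient costs at most one zero.
\<close>

lemma chebyshev_constants:
  assumes "S \<noteq> {}" "S \<subseteq> {q..m}" "finite X" "X \<inter> I (Suc q) = {}" "card S \<le> card X"
    and "\<And>x. x \<in> X \<Longrightarrow> (\<Sum>k\<in>S. c k * v q k x) = 0" "k \<in> S"
  shows "c k = 0"
  using assms
proof (induction "m - q" arbitrary: q S X k)
  case 0
  have "{q..m} \<subseteq> {q}" using 0(1) by auto
  then have S: "S = {q}" using 0(2,3) by blast
  have "X \<noteq> {}" using 0(6) S by auto
  then obtain x where "x \<in> X" by blast
  then show ?case using 0(7)[of x] 0(8) S by simp
next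
  case (Suc n)
  have q: "Suc q \<le> m" "n = m - Suc q" using Suc.hyps(2) by auto
  have fS: "finite S" using Suc.prems(2) finite_subset by blast
  have cS: "card S \<le> m + 1" using card_mono[OF _ Suc.prems(2)] by auto
  let ?S' = "S - {q}"
  define \<Phi> where "\<Phi> y = (\<Sum>k\<in>?S'. c k * v (Suc q) k y)" for y
  have \<Phi>: "\<Phi> y = (\<Sum>k\<in>S. c k * v (Suc q) k y)" for y
    unfolding \<Phi>_def by (rule sum.mono_neutral_left) (use fS in \<open>auto simp: cauchy_tower_less\<close>)
  have cont: "continuous_on (I (Suc q)) \<Phi>"
    unfolding \<Phi>_def using Y_disjoint(2)[of "Suc q"]
    by (intro continuous_intros continuous_on_subset[OF continuous_on_v]) auto
  have F: "(\<Sum>k\<in>S. c k * v q k x) = (if q \<in> S then c q else 0) + (\<Sum>y\<in>Y (Suc q). \<mu> (Suc q) y * \<Phi> y / (x - y))" for x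
    unfolding \<Phi> by (rule combination_rec) (use Suc.prems(2) in auto)
  have rest: "c k = 0" if "k \<in> ?S'" for k
  proof -
    have "\<exists>X'. finite X' \<and> X' \<subseteq> I (Suc q) \<and> card X' = card ?S' \<and> (\<forall>x\<in>X'. \<Phi> x = 0)"
    proof (rule zeros_descend[OF q(1) cont _ Suc.prems(3,4), of _ "[:if q \<in> S then c q else 0:]"])
      show "card ?S' \<le> m + 1" using cS card_mono[of S ?S'] fS by auto
      show "poly [:if q \<in> S then c q else 0:] x + (\<Sum>y\<in>Y (Suc q). \<mu> (Suc q) y * \<Phi> y / (x - y)) = 0" if "x \<in> X" for x
        using Suc.prems(6)[OF that] F[of x] by simp
      have "card ?S' + 1 \<le> card S" if "q \<in> S" using that fS by (metis Suc_eq_plus1 card_Suc_Diff1 order_refl)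
      then show "[:if q \<in> S then c q else 0:] = 0 \<and> card ?S' \<le> card X \<or>
        card ?S' + degree [:if q \<in> S then c q else 0:] + 1 \<le> card X \<or>
        [:if q \<in> S then c q else 0:] = 0 \<and> (\<Sum>y\<in>Y (Suc q). \<mu> (Suc q) y * \<Phi> y) = 0 \<and> card ?S' \<le> card X + 1"
        using Suc.prems(5) by auto
    qed
    then obtain X' where X': "finite X'" "X' \<subseteq> I (Suc q)" "card X' = card ?S'" "\<forall>x\<in>X'. \<Phi> x = 0" by blast
    show ?thesis
    proof (rule Suc.hyps(1)[OF q(2), of ?S' X' k])
      show "X' \<inter> I (Suc (Suc q)) = {}" using X' I_disjoint[of "Suc q"] by auto
      show "?S' \<subseteq> {Suc q..m}"
      proof
        fix x assume "x \<in> ?S'"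
        then have "x \<in> {q..m}" "x \<noteq> q" using Suc.prems(2) by auto
        then show "x \<in> {Suc q..m}" by auto
      qed
      show "(\<Sum>k\<in>?S'. c k * v (Suc q) k x) = 0" if "x \<in> X'" for x
        using X'(4) that by (simp add: \<Phi>_def)
    qed (use X' that in auto)
  qed
  show ?case
  proof (cases "k = q")
    case True
    have "X \<noteq> {}" using Suc.prems(1,5) fS by auto
    then obtain x where "x \<in> X" by blast
    have "\<Phi> y = 0" for y using rest by (simp add: \<Phi>_def)
    then show ?thesis using Suc.prems(6)[OF \<open>x \<in> X\<close>] F[of x] True Suc.prems(7) by auto
  qed (use rest Suc.prems(7) in auto)
qed

text \<open>
  In a chain of pure Cauchy sums no zero is lost from one level to the next, and each vanishing
  total mass adds a zero, namely the one at infinity.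
\<close>

lemma chain_of_zeros:
  assumes "s \<le> t" "t \<le> m"
    and rec: "\<And>q x. s \<le> q \<Longrightarrow> q < t \<Longrightarrow> G q x = (\<Sum>y\<in>Y (Suc q). \<mu> (Suc q) y * G (Suc q) y / (x - y))"
    and cont: "\<And>q. s < q \<Longrightarrow> q \<le> t \<Longrightarrow> continuous_on (I q) (G q)"
    and mass: "\<And>q. s \<le> q \<Longrightarrow> q < t \<Longrightarrow> q \<notin> S \<Longrightarrow> (\<Sum>y\<in>Y (Suc q). \<mu> (Suc q) y * G (Suc q) y) = 0"
  shows "\<exists>X. finite X \<and> X \<subseteq> I t \<and> card X = card ({s..<t} - S) \<and> (\<forall>x\<in>X. G t x = 0)"
  using assms
proof (induction t rule: dec_induct)
  case base
  then show ?case by (intro exI[of _ "{}"]) auto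
next
  case (step n)
  have "\<exists>X. finite X \<and> X \<subseteq> I n \<and> card X = card ({s..<n} - S) \<and> (\<forall>x\<in>X. G n x = 0)"
    by (rule step.IH) (use step.prems(1) in \<open>auto intro: step.prems(2-)\<close>)
  then obtain X where X: "finite X" "X \<subseteq> I n" "card X = card ({s..<n} - S)" "\<forall>x\<in>X. G n x = 0"
    by blast
  have c: "card ({s..<Suc n} - S) = card ({s..<n} - S) + (if n \<in> S then 0 else 1)"
  proof (cases "n \<in> S")
    case False
    then have "{s..<Suc n} - S = insert n ({s..<n} - S)" using step.hyps by auto
    then show ?thesis using False by simp
  next
    case True
    then have "{s..<Suc n} - S = {s..<n} - S" using step.hyps by (auto simp: less_Suc_eq)
    then show ?thesis using True by simp
  qed
  show ?case
  proof (rule zeros_descend[OF _ _ _ X(1), of _ _ _ 0])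
    show "card ({s..<Suc n} - S) \<le> m + 1"
      using card_mono[of "{s..<Suc n}" "{s..<Suc n} - S"] step.prems(1) by auto
    show "X \<inter> I (Suc n) = {}" using X I_disjoint[of n] by auto
    show "0 = 0 \<and> card ({s..<Suc n} - S) \<le> card X \<or>
      card ({s..<Suc n} - S) + degree (0::real poly) + 1 \<le> card X \<or>
      0 = 0 \<and> (\<Sum>y\<in>Y (Suc n). \<mu> (Suc n) y * G (Suc n) y) = 0 \<and> card ({s..<Suc n} - S) \<le> card X + 1"
      using c X(3) step.prems(4)[of n] step.hyps by auto
    show "poly 0 x + (\<Sum>y\<in>Y (Suc n). \<mu> (Suc n) y * G (Suc n) y / (x - y)) = 0" if "x \<in> X" for x
      using X(4) that step.prems(2)[of n x] step.hyps by auto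
  qed (use step.prems(1) step.hyps in \<open>auto intro: step.prems(3)\<close>)
qed

section \<open>Regularized evaluation at a point\<close>

primrec divided_level :: "nat \<Rightarrow> real \<Rightarrow> nat \<Rightarrow> nat \<Rightarrow> real \<Rightarrow> real" where
  "divided_level t z k 0 x = v t k x / (x - z)"
| "divided_level t z k (Suc n) x = (\<Sum>y\<in>Y (t - n). \<mu> (t - n) y * divided_level t z k n y / (x - y))"

text \<open>
  Row \<open>q\<close> of the tower divided by \<open>x - z\<close>. Literally dividing would create a pole at \<open>z\<close>; here the
  division takes place at the level \<open>t\<close> only and is carried down by Cauchy sums. By
  \<open>tower_expansion\<close>, the error is a combination of the rows \<open>q, \<dots>, t - 1\<close> whose coefficients do
  not depend on \<open>x\<close>.
\<close>

definition divided :: "nat \<Rightarrow> real \<Rightarrow> nat \<Rightarrow> nat \<Rightarrow> real \<Rightarrow> real" where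
  "divided t z k q = divided_level t z k (t - q)"

text \<open>
  These are the coefficients in \<open>tower_expansion\<close>. At \<open>x = z\<close> the latter expresses the rows
  \<open>s, \<dots>, t - 1\<close> of the tower through the vectors \<open>evaluation t z p\<close> with \<open>s \<le> p < t\<close>, by a
  unitriangular matrix. The span is thus the same, but row \<open>q\<close> has poles on \<open>Y (Suc q)\<close>,
  whereas the evaluations are continuous in \<open>z\<close> off \<open>Y t\<close>.
\<close>

definition evaluation :: "nat \<Rightarrow> real \<Rightarrow> nat \<Rightarrow> nat \<Rightarrow> real" where
  "evaluation t z q k = (if k = q then 1 else 0) - (\<Sum>y\<in>Y (Suc q). \<mu> (Suc q) y * divided t z k (Suc q) y)"

lemma divided_top: "divided t z k t x = v t k x / (x - z)"
  by (simp add: divided_def)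

lemma divided_step:
  assumes "q < t"
  shows "divided t z k q x = (\<Sum>y\<in>Y (Suc q). \<mu> (Suc q) y * divided t z k (Suc q) y / (x - y))"
proof -
  have "t - q = Suc (t - Suc q)" "t - (t - Suc q) = Suc q" using assms by auto
  then show ?thesis by (simp add: divided_def)
qed

text \<open>
  In the Cauchy sum for row \<open>q\<close>, insert the expansion of row \<open>Suc q\<close> and use
  \<open>(y - z)/(x - y) = (x - z)/(x - y) - 1\<close>: the constant term is absorbed by the evaluation.
\<close>

lemma tower_expansion:
  assumes "q \<le> t" "z \<notin> Y t" "x \<notin> Y (Suc q)" "q = t \<Longrightarrow> x \<noteq> z" "k \<le> m"
  shows "v q k x = (x - z) * divided t z k q x + (\<Sum>p=q..<t. evaluation t z p k * v q p x)"
  using assms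
proof (induction q arbitrary: x rule: inc_induct)
  case base
  then show ?case by (simp add: divided_top)
next
  case (step q)
  let ?d = "divided t z k (Suc q)" and ?\<mu> = "\<mu> (Suc q)"
  have "(\<Sum>y\<in>Y (Suc q). ?\<mu> y * v (Suc q) k y / (x - y))
     = (\<Sum>y\<in>Y (Suc q). (x - z) * (?\<mu> y * ?d y / (x - y)) - ?\<mu> y * ?d y
         + (\<Sum>p=Suc q..<t. evaluation t z p k * (?\<mu> y * v (Suc q) p y / (x - y))))"
  proof (intro sum.cong refl)
    fix y assume y: "y \<in> Y (Suc q)"
    have yx: "x - y \<noteq> 0" using y step.prems(2) by auto
    have vy: "v (Suc q) k y = (y - z) * ?d y + (\<Sum>p=Suc q..<t. evaluation t z p k * v (Suc q) p y)"
      using y Y_disjoint(3)[of "Suc q"] step.prems by (intro step.IH) auto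
    have "?\<mu> y * ((y - z) * ?d y) / (x - y) = (x - z) * (?\<mu> y * ?d y / (x - y)) - ?\<mu> y * ?d y"
      using yx by (simp add: field_simps)
    then show "?\<mu> y * v (Suc q) k y / (x - y) = (x - z) * (?\<mu> y * ?d y / (x - y)) - ?\<mu> y * ?d y
         + (\<Sum>p=Suc q..<t. evaluation t z p k * (?\<mu> y * v (Suc q) p y / (x - y)))"
      unfolding vy by (simp add: distrib_left add_divide_distrib sum_distrib_left sum_divide_distrib mult_ac)
  qed
  also have "\<dots> = (x - z) * divided t z k q x - (\<Sum>y\<in>Y (Suc q). ?\<mu> y * ?d y)
      + (\<Sum>p=Suc q..<t. evaluation t z p k * v q p x)"
  proof -
    have "(\<Sum>y\<in>Y (Suc q). \<Sum>p=Suc q..<t. evaluation t z p k * (?\<mu> y * v (Suc q) p y / (x - y)))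
        = (\<Sum>p=Suc q..<t. evaluation t z p k * v q p x)"
      by (subst sum.swap) (auto intro!: sum.cong simp: cauchy_tower_step[of q] sum_distrib_left)
    then show ?thesis
      using step.hyps by (simp add: sum.distrib sum_subtractf divided_step sum_distrib_left)
  qed
  finally have "v q k x = (x - z) * divided t z k q x + (evaluation t z q k + (\<Sum>p=Suc q..<t. evaluation t z p k * v q p x))"
    using v_rec[OF \<open>k \<le> m\<close>, of q x] by (simp add: evaluation_def)
  then show ?case using step.hyps by (simp add: sum.atLeast_Suc_lessThan)
qed

lemma continuous_on_evaluation:
  assumes "q < t" "t \<le> m + 1"
  shows "continuous_on (- Y t) (\<lambda>z. evaluation t z q k)"
proof -
  have "continuous_on (- Y t) (\<lambda>z. divided t z k p y)" if "y \<in> Y p" "p \<le> t" for p y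
    using that(2,1)
  proof (induction p arbitrary: y rule: inc_induct)
    case base
    then show ?case unfolding divided_top by (intro continuous_intros) auto
  next
    case (step p)
    show ?case
      unfolding divided_step[OF step.hyps(2)]
    proof (intro continuous_on_sum continuous_on_divide continuous_on_mult continuous_on_const step.IH ballI)
      fix u assume "u \<in> Y (Suc p)"
      then show "y - u \<noteq> 0" using step.prems Y_disjoint(3)[of p] by auto
    qed
  qed
  then show ?thesis unfolding evaluation_def using assms
    by (intro continuous_intros) auto
qed

lemma card_indices_above:
  assumes "S \<subseteq> {s..m}" "card S = t - s" "s \<le> t"
  shows "card ({s..<t} - S) = card (S \<inter> {t..m})"
proof -
  have fS: "finite S" using assms(1) finite_subset by blast
  have "S = (S \<inter> {s..<t}) \<union> (S \<inter> {t..m})" using assms(1) by auto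
  then have "card S = card (S \<inter> {s..<t}) + card (S \<inter> {t..m})"
    using fS by (subst card_Un_disjoint[symmetric]) auto
  moreover have "card ({s..<t} - S) = (t - s) - card (S \<inter> {s..<t})"
    by (metis Int_commute card_Diff_subset_Int card_atLeastLessThan finite_Int finite_atLeastLessThan)
  ultimately show ?thesis using assms(2) by simp
qed

text \<open>
  Every index of \<open>{s..<t}\<close> missing in \<open>S\<close> contributes a zero to the chain, and \<open>S\<close> has as many
  indices from \<open>t\<close> on as it misses below \<open>t\<close>. So the combination of row \<open>t\<close> has too many zeros.
\<close>

lemma chain_kills_high_indices:
  assumes S: "S \<subseteq> {s..m}" "card S = t - s" and t: "s \<le> t" "t \<le> m + 1"
    and rec: "\<And>q x. s \<le> q \<Longrightarrow> q < t \<Longrightarrow> G q x = (\<Sum>y\<in>Y (Suc q). \<mu> (Suc q) y * G (Suc q) y / (x - y))"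
    and cont: "\<And>q. s < q \<Longrightarrow> q \<le> t \<Longrightarrow> continuous_on (I q) (G q)"
    and mass: "\<And>q. s \<le> q \<Longrightarrow> q < t \<Longrightarrow> q \<notin> S \<Longrightarrow> (\<Sum>y\<in>Y (Suc q). \<mu> (Suc q) y * G (Suc q) y) = 0"
    and top: "\<And>x. x \<in> I t \<Longrightarrow> G t x = 0 \<Longrightarrow> (\<Sum>k\<in>S. c k * v t k x) = 0"
    and k: "k \<in> S" "t \<le> k"
  shows "c k = 0"
proof -
  have fS: "finite S" using S(1) finite_subset by blast
  have tm: "t \<le> m" using k S by auto
  obtain X where X: "finite X" "X \<subseteq> I t" "card X = card ({s..<t} - S)" "\<forall>x\<in>X. G t x = 0"
    using chain_of_zeros[OF t(1) tm, of G S] rec cont mass by blast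
  show ?thesis
  proof (rule chebyshev_constants[of "S \<inter> {t..m}" t X])
    show "card (S \<inter> {t..m}) \<le> card X" using X(3) card_indices_above[OF S t(1)] by simp
    show "X \<inter> I (Suc t) = {}" using X(2) I_disjoint[of t] by auto
    show "(\<Sum>k\<in>S \<inter> {t..m}. c k * v t k x) = 0" if "x \<in> X" for x
    proof -
      have "(\<Sum>k\<in>S \<inter> {t..m}. c k * v t k x) = (\<Sum>k\<in>S. c k * v t k x)"
      proof (rule sum.mono_neutral_left)
        show "\<forall>i\<in>S - S \<inter> {t..m}. c i * v t i x = 0"
        proof
          fix i assume "i \<in> S - S \<inter> {t..m}"
          then have "i < t" using S(1) by auto
          then show "c i * v t i x = 0" by (simp add: cauchy_tower_less)
        qed
      qed (use fS in auto)
      then show ?thesis using top X that by auto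
    qed
    show "k \<in> S \<inter> {t..m}" using k S(1) by auto
    then show "S \<inter> {t..m} \<noteq> {}" by blast
  qed (use X in auto)
qed

text \<open>
  Divide the combination of the columns \<open>S\<close> with coefficients \<open>c\<close> by \<open>x - z\<close> at every level. That all
  evaluations are zero says that the mass of each quotient is \<open>c q\<close> if \<open>q \<in> S\<close> and zero otherwise,
  so the quotients form a chain to which \<open>chain_kills_high_indices\<close> applies. The quotients are
  then zero, and so are the remaining \<open>c q\<close>, being their masses.
\<close>

lemma evaluation_nonsingular:
  assumes S: "S \<subseteq> {s..m}" "card S = t - s" and t: "s \<le> t" "t \<le> m + 1" and z: "z \<notin> I t"
    and zero: "\<And>p. p \<in> {s..<t} \<Longrightarrow> (\<Sum>k\<in>S. evaluation t z p k * c k) = 0"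
  shows "\<forall>k\<in>S. c k = 0"
proof -
  have fS: "finite S" using S(1) finite_subset by blast
  define G where "G q x = (\<Sum>k\<in>S. c k * divided t z k q x)" for q x
  have rec: "G q x = (\<Sum>y\<in>Y (Suc q). \<mu> (Suc q) y * G (Suc q) y / (x - y))" if "q < t" for q x
    unfolding G_def divided_step[OF that] sum_distrib_left sum_divide_distrib
    by (subst sum.swap) (simp add: mult_ac)
  have mass: "(\<Sum>y\<in>Y (Suc q). \<mu> (Suc q) y * G (Suc q) y) = (if q \<in> S then c q else 0)" if "q \<in> {s..<t}" for q
  proof -
    have "(\<Sum>k\<in>S. evaluation t z q k * c k)
       = (\<Sum>k\<in>S. (if k = q then c q else 0) - c k * (\<Sum>y\<in>Y (Suc q). \<mu> (Suc q) y * divided t z k (Suc q) y))"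
      by (intro sum.cong) (auto simp: evaluation_def algebra_simps)
    also have "\<dots> = (if q \<in> S then c q else 0) - (\<Sum>k\<in>S. c k * (\<Sum>y\<in>Y (Suc q). \<mu> (Suc q) y * divided t z k (Suc q) y))"
      using fS by (simp add: sum_subtractf)
    also have "(\<Sum>k\<in>S. c k * (\<Sum>y\<in>Y (Suc q). \<mu> (Suc q) y * divided t z k (Suc q) y))
       = (\<Sum>y\<in>Y (Suc q). \<mu> (Suc q) y * G (Suc q) y)"
      unfolding G_def sum_distrib_left by (subst sum.swap) (simp add: mult_ac)
    finally show ?thesis using zero[OF that] by simp
  qed
  have Gt: "G t x = (\<Sum>k\<in>S. c k * v t k x) / (x - z)" for x
    by (simp add: G_def divided_top sum_divide_distrib)
  have high: "c k = 0" if "k \<in> S" "t \<le> k" for k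
  proof (rule chain_kills_high_indices[OF S t, of G])
    show "continuous_on (I q) (G q)" if "s < q" "q \<le> t" for q
    proof (cases "q = t")
      case True
      have "continuous_on (I t) (\<lambda>x. (\<Sum>k\<in>S. c k * v t k x) / (x - z))"
        using Y_disjoint(2)[of t] z
        by (intro continuous_intros continuous_on_subset[OF continuous_on_v]) auto
      then show ?thesis using True by (simp add: Gt cong: continuous_on_cong)
    next
      case False
      then have q: "q < t" using that by simp
      have "continuous_on (- Y (Suc q)) (G q)"
        using continuous_on_cauchy_sum[OF finite_Y, of "Suc q" "\<lambda>y. \<mu> (Suc q) y * G (Suc q) y"]
        by (simp add: rec[OF q] cong: continuous_on_cong)
      then show ?thesis by (rule continuous_on_subset) (use Y_disjoint(2)[of q] in auto)
    qed
    show "(\<Sum>k\<in>S. c k * v t k x) = 0" if "x \<in> I t" "G t x = 0" for x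
      using that z Gt[of x] by auto
    show "G q x = (\<Sum>y\<in>Y (Suc q). \<mu> (Suc q) y * G (Suc q) y / (x - y))" if "s \<le> q" "q < t" for q x
      using rec that by blast
    show "(\<Sum>y\<in>Y (Suc q). \<mu> (Suc q) y * G (Suc q) y) = 0" if "s \<le> q" "q < t" "q \<notin> S" for q
      using mass[of q] that by simp
  qed (use that in auto)
  have Gzero: "G q x = 0" if "q \<le> t" for q x
    using that
  proof (induction q arbitrary: x rule: inc_induct)
    case base
    have "c k * v t k x = 0" if "k \<in> S" for k
      using high[OF that] by (cases "k < t") (auto simp: cauchy_tower_less)
    then have "(\<Sum>k\<in>S. c k * v t k x) = 0" by (intro sum.neutral) auto
    then show ?case by (simp add: Gt)
  next
    case (step q)
    then show ?case using rec[OF step.hyps(2), of x] by simp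
  qed
  show ?thesis
  proof
    fix k assume k: "k \<in> S"
    show "c k = 0"
    proof (cases "k < t")
      case True
      then show ?thesis using mass[of k] k S Gzero[of "Suc k"] by auto
    qed (use high k in auto)
  qed
qed

text \<open>
  For \<open>k \<noteq> q\<close> this is the coefficient of \<open>1/x\<close> of \<open>v q k\<close> at infinity.
\<close>

definition mass :: "nat \<Rightarrow> nat \<Rightarrow> real" where
  "mass q k = (\<Sum>y\<in>Y (Suc q). \<mu> (Suc q) y * v (Suc q) k y)"

text \<open>
  The counterpart of \<open>evaluation_nonsingular\<close> for \<open>z = \<infinity>\<close>. Here row \<open>q\<close> is replaced by its leading
  coefficients on \<open>S\<close>: the unit vector if \<open>q \<in> S\<close>, and the coefficients of \<open>1/x\<close> otherwise.
\<close>

lemma expansion_at_infinity_nonsingular: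
  assumes S: "S \<subseteq> {s..m}" "card S = t - s" and t: "s \<le> t" "t \<le> m + 1"
    and zero: "\<And>q. q \<in> {s..<t} \<Longrightarrow> q \<in> S \<Longrightarrow> c q = 0"
       "\<And>q. q \<in> {s..<t} \<Longrightarrow> q \<notin> S \<Longrightarrow> (\<Sum>k\<in>S. mass q k * c k) = 0"
  shows "\<forall>k\<in>S. c k = 0"
proof
  fix k assume k: "k \<in> S"
  define G where "G q x = (\<Sum>k\<in>S. c k * v q k x)" for q x
  show "c k = 0"
  proof (cases "k < t")
    case False
    show ?thesis
    proof (rule chain_kills_high_indices[OF S t, of G])
      show "continuous_on (I q) (G q)" for q
        unfolding G_def using Y_disjoint(2)[of q]
        by (intro continuous_intros continuous_on_subset[OF continuous_on_v]) auto
      show "G q x = (\<Sum>y\<in>Y (Suc q). \<mu> (Suc q) y * G (Suc q) y / (x - y))" if "s \<le> q" "q < t" for q x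
      proof -
        have "S \<subseteq> {..m}" using S by auto
        from combination_rec[OF this, of c q x] show ?thesis using zero(1)[of q] that by (simp add: G_def)
      qed
      show "(\<Sum>y\<in>Y (Suc q). \<mu> (Suc q) y * G (Suc q) y) = 0" if "s \<le> q" "q < t" "q \<notin> S" for q
      proof -
        have "(\<Sum>y\<in>Y (Suc q). \<mu> (Suc q) y * G (Suc q) y) = (\<Sum>k\<in>S. mass q k * c k)"
          unfolding G_def mass_def sum_distrib_left sum_distrib_right by (subst sum.swap) (simp add: mult_ac)
        then show ?thesis using zero(2)[of q] that by simp
      qed
    qed (use k False in \<open>auto simp: G_def\<close>)
  qed (use zero(1) k S in auto)
qed

end

section \<open>Vectors of minors: nonvanishing and growth\<close>

lemma eventually_cofinite_at:
  fixes z :: real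
  assumes "eventually P cofinite"
  shows "eventually P (at z)"
proof -
  have "finite {x. \<not> P x}" using assms by (simp add: eventually_cofinite)
  then have "open (- ({x. \<not> P x} - {z}))" by (intro open_Compl finite_imp_closed) auto
  then show ?thesis
    unfolding eventually_at_topological by (intro exI[of _ "- ({x. \<not> P x} - {z})"]) auto
qed

lemma eventually_cofinite_at_top:
  assumes "eventually P (cofinite :: real filter)"
  shows "eventually P at_top"
proof -
  have "finite {x. \<not> P x}" using assms by (simp add: eventually_cofinite)
  then have "eventually (\<lambda>x. \<forall>y\<in>{x. \<not> P x}. x > y) at_top"
    by (intro eventually_ball_finite) (auto intro: eventually_gt_at_top)
  then show ?thesis by eventually_elim auto
qed

lemma eq_of_eventually_cofinite:
  fixes f g :: "real \<Rightarrow> real"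
  assumes "open U" "continuous_on U f" "continuous_on U g" "z \<in> U"
    and "\<forall>\<^sub>F x in cofinite. f x = g x"
  shows "f z = g z"
proof -
  have "(f \<longlongrightarrow> f z) (at z)" "(g \<longlongrightarrow> g z) (at z)"
    using assms by (auto simp: continuous_on_eq_continuous_at isCont_def)
  moreover have "(f \<longlongrightarrow> f z) (at z) \<longleftrightarrow> (g \<longlongrightarrow> f z) (at z)"
    by (rule tendsto_cong[OF eventually_cofinite_at[OF assms(5)]])
  ultimately show ?thesis using tendsto_unique[OF trivial_limit_at] by blast
qed

text \<open>
  The matrix \<open>g\<close> is close to the identity, so its inverse is bounded.
\<close>

lemma coefficients_bounded_by_dual_pairing:
  fixes g :: "'a \<Rightarrow> 'a \<Rightarrow> real"
  assumes "finite P" and h: "\<And>p. p \<in> P \<Longrightarrow> h p = (\<Sum>q\<in>P. \<gamma> q * g p q)"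
    and g: "\<And>p q. p \<in> P \<Longrightarrow> q \<in> P \<Longrightarrow> \<bar>g p q - (if q = p then 1 else 0)\<bar> \<le> \<eta>"
    and \<eta>: "\<eta> * card P \<le> 1 / 2"
  shows "(\<Sum>p\<in>P. \<bar>\<gamma> p\<bar>) \<le> 2 * (\<Sum>p\<in>P. \<bar>h p\<bar>)"
proof -
  let ?s = "\<Sum>p\<in>P. \<bar>\<gamma> p\<bar>"
  have "\<bar>\<gamma> p\<bar> \<le> \<bar>h p\<bar> + \<eta> * ?s" if p: "p \<in> P" for p
  proof -
    have "h p = (\<Sum>q\<in>P. \<gamma> q * (g p q - (if q = p then 1 else 0)) + (if q = p then \<gamma> p else 0))"
      unfolding h[OF p] by (intro sum.cong) (auto simp: algebra_simps)
    then have "\<gamma> p = h p - (\<Sum>q\<in>P. \<gamma> q * (g p q - (if q = p then 1 else 0)))"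
      using assms(1) p by (simp add: sum.distrib)
    then have "\<bar>\<gamma> p\<bar> \<le> \<bar>h p\<bar> + \<bar>\<Sum>q\<in>P. \<gamma> q * (g p q - (if q = p then 1 else 0))\<bar>" by linarith
    also have "\<bar>\<Sum>q\<in>P. \<gamma> q * (g p q - (if q = p then 1 else 0))\<bar> \<le> (\<Sum>q\<in>P. \<bar>\<gamma> q\<bar> * \<eta>)"
    proof (rule order_trans[OF sum_abs sum_mono])
      fix q assume "q \<in> P"
      then show "\<bar>\<gamma> q * (g p q - (if q = p then 1 else 0))\<bar> \<le> \<bar>\<gamma> q\<bar> * \<eta>"
        unfolding abs_mult by (intro mult_left_mono g p) auto
    qed
    finally show ?thesis by (simp add: sum_distrib_left mult.commute)
  qed
  then have "?s \<le> (\<Sum>p\<in>P. \<bar>h p\<bar> + \<eta> * ?s)" by (rule sum_mono)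
  also have "\<dots> = (\<Sum>p\<in>P. \<bar>h p\<bar>) + (\<eta> * card P) * ?s" by (simp add: sum.distrib)
  also have "\<dots> \<le> (\<Sum>p\<in>P. \<bar>h p\<bar>) + 1 / 2 * ?s"
    using \<eta> by (intro add_left_mono mult_right_mono) (auto intro: sum_nonneg)
  finally show ?thesis by simp
qed

context atomic_nikishin begin

lemma closed_I: "closed (I q)" by (simp add: I_def)

lemma eventually_generic: "\<forall>\<^sub>F x in cofinite. \<forall>q. x \<notin> Y q"
proof -
  have "{x. \<not> (\<forall>q. x \<notin> Y q)} \<subseteq> (\<Union>q\<le>m. Y q)"
  proof
    fix x assume "x \<in> {x. \<not> (\<forall>q. x \<notin> Y q)}"
    then obtain q where q: "x \<in> Y q" by blast
    then have "q \<le> m" using Y_beyond[of q] by (cases "q \<le> m") auto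
    then show "x \<in> (\<Union>q\<le>m. Y q)" using q by blast
  qed
  then show ?thesis unfolding eventually_cofinite by (rule finite_subset) auto
qed

definition in_span :: "nat \<Rightarrow> nat \<Rightarrow> (nat \<Rightarrow> real) \<Rightarrow> real \<Rightarrow> bool" where
  "in_span s t w x \<longleftrightarrow> (\<exists>\<beta>. \<forall>k\<in>{s..m}. w k = (\<Sum>q=s..<t. \<beta> q * v q k x))"

text \<open>
  With \<open>r = card J\<close>, the rows \<open>s, \<dots>, s + r\<close> of the tower have, up to a factor, one combination that
  vanishes in the \<open>r\<close> columns \<open>J\<close>; its entry in a column \<open>k\<close> is the minor with the columns
  \<open>J \<union> {k}\<close>. A valid \<open>W\<close> is such a combination at almost every point, normalized so as to be
  continuous and without common zeros off the interval of level \<open>s + r + 1\<close>. The poles of the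
  rows are the reason for excluding finitely many points.
\<close>

definition valid :: "nat \<Rightarrow> nat set \<Rightarrow> (nat \<Rightarrow> real \<Rightarrow> real) \<Rightarrow> bool" where
  "valid s J W \<longleftrightarrow> (\<forall>k\<in>{s..m}. continuous_on (- I (Suc (s + card J))) (W k)) \<and>
     (\<forall>\<^sub>F x in cofinite. (\<forall>k\<in>J. W k x = 0) \<and> in_span s (Suc (s + card J)) (\<lambda>k. W k x) x) \<and>
     (\<forall>x. x \<notin> I (Suc (s + card J)) \<longrightarrow> (\<exists>k\<in>{s..m}. W k x \<noteq> 0))"

lemma in_span_evaluation:
  assumes "in_span s t w x" "\<forall>q. x \<notin> Y q" "t \<le> m + 1"
  shows "\<exists>\<gamma>. \<forall>k\<in>{s..m}. w k = (\<Sum>p=s..<t. \<gamma> p * evaluation t x p k)"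
proof -
  obtain \<beta> where \<beta>: "\<forall>k\<in>{s..m}. w k = (\<Sum>q=s..<t. \<beta> q * v q k x)"
    using assms(1) unfolding in_span_def by blast
  define \<gamma> where "\<gamma> p = (\<Sum>q=s..<t. \<beta> q * v q p x)" for p
  have "w k = (\<Sum>p=s..<t. \<gamma> p * evaluation t x p k)" if k: "k \<in> {s..m}" for k
  proof -
    have vq: "v q k x = (\<Sum>p=s..<t. evaluation t x p k * v q p x)" if q: "q \<in> {s..<t}" for q
    proof -
      have "v q k x = (\<Sum>p=q..<t. evaluation t x p k * v q p x)"
        using tower_expansion[of q t x x k] assms(2) q k by auto
      also have "\<dots> = (\<Sum>p=s..<t. evaluation t x p k * v q p x)"
        using q by (intro sum.mono_neutral_left) (auto simp: cauchy_tower_less)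
      finally show ?thesis .
    qed
    have "w k = (\<Sum>q=s..<t. \<beta> q * v q k x)" using \<beta> k by simp
    also have "\<dots> = (\<Sum>q=s..<t. \<Sum>p=s..<t. \<beta> q * (evaluation t x p k * v q p x))"
      by (simp add: vq sum_distrib_left)
    also have "\<dots> = (\<Sum>p=s..<t. \<gamma> p * evaluation t x p k)"
      unfolding \<gamma>_def sum_distrib_right by (subst sum.swap) (simp add: mult_ac)
    finally show ?thesis .
  qed
  then show ?thesis by blast
qed

lemma valid_zero_on:
  assumes "valid s J W" "J \<subseteq> {s..m}" "x \<notin> I (Suc (s + card J))" "k \<in> J"
  shows "W k x = 0"
proof (rule eq_of_eventually_cofinite[of "- I (Suc (s + card J))" "W k" "\<lambda>_. 0"])
  show "\<forall>\<^sub>F x in cofinite. W k x = 0"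
  proof -
    have "\<forall>\<^sub>F x in cofinite. (\<forall>k\<in>J. W k x = 0) \<and> in_span s (Suc (s + card J)) (\<lambda>k. W k x) x"
      using assms(1) unfolding valid_def by blast
    then show ?thesis by eventually_elim (use assms(4) in blast)
  qed
qed (use assms closed_I in \<open>auto simp: valid_def open_Compl\<close>)

text \<open>
  If \<open>W k\<close> vanished at \<open>z\<close>, then \<open>W\<close> would vanish at \<open>z\<close> in all columns of \<open>S = insert k J\<close>. By
  \<open>evaluation_nonsingular\<close>, the coefficients of \<open>W\<close> with respect to the evaluations near \<open>z\<close> are
  bounded by the entries of \<open>W\<close> in the columns \<open>S\<close>. They would tend to zero, and \<open>W\<close> would be
  the zero vector at \<open>z\<close>.
\<close>

lemma valid_nonvanishing:
  assumes W: "valid s J W" and J: "J \<subseteq> {s..m}" and k: "k \<in> {s..m} - J" and z: "z \<notin> I (Suc (s + card J))"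
  shows "W k z \<noteq> 0"
proof
  assume Wk: "W k z = 0"
  define t where "t = Suc (s + card J)"
  define S where "S = insert k J"
  define P where "P = {s..<t}"
  have fJ: "finite J" using J finite_subset by blast
  have S: "S \<subseteq> {s..m}" "card S = t - s" "finite S" using J k fJ by (auto simp: S_def t_def)
  have "card S \<le> card {s..m}" using S by (intro card_mono) auto
  then have t: "s \<le> t" "t \<le> m + 1" using S(2) k by (auto simp: t_def)
  have cont: "isCont (W i) z" if "i \<in> {s..m}" for i
  proof -
    have "continuous_on (- I t) (W i)" using W that unfolding valid_def t_def by blast
    then show ?thesis using z closed_I[of t] by (simp add: continuous_on_eq_continuous_at open_Compl t_def)
  qed
  have conte: "isCont (\<lambda>x. evaluation t x p i) z" if "p \<in> P" for p i
  proof -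
    have "continuous_on (- Y t) (\<lambda>x. evaluation t x p i)" using that t by (intro continuous_on_evaluation) (auto simp: P_def)
    moreover have "z \<in> - Y t" using z Y_subset[of t] by (auto simp: t_def)
    ultimately show ?thesis by (simp add: continuous_on_eq_continuous_at open_Compl finite_imp_closed)
  qed
  \<comment> \<open>Vectors supported on \<open>S\<close> that are dual to the evaluations at \<open>z\<close>; near
    \<open>z\<close> they are almost dual.\<close>
  have "\<exists>c. \<forall>p'\<in>P. (\<Sum>i\<in>S. evaluation t z p' i * c i) = (if p' = p then 1 else 0)" if "p \<in> P" for p
  proof (rule dual_vector_exists[OF _ S(3) _ _ that])
    fix c assume "\<And>p. p \<in> P \<Longrightarrow> (\<Sum>i\<in>S. evaluation t z p i * c i) = 0"
    then show "\<forall>i\<in>S. c i = 0"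
      using z by (intro evaluation_nonsingular[OF S(1,2) t, of z]) (auto simp: t_def P_def)
  qed (use S in \<open>auto simp: P_def\<close>)
  then obtain c where c: "\<And>p p'. p \<in> P \<Longrightarrow> p' \<in> P \<Longrightarrow> (\<Sum>i\<in>S. evaluation t z p' i * c p i) = (if p' = p then 1 else 0)"
    by metis
  define g where "g p p' x = (\<Sum>i\<in>S. evaluation t x p' i * c p i)" for p p' x
  define h where "h p x = (\<Sum>i\<in>S. W i x * c p i)" for p x
  have WS: "W i z = 0" if "i \<in> S" for i
    using that Wk valid_zero_on[OF W J z] by (auto simp: S_def)
  obtain i0 where i0: "i0 \<in> {s..m}" "W i0 z \<noteq> 0" using W z unfolding valid_def by blast
  define \<eta> :: real where "\<eta> = 1 / (2 * (card P + 1))"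
  have \<eta>: "\<eta> > 0" "\<eta> * card P \<le> 1 / 2" by (auto simp: \<eta>_def field_simps)
  have ev1: "\<forall>\<^sub>F x in at z. \<forall>p\<in>P. \<forall>p'\<in>P. \<bar>g p p' x - (if p' = p then 1 else 0)\<bar> \<le> \<eta>"
  proof (intro eventually_ball_finite ballI)
    fix p p' assume p: "p \<in> P" "p' \<in> P"
    have "(g p p' \<longlongrightarrow> g p p' z) (at z)"
      using conte[OF p(2)] unfolding g_def isCont_def by (intro tendsto_intros) auto
    then have "\<forall>\<^sub>F x in at z. dist (g p p' x) (g p p' z) < \<eta>" using \<eta>(1) by (rule tendstoD)
    then show "\<forall>\<^sub>F x in at z. \<bar>g p p' x - (if p' = p then 1 else 0)\<bar> \<le> \<eta>"
      by eventually_elim (simp add: g_def c[OF p] dist_real_def)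
  qed (auto simp: P_def)
  define C where "C = (\<Sum>p\<in>P. \<bar>evaluation t z p i0\<bar>) + 1"
  have ev2: "\<forall>\<^sub>F x in at z. \<forall>p\<in>P. \<bar>evaluation t x p i0\<bar> \<le> C"
  proof (intro eventually_ball_finite ballI)
    fix p assume p: "p \<in> P"
    have "\<forall>\<^sub>F x in at z. dist (evaluation t x p i0) (evaluation t z p i0) < 1"
      using conte[OF p, of i0] unfolding isCont_def by (rule tendstoD) auto
    moreover have "\<bar>evaluation t z p i0\<bar> \<le> (\<Sum>p\<in>P. \<bar>evaluation t z p i0\<bar>)"
      using p by (intro member_le_sum) (auto simp: P_def)
    ultimately show "\<forall>\<^sub>F x in at z. \<bar>evaluation t x p i0\<bar> \<le> C"
      by (auto elim!: eventually_mono simp: dist_real_def C_def)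
  qed (auto simp: P_def)
  have "\<forall>\<^sub>F x in at z. \<bar>W i0 x\<bar> \<le> C * (2 * (\<Sum>p\<in>P. \<bar>h p x\<bar>))"
  proof -
    have "\<forall>\<^sub>F x in cofinite. in_span s t (\<lambda>k. W k x) x"
      using W unfolding valid_def t_def by (auto elim: eventually_mono)
    from eventually_cofinite_at[OF this] eventually_cofinite_at[OF eventually_generic] ev1 ev2
    show ?thesis
    proof eventually_elim
      case (elim x)
      obtain \<gamma> where \<gamma>: "\<forall>k\<in>{s..m}. W k x = (\<Sum>p=s..<t. \<gamma> p * evaluation t x p k)"
        using in_span_evaluation[OF elim(1,2) t(2)] by blast
      have "h p x = (\<Sum>q\<in>P. \<gamma> q * g p q x)" if "p \<in> P" for p
      proof -
        have "h p x = (\<Sum>i\<in>S. \<Sum>q\<in>P. \<gamma> q * evaluation t x q i * c p i)"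
          unfolding h_def P_def using S(1) \<gamma> by (intro sum.cong) (auto simp: sum_distrib_right)
        also have "\<dots> = (\<Sum>q\<in>P. \<gamma> q * g p q x)"
          unfolding g_def by (subst sum.swap) (simp add: sum_distrib_left mult.assoc)
        finally show ?thesis .
      qed
      then have "(\<Sum>p\<in>P. \<bar>\<gamma> p\<bar>) \<le> 2 * (\<Sum>p\<in>P. \<bar>h p x\<bar>)"
        using elim(3) \<eta>(2) by (intro coefficients_bounded_by_dual_pairing[of P "\<lambda>p. h p x" \<gamma> "\<lambda>p q. g p q x" \<eta>]) (auto simp: P_def)
      moreover have "C \<ge> 0" by (auto simp: C_def intro: add_nonneg_nonneg sum_nonneg)
      moreover have "\<bar>W i0 x\<bar> \<le> (\<Sum>p\<in>P. \<bar>\<gamma> p\<bar> * C)"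
      proof -
        have "\<bar>W i0 x\<bar> \<le> (\<Sum>p\<in>P. \<bar>\<gamma> p * evaluation t x p i0\<bar>)"
          using \<gamma> i0 by (auto simp: P_def)
        also have "\<dots> \<le> (\<Sum>p\<in>P. \<bar>\<gamma> p\<bar> * C)"
          using elim(4) by (intro sum_mono) (auto simp: abs_mult intro: mult_left_mono)
        finally show ?thesis .
      qed
      moreover have "(\<Sum>p\<in>P. \<bar>\<gamma> p\<bar> * C) = C * (\<Sum>p\<in>P. \<bar>\<gamma> p\<bar>)"
        by (simp add: sum_distrib_left mult.commute)
      ultimately show ?case using mult_left_mono[of "\<Sum>p\<in>P. \<bar>\<gamma> p\<bar>" "2 * (\<Sum>p\<in>P. \<bar>h p x\<bar>)" C] by linarith
    qed
  qed
  moreover have "((\<lambda>x. \<bar>W i0 x\<bar>) \<longlongrightarrow> \<bar>W i0 z\<bar>) (at z)"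
    using cont[OF i0(1)] unfolding isCont_def by (rule tendsto_rabs)
  moreover have "((\<lambda>x. C * (2 * (\<Sum>p\<in>P. \<bar>h p x\<bar>))) \<longlongrightarrow> C * (2 * (\<Sum>p\<in>P. \<bar>h p z\<bar>))) (at z)"
    using cont S(1) unfolding h_def isCont_def by (intro tendsto_intros) auto
  ultimately have "\<bar>W i0 z\<bar> \<le> C * (2 * (\<Sum>p\<in>P. \<bar>h p z\<bar>))"
    by (intro tendsto_le[OF trivial_limit_at])
  moreover have "h p z = 0" for p by (simp add: h_def WS)
  ultimately show False using i0 by simp
qed

lemma tower_at_infinity:
  assumes "k \<le> m"
  shows "(v q k \<longlongrightarrow> (if k = q then 1 else 0)) at_top"
    and "k \<noteq> q \<Longrightarrow> ((\<lambda>x. x * v q k x) \<longlongrightarrow> mass q k) at_top"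
proof -
  have lim: "((\<lambda>x. x * (1 / (x - y))) \<longlongrightarrow> 1) at_top" "((\<lambda>x. 1 / (x - y)) \<longlongrightarrow> 0) at_top" for y :: real
    by real_asymp+
  have "((\<lambda>x. \<Sum>y\<in>Y (Suc q). \<mu> (Suc q) y * v (Suc q) k y * (1 / (x - y))) \<longlongrightarrow> (\<Sum>y\<in>Y (Suc q). \<mu> (Suc q) y * v (Suc q) k y * 0)) at_top"
    by (intro tendsto_sum tendsto_mult tendsto_const lim)
  then have "((\<lambda>x. (if k = q then 1 else 0) + (\<Sum>y\<in>Y (Suc q). \<mu> (Suc q) y * v (Suc q) k y * (1 / (x - y)))) \<longlongrightarrow> (if k = q then 1 else 0) + 0) at_top"
    by (intro tendsto_add tendsto_const) simp
  then show "(v q k \<longlongrightarrow> (if k = q then 1 else 0)) at_top"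
    by (simp add: v_rec[OF assms, of q, abs_def])
  assume "k \<noteq> q"
  have "((\<lambda>x. \<Sum>y\<in>Y (Suc q). \<mu> (Suc q) y * v (Suc q) k y * (x * (1 / (x - y)))) \<longlongrightarrow> (\<Sum>y\<in>Y (Suc q). \<mu> (Suc q) y * v (Suc q) k y * 1)) at_top"
    by (intro tendsto_sum tendsto_mult tendsto_const lim)
  then show "((\<lambda>x. x * v q k x) \<longlongrightarrow> mass q k) at_top"
    using \<open>k \<noteq> q\<close> by (simp add: v_rec[OF assms, of q, abs_def] mass_def sum_distrib_left mult_ac)
qed

text \<open>
  The argument of \<open>valid_nonvanishing\<close> at infinity. The rows \<open>q \<notin> S\<close>, with \<open>S = insert j J\<close>, are
  multiplied by \<open>x\<close>, so that the rows, restricted to the columns \<open>S\<close>, have a nonsingular limit; the coefficients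
  of \<open>W\<close> are then bounded by \<open>W j\<close>. After division by \<open>x\<close>, column \<open>k\<close> of the rescaled rows tends
  to zero, except in row \<open>k\<close>. The coefficient of this row is of smaller order, because the dual
  vector belonging to it has no component in column \<open>j\<close>.
\<close>

lemma later_column_grows_slower:
  assumes W: "valid s J W" and J: "J \<subseteq> {s..m}" and j: "j \<in> {s..m} - J" and k: "k \<in> {s..m} - J" and jk: "j < k"
  shows "((\<lambda>x. W k x / (x * W j x)) \<longlongrightarrow> 0) at_top"
proof -
  define t where "t = Suc (s + card J)"
  define S where "S = insert j J"
  define P where "P = {s..<t}"
  have fJ: "finite J" using J finite_subset by blast
  have S: "S \<subseteq> {s..m}" "card S = t - s" "finite S" using J j fJ by (auto simp: S_def t_def)
  have kS: "k \<notin> S" "k \<le> m" using k jk by (auto simp: S_def)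
  have "card S \<le> card {s..m}" using S by (intro card_mono) auto
  then have t: "s \<le> t" "t \<le> m + 1" using S(2) j by (auto simp: t_def)
  \<comment> \<open>The factor that gives row \<open>q\<close> a finite nonzero limit on the columns
    \<open>S\<close>.\<close>
  define sc where "sc q x = (if q \<in> S then 1 else x)" for q :: nat and x :: real
  define N where "N q i = (if q \<in> S then (if i = q then 1 else 0) else mass q i)" for q i
  have "\<exists>c. \<forall>p'\<in>P. (\<Sum>i\<in>S. N p' i * c i) = (if p' = p then 1 else 0)" if "p \<in> P" for p
  proof (rule dual_vector_exists[OF _ S(3) _ _ that])
    fix c assume c: "\<And>p. p \<in> P \<Longrightarrow> (\<Sum>i\<in>S. N p i * c i) = 0"
    show "\<forall>i\<in>S. c i = 0"
    proof (rule expansion_at_infinity_nonsingular[OF S(1,2) t])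
      fix q assume q: "q \<in> {s..<t}" "q \<in> S"
      have "(\<Sum>i\<in>S. N q i * c i) = (\<Sum>i\<in>S. if i = q then c q else 0)"
        using q by (intro sum.cong) (auto simp: N_def)
      then show "c q = 0" using c[of q] q S(3) by (auto simp: P_def)
    next
      fix q assume q: "q \<in> {s..<t}" "q \<notin> S"
      then show "(\<Sum>k\<in>S. mass q k * c k) = 0" using c[of q] by (simp add: N_def P_def)
    qed
  qed (use S in \<open>auto simp: P_def\<close>)
  then obtain c where c: "\<And>p p'. p \<in> P \<Longrightarrow> p' \<in> P \<Longrightarrow> (\<Sum>i\<in>S. N p' i * c p i) = (if p' = p then 1 else 0)"
    by metis
  define g where "g p p' x = (\<Sum>i\<in>S. sc p' x * v p' i x * c p i)" for p p' x
  have limN: "((\<lambda>x. sc q x * v q i x) \<longlongrightarrow> N q i) at_top" if "i \<in> S" for q i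
  proof -
    have "i \<le> m" using that S(1) by auto
    then show ?thesis using tower_at_infinity[of i q] that by (cases "q \<in> S") (auto simp: sc_def N_def)
  qed
  have limg: "(g p p' \<longlongrightarrow> (if p' = p then 1 else 0)) at_top" if "p \<in> P" "p' \<in> P" for p p'
    unfolding c[OF that, symmetric] g_def by (intro tendsto_sum tendsto_mult tendsto_const limN) auto
  define \<eta> :: real where "\<eta> = 1 / (2 * (card P + 1))"
  have \<eta>: "\<eta> > 0" "\<eta> * card P \<le> 1 / 2" by (auto simp: \<eta>_def field_simps)
  have ev1: "\<forall>\<^sub>F x in at_top. \<forall>p\<in>P. \<forall>p'\<in>P. \<bar>g p p' x - (if p' = p then 1 else 0)\<bar> \<le> \<eta>"
  proof (intro eventually_ball_finite ballI)
    fix p p' assume p: "p \<in> P" "p' \<in> P"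
    have "\<forall>\<^sub>F x in at_top. dist (g p p' x) (if p' = p then 1 else 0) < \<eta>"
      using limg[OF p] \<eta>(1) by (rule tendstoD)
    then show "\<forall>\<^sub>F x in at_top. \<bar>g p p' x - (if p' = p then 1 else 0)\<bar> \<le> \<eta>"
      by eventually_elim (simp add: dist_real_def)
  qed (auto simp: P_def)
  define C where "C = 2 * (\<Sum>p\<in>P. \<bar>c p j\<bar>)"
  define \<psi> where "\<psi> q x = (if q = k then \<bar>sc k x / x * v k k x\<bar> * (\<Sum>p\<in>P. \<bar>g k p x - (if p = k then 1 else 0)\<bar>)
      else \<bar>sc q x / x * v q k x\<bar>)" for q x
  have bound: "\<forall>\<^sub>F x in at_top. \<bar>W k x / (x * W j x)\<bar> \<le> (\<Sum>q\<in>P. C * \<psi> q x)"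
  proof -
    have "\<forall>\<^sub>F x in cofinite. (\<forall>k\<in>J. W k x = 0) \<and> in_span s t (\<lambda>k. W k x) x"
      using W unfolding valid_def t_def by blast
    note span_ev = eventually_cofinite_at_top[OF this]
    have Wj_ev: "\<forall>\<^sub>F x in at_top. W j x \<noteq> 0"
    proof -
      have "\<forall>\<^sub>F x in at_top. x \<notin> I t"
        using eventually_gt_at_top[of "hi t"] by eventually_elim (auto simp: I_def)
      then show ?thesis by eventually_elim (use valid_nonvanishing[OF W J j] in \<open>simp add: t_def\<close>)
    qed
    from span_ev Wj_ev eventually_gt_at_top[of 0] ev1
    show ?thesis
    proof eventually_elim
      case (elim x)
      note span = elim(1) and Wj = elim(2) and x = elim(3) and ev = elim(4)
      obtain \<beta> where \<beta>: "\<forall>k\<in>{s..m}. W k x = (\<Sum>q=s..<t. \<beta> q * v q k x)"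
        using span unfolding in_span_def by blast
      have scx: "sc q x \<noteq> 0" for q using x by (simp add: sc_def)
      define \<gamma> where "\<gamma> q = \<beta> q / sc q x" for q
      have W\<gamma>: "W i x = (\<Sum>q\<in>P. \<gamma> q * (sc q x * v q i x))" if "i \<in> {s..m}" for i
        using \<beta> that scx by (simp add: \<gamma>_def P_def)
      have pair: "W j x * c p j = (\<Sum>q\<in>P. \<gamma> q * g p q x)" for p
      proof -
        have "(\<Sum>q\<in>P. \<gamma> q * g p q x) = (\<Sum>i\<in>S. (\<Sum>q\<in>P. \<gamma> q * (sc q x * v q i x)) * c p i)"
          unfolding g_def sum_distrib_left sum_distrib_right by (subst sum.swap) (simp add: mult_ac)
        also have "\<dots> = (\<Sum>i\<in>S. W i x * c p i)" using W\<gamma> S(1) by (intro sum.cong) auto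
        also have "\<dots> = W j x * c p j"
          using span j fJ by (simp add: S_def)
        finally show ?thesis by simp
      qed
      have "(\<Sum>p\<in>P. \<bar>\<gamma> p\<bar>) \<le> 2 * (\<Sum>p\<in>P. \<bar>W j x * c p j\<bar>)"
        using ev \<eta>(2) pair by (intro coefficients_bounded_by_dual_pairing[of P _ \<gamma> "\<lambda>p q. g p q x" \<eta>]) (auto simp: P_def)
      also have "\<dots> = C * \<bar>W j x\<bar>" by (simp add: C_def abs_mult sum_distrib_left mult_ac)
      finally have sum\<gamma>: "(\<Sum>p\<in>P. \<bar>\<gamma> p\<bar>) \<le> C * \<bar>W j x\<bar>" .
      have \<gamma>q: "\<bar>\<gamma> q\<bar> \<le> C * \<bar>W j x\<bar>" if "q \<in> P" for q
        using sum\<gamma> member_le_sum[of q P "\<lambda>p. \<bar>\<gamma> p\<bar>"] that by (simp add: P_def)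
      have \<gamma>k: "\<bar>\<gamma> k\<bar> \<le> C * \<bar>W j x\<bar> * (\<Sum>p\<in>P. \<bar>g k p x - (if p = k then 1 else 0)\<bar>)" if kP: "k \<in> P"
      proof -
        have jP: "j \<in> P" "j \<in> S" using kP jk j by (auto simp: P_def S_def)
        have "(\<Sum>i\<in>S. N j i * c k i) = (\<Sum>i\<in>S. if i = j then c k j else 0)"
          using jP by (intro sum.cong) (auto simp: N_def)
        \<comment> \<open>Row \<open>j\<close> tends to the unit vector of column \<open>j\<close>, so duality to row
          \<open>k\<close> removes component \<open>j\<close>.\<close>
        then have "c k j = 0" using c[OF kP jP(1)] jk jP S(3) by simp
        then have "0 = (\<Sum>q\<in>P. \<gamma> q * (g k q x - (if q = k then 1 else 0)) + (if q = k then \<gamma> k else 0))"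
        proof -
          have "(\<Sum>q\<in>P. \<gamma> q * g k q x) = (\<Sum>q\<in>P. \<gamma> q * (g k q x - (if q = k then 1 else 0)) + (if q = k then \<gamma> k else 0))"
            by (intro sum.cong) (auto simp: algebra_simps)
          then show ?thesis using pair[of k] \<open>c k j = 0\<close> by simp
        qed
        then have "\<bar>\<gamma> k\<bar> = \<bar>\<Sum>q\<in>P. \<gamma> q * (g k q x - (if q = k then 1 else 0))\<bar>"
          using kP by (simp add: sum.distrib P_def)
        also have "\<dots> \<le> (\<Sum>q\<in>P. C * \<bar>W j x\<bar> * \<bar>g k q x - (if q = k then 1 else 0)\<bar>)"
        proof (rule order_trans[OF sum_abs sum_mono])
          fix q assume "q \<in> P"
          then show "\<bar>\<gamma> q * (g k q x - (if q = k then 1 else 0))\<bar> \<le> C * \<bar>W j x\<bar> * \<bar>g k q x - (if q = k then 1 else 0)\<bar>"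
            unfolding abs_mult by (intro mult_right_mono \<gamma>q) auto
        qed
        finally show ?thesis by (simp add: sum_distrib_left)
      qed
      have "\<bar>W k x / (x * W j x)\<bar> = \<bar>\<Sum>q\<in>P. \<gamma> q / W j x * (sc q x / x * v q k x)\<bar>"
        using W\<gamma>[of k] k by (simp add: sum_divide_distrib mult_ac)
      also have "\<dots> \<le> (\<Sum>q\<in>P. C * \<psi> q x)"
      proof (rule order_trans[OF sum_abs sum_mono])
        fix q assume q: "q \<in> P"
        show "\<bar>\<gamma> q / W j x * (sc q x / x * v q k x)\<bar> \<le> C * \<psi> q x"
        proof (cases "q = k")
          case True
          have "\<bar>\<gamma> k / W j x\<bar> \<le> C * (\<Sum>p\<in>P. \<bar>g k p x - (if p = k then 1 else 0)\<bar>)"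
            using \<gamma>k q True Wj by (simp add: divide_simps mult_ac)
          from mult_right_mono[OF this abs_ge_zero[of "sc k x / x * v k k x"]]
          show ?thesis unfolding abs_mult[symmetric] \<psi>_def True by (simp add: mult_ac)
        next
          case False
          have "\<bar>\<gamma> q / W j x\<bar> \<le> C" using \<gamma>q[OF q] Wj by (simp add: divide_simps)
          from mult_right_mono[OF this abs_ge_zero[of "sc q x / x * v q k x"]]
          show ?thesis using False unfolding abs_mult[symmetric] \<psi>_def by simp
        qed
      qed
      finally show ?case .
    qed
  qed
  have "(\<psi> q \<longlongrightarrow> 0) at_top" if q: "q \<in> P" for q
  proof (cases "q = k")
    case True
    have "(\<lambda>x. \<bar>sc k x / x * v k k x\<bar>) = (\<lambda>x. \<bar>x / x\<bar>)" using kS by (auto simp: sc_def)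
    moreover have "((\<lambda>x::real. \<bar>x / x\<bar>) \<longlongrightarrow> 1) at_top" by real_asymp
    ultimately have "((\<lambda>x. \<bar>sc k x / x * v k k x\<bar>) \<longlongrightarrow> 1) at_top" by simp
    moreover have "((\<lambda>x. \<Sum>p\<in>P. \<bar>g k p x - (if p = k then 1 else 0)\<bar>) \<longlongrightarrow> (\<Sum>p\<in>P. \<bar>(if p = k then 1 else 0) - (if p = k then 1 else 0)\<bar>)) at_top"
      using q True by (intro tendsto_sum tendsto_rabs tendsto_diff tendsto_const limg) auto
    ultimately have "((\<lambda>x. \<bar>sc k x / x * v k k x\<bar> * (\<Sum>p\<in>P. \<bar>g k p x - (if p = k then 1 else 0)\<bar>)) \<longlongrightarrow> 1 * 0) at_top"
      by (intro tendsto_mult) auto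
    then show ?thesis using True by (simp add: \<psi>_def[abs_def])
  next
    case False
    have v0: "(v q k \<longlongrightarrow> 0) at_top" using tower_at_infinity(1)[OF kS(2), of q] False by simp
    have "((\<lambda>x::real. 1 / x) \<longlongrightarrow> 0) at_top" "((\<lambda>x::real. x / x) \<longlongrightarrow> 1) at_top" by real_asymp+
    then have "((\<lambda>x. sc q x / x) \<longlongrightarrow> (if q \<in> S then 0 else 1)) at_top"
      by (cases "q \<in> S") (simp_all only: sc_def if_True if_False)
    from tendsto_rabs[OF tendsto_mult[OF this v0]] show ?thesis using False by (simp add: \<psi>_def[abs_def])
  qed
  then have "((\<lambda>x. \<Sum>q\<in>P. C * \<psi> q x) \<longlongrightarrow> (\<Sum>q\<in>P. C * 0)) at_top"
    by (intro tendsto_sum tendsto_mult tendsto_const)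
  then have "((\<lambda>x. \<Sum>q\<in>P. C * \<psi> q x) \<longlongrightarrow> 0) at_top" by simp
  then show ?thesis by (rule Lim_null_comparison[rotated]) (use bound in \<open>simp add: real_norm_def\<close>)
qed

end

section \<open>Division by a column\<close>

text \<open>
  A strict degree bound which for \<open>d = 0\<close> forces the zero polynomial.
\<close>

definition deg_below :: "'a::zero poly \<Rightarrow> nat \<Rightarrow> bool" where
  "deg_below p d \<longleftrightarrow> (\<forall>i\<ge>d. coeff p i = 0)"

lemma deg_below_degree: "deg_below p d \<longleftrightarrow> p = 0 \<or> degree p < d"
  unfolding deg_below_def
  by (metis coeff_0 coeff_eq_0 leading_coeff_0_iff linorder_not_le order_less_le_trans)

lemma deg_below_0: "deg_below p 0 \<longleftrightarrow> p = 0"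
  by (simp add: deg_below_degree)

lemma deg_below_mono: "deg_below p d \<Longrightarrow> d \<le> e \<Longrightarrow> deg_below p e"
  by (auto simp: deg_below_def)

lemma deg_below_add: "deg_below p d \<Longrightarrow> deg_below q d \<Longrightarrow> deg_below (p + q) d"
  by (simp add: deg_below_def)

lemma deg_below_sum: "(\<And>i. i \<in> A \<Longrightarrow> deg_below (p i) d) \<Longrightarrow> deg_below (\<Sum>i\<in>A. p i) d"
  by (auto simp: deg_below_def coeff_sum intro: sum.neutral)

lemma deg_below_smult: "deg_below p d \<Longrightarrow> deg_below (smult c p) d" for c :: "'a::comm_semiring_0"
  by (simp add: deg_below_def)

lemma deg_below_pCons: "deg_below p d \<Longrightarrow> deg_below (pCons c p) (Suc d)"
  by (auto simp: deg_below_def coeff_pCons split: nat.split)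

lemma deg_below_synthetic_div: "deg_below p d \<Longrightarrow> deg_below (synthetic_div p c) d"
  by (auto simp: deg_below_degree degree_synthetic_div synthetic_div_eq_0_iff)

lemma deg_below_many_zeros:
  fixes p :: "'a::idom poly"
  assumes "deg_below p d" "finite X" "d \<le> card X" "\<And>x. x \<in> X \<Longrightarrow> poly p x = 0"
  shows "p = 0"
proof (rule ccontr)
  assume "p \<noteq> 0"
  then have "degree p < card X" using assms by (auto simp: deg_below_degree)
  then have "p = 0" using assms by (intro poly_eqI_degree[of X]) auto
  then show False using \<open>p \<noteq> 0\<close> by blast
qed

lemma affine_cauchy_sum_finite_zeros:
  fixes g :: "real \<Rightarrow> real"
  assumes "finite Z" "x0 \<notin> Z" "a + b * x0 + (\<Sum>u\<in>Z. g u / (x0 - u)) \<noteq> 0"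
  shows "\<forall>\<^sub>F x in cofinite. a + b * x + (\<Sum>u\<in>Z. g u / (x - u)) \<noteq> 0"
proof -
  define D where "D x = (\<Prod>u\<in>Z. x - u)" for x
  define Q where "Q = [:a, b:] * (\<Prod>u\<in>Z. [:-u, 1:]) + (\<Sum>u\<in>Z. smult (g u) (\<Prod>w\<in>Z-{u}. [:-w, 1:]))"
  have Q: "poly Q x = (a + b * x + (\<Sum>u\<in>Z. g u / (x - u))) * D x" if "x \<notin> Z" for x
  proof -
    have "g u * (\<Prod>w\<in>Z-{u}. x - w) = g u / (x - u) * D x" if "u \<in> Z" for u
    proof -
      have "D x = (x - u) * (\<Prod>w\<in>Z-{u}. x - w)" unfolding D_def using assms(1) that by (simp add: prod.remove)
      moreover have "x - u \<noteq> 0" using that \<open>x \<notin> Z\<close> by auto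
      ultimately show ?thesis by simp
    qed
    then have "(\<Sum>u\<in>Z. g u * (\<Prod>w\<in>Z-{u}. x - w)) = (\<Sum>u\<in>Z. g u / (x - u)) * D x"
      by (simp add: sum_distrib_right)
    then have "poly Q x = (a + b * x) * D x + (\<Sum>u\<in>Z. g u / (x - u)) * D x"
      by (simp add: Q_def D_def poly_prod poly_sum algebra_simps)
    then show ?thesis by (simp only: distrib_right)
  qed
  have "D x0 \<noteq> 0" unfolding D_def using assms by auto
  then have "Q \<noteq> 0" using Q[OF assms(2)] assms(3) by auto
  then have "finite ({x. poly Q x = 0} \<union> Z)" using assms(1) poly_roots_finite by blast
  moreover have "{x. \<not> a + b * x + (\<Sum>u\<in>Z. g u / (x - u)) \<noteq> 0} \<subseteq> {x. poly Q x = 0} \<union> Z"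
    using Q by auto
  ultimately show ?thesis unfolding eventually_cofinite using finite_subset by blast
qed

text \<open>
  Subtracting \<open>\<phi> F\<close> cancels the poles in \<open>Z\<close>, since \<open>\<phi>(y) - \<phi>(x)\<close> is divisible by \<open>x - y\<close>. Only the
  poles of \<open>\<phi>\<close> and an affine function remain.
\<close>

lemma elimination_identity:
  fixes \<rho> w :: "real \<Rightarrow> real" and c d l0 l1 :: real
  assumes "Z \<inter> U = {}" "x \<notin> Z" "x \<notin> U"
  defines "\<phi> \<equiv> \<lambda>x. l0 + l1 * x + (\<Sum>u\<in>U. w u / (x - u))"
  defines "F \<equiv> \<lambda>x. c + (\<Sum>y\<in>Z. \<rho> y / (x - y))"
  shows "(d + (\<Sum>y\<in>Z. \<phi> y * \<rho> y / (x - y))) - \<phi> x * F x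
    = (d - c * l0 - l1 * (\<Sum>y\<in>Z. \<rho> y)) - c * l1 * x - (\<Sum>u\<in>U. w u * F u / (x - u))"
proof -
  have diff: "(\<phi> y - \<phi> x) * \<rho> y / (x - y) = - l1 * \<rho> y - (\<Sum>u\<in>U. w u / (x - u) * (\<rho> y / (u - y)))"
    if y: "y \<in> Z" for y
  proof -
    have xy: "x - y \<noteq> 0" using y assms by auto
    have "w u / (y - u) - w u / (x - u) = - (x - y) * (w u / (x - u) * (1 / (u - y)))" if "u \<in> U" for u
    proof -
      have "y - u \<noteq> 0" "x - u \<noteq> 0" "u - y \<noteq> 0" using that y assms by auto
      then show ?thesis by (simp add: divide_simps) (simp add: algebra_simps)
    qed
    then have "(\<Sum>u\<in>U. w u / (y - u)) - (\<Sum>u\<in>U. w u / (x - u)) = - (x - y) * (\<Sum>u\<in>U. w u / (x - u) * (1 / (u - y)))"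
      by (simp add: sum_subtractf[symmetric] sum_distrib_left)
    then have "\<phi> y - \<phi> x = (x - y) * (- l1 - (\<Sum>u\<in>U. w u / (x - u) * (1 / (u - y))))"
      by (simp add: \<phi>_def algebra_simps)
    then have "(\<phi> y - \<phi> x) * \<rho> y / (x - y) = (- l1 - (\<Sum>u\<in>U. w u / (x - u) * (1 / (u - y)))) * \<rho> y"
      using xy by simp
    then show ?thesis by (simp only: left_diff_distrib[of "- l1" _ "\<rho> y"] sum_distrib_right) (simp add: mult.commute)
  qed
  have F: "(\<Sum>y\<in>Z. \<rho> y / (u - y)) = F u - c" for u by (simp add: F_def)
  have "(d + (\<Sum>y\<in>Z. \<phi> y * \<rho> y / (x - y))) - \<phi> x * F x
     = d - \<phi> x * c + ((\<Sum>y\<in>Z. \<phi> y * \<rho> y / (x - y)) - (\<Sum>y\<in>Z. \<phi> x * \<rho> y / (x - y)))"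
    by (simp add: F_def distrib_left sum_distrib_left)
  also have "(\<Sum>y\<in>Z. \<phi> y * \<rho> y / (x - y)) - (\<Sum>y\<in>Z. \<phi> x * \<rho> y / (x - y)) = (\<Sum>y\<in>Z. (\<phi> y - \<phi> x) * \<rho> y / (x - y))"
    by (simp add: sum_subtractf[symmetric] left_diff_distrib diff_divide_distrib)
  also have "\<dots> = (\<Sum>y\<in>Z. - l1 * \<rho> y) - (\<Sum>y\<in>Z. \<Sum>u\<in>U. w u / (x - u) * (\<rho> y / (u - y)))"
    by (simp add: diff sum_subtractf)
  also have "(\<Sum>y\<in>Z. \<Sum>u\<in>U. w u / (x - u) * (\<rho> y / (u - y))) = (\<Sum>u\<in>U. w u / (x - u) * (F u - c))"
    by (subst sum.swap) (simp add: F[symmetric] sum_distrib_left)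
  also have "\<dots> = (\<Sum>u\<in>U. w u * F u / (x - u)) - c * (\<Sum>u\<in>U. w u / (x - u))"
    by (simp add: sum_subtractf[symmetric] right_diff_distrib diff_divide_distrib sum_distrib_left mult_ac)
  also have "(\<Sum>y\<in>Z. - l1 * \<rho> y) = - l1 * (\<Sum>y\<in>Z. \<rho> y)" by (rule sum_distrib_left[symmetric])
  finally show ?thesis by (simp add: \<phi>_def algebra_simps)
qed

text \<open>
  In the product \<open>H G\<close> the poles in \<open>U\<close> have residues \<open>- \<eta> G\<close> and those in \<open>Z\<close> have residues \<open>H \<theta>\<close>; the
  added Cauchy sum cancels the former.
\<close>

lemma quotient_identity:
  fixes \<eta> \<theta> :: "real \<Rightarrow> real" and a A B l0 l1 :: real
  assumes "U \<inter> Z = {}" "x \<notin> U" "x \<notin> Z"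
  defines "G \<equiv> \<lambda>x. A + B * x + (\<Sum>z\<in>Z. \<theta> z / (x - z))"
  defines "H \<equiv> \<lambda>x. a - (\<Sum>u\<in>U. \<eta> u / (x - u))"
  shows "l0 + l1 * x + (\<Sum>u\<in>U. \<eta> u * G u / (x - u)) + H x * G x
    = (l0 + a * A - B * (\<Sum>u\<in>U. \<eta> u)) + (l1 + a * B) * x + (\<Sum>z\<in>Z. H z * \<theta> z / (x - z))"
proof -
  have diff: "\<eta> u * (G u - G x) / (x - u) = - B * \<eta> u - (\<Sum>z\<in>Z. \<theta> z / (x - z) * (\<eta> u / (z - u)))"
    if u: "u \<in> U" for u
  proof -
    have xu: "x - u \<noteq> 0" using u assms by auto
    have "\<theta> z / (u - z) - \<theta> z / (x - z) = - (x - u) * (\<theta> z / (x - z) * (1 / (z - u)))" if "z \<in> Z" for z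
    proof -
      have "u - z \<noteq> 0" "x - z \<noteq> 0" "z - u \<noteq> 0" using that u assms by auto
      then show ?thesis by (simp add: divide_simps) (simp add: algebra_simps)
    qed
    then have "(\<Sum>z\<in>Z. \<theta> z / (u - z)) - (\<Sum>z\<in>Z. \<theta> z / (x - z)) = - (x - u) * (\<Sum>z\<in>Z. \<theta> z / (x - z) * (1 / (z - u)))"
      by (simp add: sum_subtractf[symmetric] sum_distrib_left)
    then have "G u - G x = (x - u) * (- B - (\<Sum>z\<in>Z. \<theta> z / (x - z) * (1 / (z - u))))"
      by (simp add: G_def algebra_simps)
    then have "\<eta> u * (G u - G x) / (x - u) = (- B - (\<Sum>z\<in>Z. \<theta> z / (x - z) * (1 / (z - u)))) * \<eta> u"
      using xu by simp
    then show ?thesis by (simp only: left_diff_distrib[of "- B" _ "\<eta> u"] sum_distrib_right) (simp add: mult.commute)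
  qed
  have H: "(\<Sum>u\<in>U. \<eta> u / (z - u)) = a - H z" for z by (simp add: H_def)
  have "(\<Sum>u\<in>U. \<eta> u * G u / (x - u)) + H x * G x
     = a * G x + (\<Sum>u\<in>U. \<eta> u * (G u - G x) / (x - u))"
    by (simp add: H_def left_diff_distrib right_diff_distrib sum_distrib_left diff_divide_distrib sum_subtractf mult_ac)
  also have "(\<Sum>u\<in>U. \<eta> u * (G u - G x) / (x - u))
     = - B * (\<Sum>u\<in>U. \<eta> u) - (\<Sum>u\<in>U. \<Sum>z\<in>Z. \<theta> z / (x - z) * (\<eta> u / (z - u)))"
    by (simp add: diff sum_subtractf sum_distrib_left)
  also have "(\<Sum>u\<in>U. \<Sum>z\<in>Z. \<theta> z / (x - z) * (\<eta> u / (z - u))) = (\<Sum>z\<in>Z. \<theta> z / (x - z) * (a - H z))"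
    by (subst sum.swap) (simp add: H[symmetric] sum_distrib_left)
  also have "\<dots> = a * (\<Sum>z\<in>Z. \<theta> z / (x - z)) - (\<Sum>z\<in>Z. H z * \<theta> z / (x - z))"
    by (simp add: sum_subtractf[symmetric] right_diff_distrib diff_divide_distrib sum_distrib_left mult_ac)
  finally show ?thesis by (simp add: G_def algebra_simps)
qed

lemma constant_sign_on_interval:
  fixes g :: "real \<Rightarrow> real"
  assumes "is_interval A" "continuous_on A g" "\<And>x. x \<in> A \<Longrightarrow> g x \<noteq> 0"
  obtains \<sigma> where "\<sigma> = 1 \<or> \<sigma> = -1" "\<And>x. x \<in> A \<Longrightarrow> \<sigma> * g x > 0"
  using sign_pattern_of_nonvanishing[of "{}" A g] assms by auto

context atomic_nikishin begin

lemma is_interval_I: "is_interval (I q)" by (simp add: I_def)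

text \<open>
  Validity controls the entries off one interval only; division also requires that they have no more
  than finitely many zeros on it.
\<close>

definition proper :: "nat \<Rightarrow> nat set \<Rightarrow> (nat \<Rightarrow> real \<Rightarrow> real) \<Rightarrow> bool" where
  "proper s J W \<longleftrightarrow> valid s J W \<and> (\<forall>k\<in>{s..m}-J. \<forall>\<^sub>F x in cofinite. W k x \<noteq> 0)"

text \<open>
  The result \<open>W'\<close> of dividing \<open>W\<close> by its column \<open>j\<close>, together with the nodes and masses.
\<close>

definition expansion ::
  "nat \<Rightarrow> nat set \<Rightarrow> nat \<Rightarrow> (nat \<Rightarrow> real \<Rightarrow> real) \<Rightarrow> real set \<Rightarrow> (real \<Rightarrow> real) \<Rightarrow> (nat \<Rightarrow> real \<Rightarrow> real)
    \<Rightarrow> (nat \<Rightarrow> real) \<Rightarrow> (nat \<Rightarrow> real) \<Rightarrow> bool" where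
  "expansion s J j W Z \<tau> W' l0 l1 \<longleftrightarrow> finite Z \<and> Z \<subseteq> I (Suc (s + card J)) \<and> (\<forall>y\<in>Z. \<tau> y > 0) \<and>
     (\<forall>k\<in>{s..m} - insert j J. \<forall>\<^sub>F x in cofinite.
        W k x / W j x = l0 k + l1 k * x + (\<Sum>y\<in>Z. W' k y * \<tau> y / (x - y)))"

text \<open>
  Division is possible \<open>n\<close> times in a row, by columns chosen in any order. Each division may lose one
  node.
\<close>

primrec good :: "nat \<Rightarrow> nat \<Rightarrow> nat set \<Rightarrow> (nat \<Rightarrow> real \<Rightarrow> real) \<Rightarrow> bool" where
  "good 0 s J W \<longleftrightarrow> proper s J W"
| "good (Suc n) s J W \<longleftrightarrow> proper s J W \<and> (\<forall>j\<in>{s..m}-J. \<exists>Z \<tau> W' l0 l1.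
     expansion s J j W Z \<tau> W' l0 l1 \<and> K \<le> card Z + card J + 1 \<and> good n s (insert j J) W')"

lemma good_proper: "good n s J W \<Longrightarrow> proper s J W"
  by (cases n) auto

lemma in_span_scale:
  assumes "in_span s t w x"
  shows "in_span s t (\<lambda>k. \<kappa> * w k) x"
proof -
  obtain \<beta> where "\<forall>k\<in>{s..m}. w k = (\<Sum>q=s..<t. \<beta> q * v q k x)"
    using assms unfolding in_span_def by blast
  then show ?thesis unfolding in_span_def
    by (intro exI[of _ "\<lambda>q. \<kappa> * \<beta> q"]) (simp add: sum_distrib_left mult.assoc)
qed

lemma valid_scale:
  assumes "valid s J W" "\<kappa> \<noteq> 0"
  shows "valid s J (\<lambda>k x. \<kappa> * W k x)"
  unfolding valid_def
proof (intro conjI ballI)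
  show "continuous_on (- I (Suc (s + card J))) (\<lambda>x. \<kappa> * W k x)" if "k \<in> {s..m}" for k
    using assms(1) that by (auto simp: valid_def intro: continuous_intros)
  have "\<forall>\<^sub>F x in cofinite. (\<forall>k\<in>J. W k x = 0) \<and> in_span s (Suc (s + card J)) (\<lambda>k. W k x) x"
    using assms(1) unfolding valid_def by blast
  then show "\<forall>\<^sub>F x in cofinite. (\<forall>k\<in>J. \<kappa> * W k x = 0) \<and> in_span s (Suc (s + card J)) (\<lambda>k. \<kappa> * W k x) x"
    by eventually_elim (use in_span_scale in auto)
  show "\<forall>x. x \<notin> I (Suc (s + card J)) \<longrightarrow> (\<exists>k\<in>{s..m}. \<kappa> * W k x \<noteq> 0)"
    using assms unfolding valid_def by auto
qed

lemma good_scale: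
  assumes "good n s J W" "\<kappa> \<noteq> 0"
  shows "good n s J (\<lambda>k x. \<kappa> * W k x)"
proof -
  have "proper s J (\<lambda>k x. \<kappa> * W k x)"
    using good_proper[OF assms(1)] assms(2) valid_scale unfolding proper_def by auto
  moreover have "expansion s J j (\<lambda>k x. \<kappa> * W k x) Z \<tau> W' l0 l1 = expansion s J j W Z \<tau> W' l0 l1" for j Z \<tau> W' l0 l1
    unfolding expansion_def using assms(2) by simp
  ultimately show ?thesis using assms(1) by (cases n) auto
qed

text \<open>
  Combinations of the rows from \<open>Suc s\<close> on are combinations of the rows from \<open>s\<close> on that vanish in
  column \<open>s\<close>.
\<close>

lemma valid_shift:
  assumes h: "valid (Suc s) J h" and J: "J \<subseteq> {Suc s..m}" and s: "s \<le> m"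
  shows "valid s (insert s J) (h(s := \<lambda>_. 0))"
proof -
  have fJ: "finite J" "s \<notin> J" using J finite_subset by auto
  have idx: "Suc (s + card (insert s J)) = Suc (Suc s + card J)" using fJ by simp
  have split: "{s..m} = insert s {Suc s..m}" using s by auto
  show ?thesis unfolding valid_def idx
  proof (intro conjI ballI)
    show "continuous_on (- I (Suc (Suc s + card J))) ((h(s := \<lambda>_. 0)) k)" if "k \<in> {s..m}" for k
      using h that by (auto simp: valid_def split)
    have "\<forall>\<^sub>F x in cofinite. (\<forall>k\<in>J. h k x = 0) \<and> in_span (Suc s) (Suc (Suc s + card J)) (\<lambda>k. h k x) x"
      using h unfolding valid_def by blast
    then show "\<forall>\<^sub>F x in cofinite. (\<forall>k\<in>insert s J. (h(s := \<lambda>_. 0)) k x = 0)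
       \<and> in_span s (Suc (Suc s + card J)) (\<lambda>k. (h(s := \<lambda>_. 0)) k x) x"
    proof eventually_elim
      case (elim x)
      then obtain \<beta> where \<beta>: "\<forall>k\<in>{Suc s..m}. h k x = (\<Sum>q=Suc s..<Suc (Suc s + card J). \<beta> q * v q k x)"
        unfolding in_span_def by blast
      have "(h(s := \<lambda>_. 0)) k x = (\<Sum>q=s..<Suc (Suc s + card J). (\<beta>(s := 0)) q * v q k x)" if k: "k \<in> {s..m}" for k
      proof -
        have "(\<Sum>q=s..<Suc (Suc s + card J). (\<beta>(s := 0)) q * v q k x)
          = (\<Sum>q=Suc s..<Suc (Suc s + card J). \<beta> q * v q k x)"
          by (subst sum.atLeast_Suc_lessThan) (auto intro: sum.cong)
        also have "\<dots> = (h(s := \<lambda>_. 0)) k x"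
        proof (cases "k = s")
          case True
          then have "(\<Sum>q=Suc s..<Suc (Suc s + card J). \<beta> q * v q k x) = 0"
            by (intro sum.neutral) (auto simp: cauchy_tower_less)
          then show ?thesis using True by simp
        next
          case False
          then have "k \<in> {Suc s..m}" using k by auto
          then show ?thesis using \<beta> False by simp
        qed
        finally show ?thesis ..
      qed
      then show ?case using elim unfolding in_span_def by (intro conjI exI[of _ "\<beta>(s := 0)"]) auto
    qed
    show "\<forall>x. x \<notin> I (Suc (Suc s + card J)) \<longrightarrow> (\<exists>k\<in>{s..m}. (h(s := \<lambda>_. 0)) k x \<noteq> 0)"
    proof (intro allI impI)
      fix x assume "x \<notin> I (Suc (Suc s + card J))"
      then obtain k where "k \<in> {Suc s..m}" "h k x \<noteq> 0" using h unfolding valid_def by blast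
      then show "\<exists>k\<in>{s..m}. (h(s := \<lambda>_. 0)) k x \<noteq> 0" by (intro bexI[of _ k]) auto
    qed
  qed
qed

lemma proper_shift:
  assumes "proper (Suc s) J h" "J \<subseteq> {Suc s..m}" "s \<le> m"
  shows "proper s (insert s J) (h(s := \<lambda>_. 0))"
  unfolding proper_def
proof (intro conjI ballI)
  show "valid s (insert s J) (h(s := \<lambda>_. 0))"
    using assms by (intro valid_shift) (auto simp: proper_def)
  fix k assume k: "k \<in> {s..m} - insert s J"
  then have "k \<in> {Suc s..m} - J" by auto
  then show "\<forall>\<^sub>F x in cofinite. (h(s := \<lambda>_. 0)) k x \<noteq> 0"
    using assms(1) k by (auto simp: proper_def)
qed

lemma good_shift:
  assumes "good n (Suc s) J h" "J \<subseteq> {Suc s..m}" "s \<le> m"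
  shows "good n s (insert s J) (h(s := \<lambda>_. 0))"
  using assms
proof (induction n arbitrary: J h)
  case (0 J h)
  then show ?case by (simp only: good.simps proper_shift)
next
  case (Suc n J h)
  have fJ: "finite J" "s \<notin> J" using Suc.prems(2) finite_subset by auto
  have set: "{s..m} - insert s J = {Suc s..m} - J" by auto
  have prp: "proper s (insert s J) (h(s := \<lambda>_. 0))"
    using good_proper[OF Suc.prems(1)] Suc.prems(2,3) by (rule proper_shift)
  have "\<exists>Z \<tau> W' l0 l1. expansion s (insert s J) j (h(s := \<lambda>_. 0)) Z \<tau> W' l0 l1 \<and> K \<le> card Z + card (insert s J) + 1
      \<and> good n s (insert j (insert s J)) W'" if j: "j \<in> {Suc s..m} - J" for j
  proof -
    obtain Z \<tau> W' l0 l1 where e: "expansion (Suc s) J j h Z \<tau> W' l0 l1" "K \<le> card Z + card J + 1"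
        "good n (Suc s) (insert j J) W'"
      using Suc.prems(1) j unfolding good.simps by blast
    have set2: "{s..m} - insert j (insert s J) = {Suc s..m} - insert j J" by auto
    have "expansion s (insert s J) j (h(s := \<lambda>_. 0)) Z \<tau> (W'(s := \<lambda>_. 0)) l0 l1"
      unfolding expansion_def set2
    proof (intro conjI ballI)
      show "finite Z" "Z \<subseteq> I (Suc (s + card (insert s J)))" "\<And>y. y \<in> Z \<Longrightarrow> \<tau> y > 0"
        using e(1) fJ by (auto simp: expansion_def)
      fix k assume k: "k \<in> {Suc s..m} - insert j J"
      then have "k \<noteq> s" "j \<noteq> s" using j by auto
      then show "\<forall>\<^sub>F x in cofinite. (h(s := \<lambda>_. 0)) k x / (h(s := \<lambda>_. 0)) j x
          = l0 k + l1 k * x + (\<Sum>y\<in>Z. (W'(s := \<lambda>_. 0)) k y * \<tau> y / (x - y))"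
        using e(1) k by (simp add: expansion_def)
    qed
    moreover have "good n s (insert j (insert s J)) (W'(s := \<lambda>_. 0))"
      using Suc.IH[OF e(3) _ Suc.prems(3)] j Suc.prems(2) by (simp add: insert_commute[of s j] fun_upd_def)
    moreover have "K \<le> card Z + card (insert s J) + 1" using e(2) fJ by simp
    ultimately show ?thesis by blast
  qed
  then show ?case unfolding good.simps set using prp by blast
qed

lemma in_span_eliminate:
  assumes "in_span s t w x" "in_span (Suc s) (Suc t) w2 x" "w2 s = 0" "s < t"
  shows "in_span s (Suc t) (\<lambda>k. w k - \<kappa> * w2 k) x"
proof -
  obtain \<beta>1 where b1: "\<forall>k\<in>{s..m}. w k = (\<Sum>q=s..<t. \<beta>1 q * v q k x)"
    using assms(1) unfolding in_span_def by blast
  obtain \<beta>2 where b2: "\<forall>k\<in>{Suc s..m}. w2 k = (\<Sum>q=Suc s..<Suc t. \<beta>2 q * v q k x)"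
    using assms(2) unfolding in_span_def by blast
  have w2: "w2 k = (\<Sum>q=Suc s..<Suc t. \<beta>2 q * v q k x)" if "k \<in> {s..m}" for k
  proof (cases "k = s")
    case True
    then have "(\<Sum>q=Suc s..<Suc t. \<beta>2 q * v q k x) = 0"
      by (intro sum.neutral) (auto simp: cauchy_tower_less)
    then show ?thesis using True assms(3) by simp
  qed (use b2 that in auto)
  define \<beta> where "\<beta> q = (if q < t then \<beta>1 q else 0) - \<kappa> * (if q = s then 0 else \<beta>2 q)" for q
  have "w k - \<kappa> * w2 k = (\<Sum>q=s..<Suc t. \<beta> q * v q k x)" if k: "k \<in> {s..m}" for k
  proof -
    have "(\<Sum>q=s..<Suc t. \<beta> q * v q k x) = (\<Sum>q=s..<Suc t. (if q < t then \<beta>1 q else 0) * v q k x)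
        - \<kappa> * (\<Sum>q=s..<Suc t. (if q = s then 0 else \<beta>2 q) * v q k x)"
      by (simp only: \<beta>_def left_diff_distrib sum_subtractf sum_distrib_left mult.assoc)
    also have "(\<Sum>q=s..<Suc t. (if q < t then \<beta>1 q else 0) * v q k x) = (\<Sum>q=s..<t. \<beta>1 q * v q k x)"
      using assms(4) by simp
    also have "(\<Sum>q=s..<Suc t. (if q = s then 0 else \<beta>2 q) * v q k x) = (\<Sum>q=Suc s..<Suc t. \<beta>2 q * v q k x)"
      using assms(4) by (subst sum.atLeast_Suc_lessThan) (auto intro: sum.cong)
    finally show ?thesis using b1 w2 k by simp
  qed
  then show ?thesis unfolding in_span_def by blast
qed

lemma expansion_pointwise:
  assumes W: "valid s J W" and J: "J \<subseteq> {s..m}" and j: "j \<in> {s..m} - J"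
    and e: "expansion s J j W Z \<tau> W' l0 l1" and k: "k \<in> {s..m} - insert j J" and x: "x \<notin> I (Suc (s + card J))"
  shows "W k x / W j x = l0 k + l1 k * x + (\<Sum>y\<in>Z. W' k y * \<tau> y / (x - y))"
proof (rule eq_of_eventually_cofinite[of "- I (Suc (s + card J))" "\<lambda>x. W k x / W j x"
      "\<lambda>x. l0 k + l1 k * x + (\<Sum>y\<in>Z. W' k y * \<tau> y / (x - y))"])
  show "continuous_on (- I (Suc (s + card J))) (\<lambda>x. W k x / W j x)"
    using W j k valid_nonvanishing[OF W J j] by (intro continuous_intros) (auto simp: valid_def)
  have "Z \<subseteq> I (Suc (s + card J))" "finite Z" using e by (auto simp: expansion_def)
  then show "continuous_on (- I (Suc (s + card J))) (\<lambda>x. l0 k + l1 k * x + (\<Sum>y\<in>Z. W' k y * \<tau> y / (x - y)))"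
    by (intro continuous_intros) auto
qed (use closed_I x e k in \<open>auto simp: expansion_def open_Compl\<close>)

lemma point_outside_I: "hi q + 1 \<notin> I q" by (simp add: I_def)

text \<open>
  Division by a column \<open>j\<close> other than the first. The ratios of \<open>h\<close> on the next level have the form
  \<open>h\<^sub>k/h\<^sub>j = \<phi>\<^sub>k\<close> with a Cauchy sum over \<open>Z2\<close>. Subtracting \<open>\<phi>\<^sub>k f\<^sub>j\<close> from \<open>f\<^sub>k\<close> gives a proper vector \<open>H\<close>
  for the columns \<open>insert j J\<close>, because the combination of rows now vanishes in column \<open>j\<close> too. The term
  linear in \<open>x\<close> that \<open>elimination_identity\<close> leaves must vanish, since later columns grow more
  slowly. Finally \<open>f\<^sub>k/f\<^sub>j = \<phi>\<^sub>k + H\<^sub>k/f\<^sub>j\<close>, and expanding \<open>1/f\<^sub>j\<close> by \<open>reciprocal_of_cauchy_sum\<close> gives a Cauchy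
  sum with density \<open>H\<close>. For \<open>k = s\<close> this holds with \<open>\<phi>\<^sub>s = 0\<close> and \<open>H\<^sub>s = 1\<close>.
\<close>

lemma eliminate:
  assumes s: "s \<le> m" and J: "J \<subseteq> {Suc s..m}" and j: "j \<in> {Suc s..m} - J"
    and f: "valid s J f" "\<And>x. f s x = 1" and h: "proper (Suc s) J h"
    and Z: "finite Z" "Z \<noteq> {}" "Z \<subseteq> I (Suc (s + card J))" "\<And>y. y \<in> Z \<Longrightarrow> \<tau> y > 0"
    and fk: "\<And>k. k \<in> {Suc s..m} - J \<Longrightarrow> \<forall>\<^sub>F x in cofinite. f k x = c k + (\<Sum>y\<in>Z. h k y * \<tau> y / (x - y))"
    and e2: "expansion (Suc s) J j h Z2 \<tau>2 h' l0' l1'"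
  obtains H Z' \<tau>' l0 l1 \<kappa> a where
    "proper s (insert j J) H" "\<And>x. H s x = 1"
    "\<And>k x. k \<in> {Suc s..m} - insert j J \<Longrightarrow> H k x = a k + (\<Sum>u\<in>Z2. h' k u * (- (\<tau>2 u * f j u)) / (x - u))"
    "\<kappa> = 1 \<or> \<kappa> = (-1::real)" "expansion s J j f Z' \<tau>' (\<lambda>k x. \<kappa> * H k x) l0 l1" "card Z \<le> card Z' + 1"
proof -
  define t where "t = Suc (s + card J)"
  have fJ: "finite J" "s \<notin> J" using J finite_subset by auto
  have hv: "valid (Suc s) J h" using h by (simp add: proper_def)
  have J': "J \<subseteq> {s..m}" and js: "j \<noteq> s" "j \<in> {s..m} - J" using J j by auto
  have cardj: "Suc (s + card (insert j J)) = Suc t" using fJ j by (simp add: t_def)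
  have disj: "I t \<inter> I (Suc t) = {}" by (rule I_disjoint)
  have Zt: "Z \<subseteq> I t" using Z by (simp add: t_def)
  have Z2: "finite Z2" "Z2 \<subseteq> I (Suc t)" using e2 by (auto simp: expansion_def t_def)
  have ZZ2: "Z \<inter> Z2 = {}" using Zt Z2 disj by auto
  have hnz: "h k x \<noteq> 0" if "k \<in> {Suc s..m} - J" "x \<notin> I (Suc t)" for k x
    using valid_nonvanishing[OF hv J that(1)] that(2) by (simp add: t_def)
  have fnz: "f k x \<noteq> 0" if "k \<in> {s..m} - J" "x \<notin> I t" for k x
    using valid_nonvanishing[OF f(1) J' that(1)] that(2) by (simp add: t_def)
  \<comment> \<open>The closed form of \<open>f j\<close>, with masses of constant sign \<open>\<sigma>\<close>.\<close>
  define F where "F x = c j + (\<Sum>y\<in>Z. h j y * \<tau> y / (x - y))" for x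
  have fF: "f j x = F x" if "x \<notin> I t" for x
  proof (rule eq_of_eventually_cofinite[of "- I t" "f j" F])
    show "continuous_on (- I t) (f j)" using f(1) js by (auto simp: valid_def t_def)
    show "continuous_on (- I t) F" unfolding F_def using Z(1) Zt by (intro continuous_intros) auto
    show "\<forall>\<^sub>F x in cofinite. f j x = F x" using fk[OF j] by (simp add: F_def)
  qed (use that closed_I in auto)
  define \<phi> where "\<phi> k x = l0' k + l1' k * x + (\<Sum>u\<in>Z2. h' k u * \<tau>2 u / (x - u))" for k x
  have h\<phi>: "h k x / h j x = \<phi> k x" if "k \<in> {Suc s..m} - insert j J" "x \<notin> I (Suc t)" for k x
    using expansion_pointwise[OF hv J j e2 that(1)] that(2) by (simp add: \<phi>_def t_def)
  have hj_cont: "continuous_on (I t) (h j)"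
  proof -
    have "continuous_on (- I (Suc t)) (h j)" using hv j by (auto simp: valid_def t_def)
    then show ?thesis by (rule continuous_on_subset) (use disj in auto)
  qed
  have hj_nz: "h j x \<noteq> 0" if "x \<in> I t" for x using hnz[OF j] that disj by auto
  obtain \<sigma> where \<sigma>: "\<sigma> = 1 \<or> \<sigma> = -1" "\<And>x. x \<in> I t \<Longrightarrow> \<sigma> * h j x > 0"
    using constant_sign_on_interval[OF is_interval_I hj_cont hj_nz] by blast
  have It: "I t = {lo t..hi t}" using Z(2) Zt unfolding I_def by (auto split: if_splits)
  have \<sigma>F: "\<sigma> * c j + (\<Sum>y\<in>Z. \<sigma> * (h j y * \<tau> y) / (x - y)) = \<sigma> * F x" for x
    by (simp add: F_def distrib_left sum_distrib_left mult.assoc)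
  have "\<exists>Z' \<theta> A B. finite Z' \<and> Z' \<subseteq> I t \<and> card Z \<le> card Z' + 1 \<and> (\<forall>z\<in>Z'. \<theta> z < 0) \<and>
    (\<forall>x. x \<notin> Z \<longrightarrow> x \<notin> Z' \<longrightarrow> \<sigma> * F x \<noteq> 0 \<and> 1 / (\<sigma> * F x) = A + B * x + (\<Sum>z\<in>Z'. \<theta> z / (x - z)))"
    unfolding \<sigma>F[symmetric] It
  proof (rule reciprocal_of_cauchy_sum[OF Z(1,2)])
    show "Z \<subseteq> {lo t..hi t}" using Zt It by simp
    show "\<sigma> * (h j y * \<tau> y) > 0" if "y \<in> Z" for y
      using \<sigma>(2)[of y] Z(4)[OF that] Zt that by (auto simp: mult.assoc[symmetric])
    show "\<sigma> * c j + (\<Sum>y\<in>Z. \<sigma> * (h j y * \<tau> y) / (x - y)) \<noteq> 0" if "x \<notin> {lo t..hi t}" for x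
      unfolding \<sigma>F using fF[of x] fnz[OF js(2), of x] that It \<sigma>(1) by auto
  qed
  then obtain Z' \<theta> A B where Z': "finite Z'" "Z' \<subseteq> I t" "card Z \<le> card Z' + 1" "\<And>z. z \<in> Z' \<Longrightarrow> \<theta> z < 0"
    and rec: "\<And>x. x \<notin> Z \<Longrightarrow> x \<notin> Z' \<Longrightarrow> \<sigma> * F x \<noteq> 0 \<and> 1 / (\<sigma> * F x) = A + B * x + (\<Sum>z\<in>Z'. \<theta> z / (x - z))"
    by blast
  define G where "G x = \<sigma> * A + \<sigma> * B * x + (\<Sum>z\<in>Z'. \<sigma> * \<theta> z / (x - z))" for x
  have FG: "F x \<noteq> 0" "1 / F x = G x" if "x \<notin> Z" "x \<notin> Z'" for x
  proof -
    have "1 / F x = \<sigma> * (1 / (\<sigma> * F x))" using \<sigma>(1) rec[OF that] by auto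
    also have "\<dots> = G x" using rec[OF that] by (simp add: G_def distrib_left sum_distrib_left mult.assoc)
    finally show "1 / F x = G x" .
    show "F x \<noteq> 0" using rec[OF that] by auto
  qed
  define a where "a k = c k - c j * l0' k - l1' k * (\<Sum>y\<in>Z. h j y * \<tau> y)" for k
  define R where "R k x = a k - (\<Sum>u\<in>Z2. h' k u * \<tau>2 u * F u / (x - u))" for k x
  \<comment> \<open>The linear term is kept until growth at infinity shows that it is zero.\<close>
  define Ht where "Ht k x = (if k = s then 1 else if k \<in> {Suc s..m} - insert j J then R k x - c j * l1' k * x else 0)" for k x
  have f_minus: "f k x - \<phi> k x * F x = R k x - c j * l1' k * x"
    if k: "k \<in> {Suc s..m} - insert j J" and x: "x \<notin> Z" "x \<notin> Z2" and fx: "f k x = c k + (\<Sum>y\<in>Z. h k y * \<tau> y / (x - y))" for k x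
  proof -
    have "h k y * \<tau> y / (x - y) = \<phi> k y * (h j y * \<tau> y) / (x - y)" if "y \<in> Z" for y
    proof -
      have "y \<notin> I (Suc t)" using that Zt disj by auto
      then have "h k y = \<phi> k y * h j y" using h\<phi>[OF k, of y] hnz[OF j, of y] by (simp add: field_simps)
      then show ?thesis by simp
    qed
    then have "f k x = c k + (\<Sum>y\<in>Z. \<phi> k y * (h j y * \<tau> y) / (x - y))"
      unfolding fx by (simp only: cong: sum.cong)
    then show ?thesis
      using elimination_identity[OF ZZ2 x, of "c k" "l0' k" "l1' k" "\<lambda>u. h' k u * \<tau>2 u" "\<lambda>y. h j y * \<tau> y" "c j"]
      unfolding \<phi>_def F_def R_def a_def by simp
  qed
  have contHt: "continuous_on (- I (Suc t)) (Ht k)" for k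
  proof -
    have "continuous_on (- I (Suc t)) (\<lambda>x. R k x - c j * l1' k * x)"
      unfolding R_def using Z2 by (intro continuous_intros) auto
    moreover consider "k = s" | "k \<in> {Suc s..m} - insert j J" | "k \<noteq> s" "k \<notin> {Suc s..m} - insert j J" by blast
    then have "Ht k = (\<lambda>_. 1) \<or> Ht k = (\<lambda>x. R k x - c j * l1' k * x) \<or> Ht k = (\<lambda>_. 0)"
    proof cases
      case 2
      then have "k \<noteq> s" by auto
      then show ?thesis using 2 by (simp add: Ht_def[abs_def])
    next
      case 3
      then have "Ht k = (\<lambda>_. 0)" unfolding Ht_def[abs_def] by (simp only: if_False)
      then show ?thesis by blast
    qed (simp add: Ht_def[abs_def])
    ultimately show ?thesis by auto
  qed
  have validHt: "valid s (insert j J) Ht"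
    unfolding valid_def cardj
  proof (intro conjI ballI allI impI)
    show "continuous_on (- I (Suc t)) (Ht k)" for k by (rule contHt)
    show "\<exists>k\<in>{s..m}. Ht k x \<noteq> 0" for x using s by (intro bexI[of _ s]) (auto simp: Ht_def)
    have ev_f: "\<forall>\<^sub>F x in cofinite. (\<forall>k\<in>J. f k x = 0) \<and> in_span s t (\<lambda>k. f k x) x"
      using f(1) unfolding valid_def t_def by blast
    have ev_h: "\<forall>\<^sub>F x in cofinite. (\<forall>k\<in>J. h k x = 0) \<and> in_span (Suc s) (Suc t) (\<lambda>k. h k x) x"
      using hv unfolding valid_def t_def by simp
    have ev_hj: "\<forall>\<^sub>F x in cofinite. h j x \<noteq> 0" using h j by (auto simp: proper_def)
    have ev_fk: "\<forall>\<^sub>F x in cofinite. \<forall>k\<in>{Suc s..m} - J. f k x = c k + (\<Sum>y\<in>Z. h k y * \<tau> y / (x - y))"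
      using fk by (intro eventually_ball_finite) auto
    have ev_hk: "\<forall>\<^sub>F x in cofinite. \<forall>k\<in>{Suc s..m} - insert j J. h k x / h j x = \<phi> k x"
      using e2 by (intro eventually_ball_finite) (auto simp: expansion_def \<phi>_def)
    have ev_Z: "\<forall>\<^sub>F x in cofinite. x \<notin> Z \<union> Z2"
      using Z(1) Z2(1) by (simp add: eventually_cofinite)
    from ev_f ev_h ev_hj ev_fk ev_hk ev_Z
    show "\<forall>\<^sub>F x in cofinite. (\<forall>k\<in>insert j J. Ht k x = 0) \<and> in_span s (Suc t) (\<lambda>k. Ht k x) x"
    proof eventually_elim
      case (elim x)
      have Fx: "f j x = F x" using elim(4) j by (simp add: F_def)
      define h0 where "h0 = (\<lambda>k. if k = s then 0 else h k x)"
      have span: "in_span s (Suc t) (\<lambda>k. f k x - (f j x / h j x) * h0 k) x"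
      proof (rule in_span_eliminate)
        show "in_span (Suc s) (Suc t) h0 x" using elim(2) unfolding in_span_def h0_def by auto
      qed (use elim(1) in \<open>auto simp: h0_def t_def\<close>)
      have "Ht k x = f k x - (f j x / h j x) * h0 k" if k: "k \<in> {s..m}" for k
      proof -
        consider "k = s" | "k \<in> J" | "k = j" | "k \<in> {Suc s..m} - insert j J" using k js j by force
        then show ?thesis
        proof cases
          case 1
          then show ?thesis using f(2) by (simp add: Ht_def h0_def)
        next
          case 2
          then have "k \<noteq> s" using fJ by auto
          then show ?thesis using 2 elim(1,2) by (simp add: Ht_def h0_def)
        next
          case 3
          then show ?thesis using elim(3) js by (simp add: Ht_def h0_def)
        next
          case 4
          then have "k \<noteq> s" by auto
          have "h k x / h j x = \<phi> k x" using elim(5) 4 by blast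
          then have "(f j x / h j x) * h k x = \<phi> k x * F x" using Fx by (metis mult.commute times_divide_eq_left times_divide_eq_right)
          moreover have "f k x - \<phi> k x * F x = R k x - c j * l1' k * x"
            using elim(4,6) 4 by (intro f_minus) auto
          ultimately show ?thesis using 4 \<open>k \<noteq> s\<close> by (simp add: Ht_def h0_def)
        qed
      qed
      then have "in_span s (Suc t) (\<lambda>k. Ht k x) x" using span unfolding in_span_def by auto
      moreover have "\<forall>k\<in>insert j J. Ht k x = 0" using fJ js by (auto simp: Ht_def)
      ultimately show ?case by blast
    qed
  qed
  have lin: "c j * l1' k = 0" if k: "k \<in> {Suc s..m} - insert j J" for k
  proof -
    have "((\<lambda>x. Ht k x / (x * Ht s x)) \<longlongrightarrow> 0) at_top"
      by (rule later_column_grows_slower[OF validHt]) (use J' js k s fJ in auto)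
    moreover have "((\<lambda>x. Ht k x / (x * Ht s x)) \<longlongrightarrow> - (c j * l1' k)) at_top"
    proof -
      have lim: "((\<lambda>x::real. 1 / x) \<longlongrightarrow> 0) at_top" "((\<lambda>x::real. x / x) \<longlongrightarrow> 1) at_top"
         "((\<lambda>x. 1 / (x - u) * (1 / x)) \<longlongrightarrow> 0) at_top" for u :: real by real_asymp+
      have "((\<lambda>x. a k * (1 / x) - (\<Sum>u\<in>Z2. h' k u * \<tau>2 u * F u * (1 / (x - u) * (1 / x))) - c j * l1' k * (x / x))
        \<longlongrightarrow> a k * 0 - (\<Sum>u\<in>Z2. h' k u * \<tau>2 u * F u * 0) - c j * l1' k * 1) at_top"
        by (intro tendsto_diff tendsto_mult tendsto_sum tendsto_const lim)
      moreover have "Ht k x / (x * Ht s x)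
         = a k * (1 / x) - (\<Sum>u\<in>Z2. h' k u * \<tau>2 u * F u * (1 / (x - u) * (1 / x))) - c j * l1' k * (x / x)" for x
      proof -
        have "k \<noteq> s" using k by auto
        then have "Ht k x / (x * Ht s x) = (R k x - c j * l1' k * x) / x" using k by (simp add: Ht_def)
        then show ?thesis by (simp add: R_def diff_divide_distrib sum_divide_distrib mult.assoc)
      qed
      ultimately show ?thesis by simp
    qed
    ultimately have "0 = - (c j * l1' k)" using tendsto_unique[OF trivial_limit_at_top_linorder] by blast
    then show ?thesis by simp
  qed
  have HtR: "Ht k x = R k x" if "k \<in> {Suc s..m} - insert j J" for k x
    using lin[OF that] that by (auto simp: Ht_def)
  have Ht_eq: "Ht k x = a k + (\<Sum>u\<in>Z2. h' k u * (- (\<tau>2 u * f j u)) / (x - u))" if k: "k \<in> {Suc s..m} - insert j J" for k x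
  proof -
    have "f j u = F u" if "u \<in> Z2" for u using that Z2 disj by (intro fF) auto
    then show ?thesis by (simp add: HtR[OF k] R_def sum_negf mult.assoc)
  qed
  have properHt: "proper s (insert j J) Ht"
    unfolding proper_def
  proof (intro conjI ballI validHt)
    fix k assume k: "k \<in> {s..m} - insert j J"
    show "\<forall>\<^sub>F x in cofinite. Ht k x \<noteq> 0"
    proof (cases "k = s")
      case True
      then show ?thesis by (simp add: Ht_def)
    next
      case False
      then have k': "k \<in> {Suc s..m} - insert j J" using k by auto
      define x0 where "x0 = hi (Suc t) + 1"
      have x0: "x0 \<notin> I (Suc t)" unfolding x0_def by (rule point_outside_I)
      have "Ht k x0 \<noteq> 0"
        using x0 by (intro valid_nonvanishing[OF validHt _ k]) (use J' js cardj in auto)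
      then have "a k + 0 * x0 + (\<Sum>u\<in>Z2. h' k u * (- (\<tau>2 u * f j u)) / (x0 - u)) \<noteq> 0" using Ht_eq[OF k'] by simp
      then have "\<forall>\<^sub>F x in cofinite. a k + 0 * x + (\<Sum>u\<in>Z2. h' k u * (- (\<tau>2 u * f j u)) / (x - u)) \<noteq> 0"
        using x0 Z2 by (intro affine_cauchy_sum_finite_zeros) auto
      then show ?thesis using Ht_eq[OF k'] by simp
    qed
  qed
  define \<eta> where "\<eta> k u = h' k u * \<tau>2 u * F u" for k u
  define l0 where "l0 k = (if k = s then \<sigma> * A else l0' k + a k * (\<sigma> * A) - \<sigma> * B * (\<Sum>u\<in>Z2. \<eta> k u))" for k
  define l1 where "l1 k = (if k = s then \<sigma> * B else l1' k + a k * (\<sigma> * B))" for k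
  have Z2ZZ': "x \<notin> Z" "x \<notin> Z'" if "x \<in> Z2" for x using that Z2 Zt Z' disj by auto
  have \<sigma>\<sigma>: "\<sigma> * \<theta> z = - \<sigma> * (- \<theta> z)" for z by simp
  have "expansion s J j f Z' (\<lambda>z. - \<theta> z) (\<lambda>k x. - \<sigma> * Ht k x) l0 l1"
    unfolding expansion_def t_def[symmetric]
  proof (intro conjI ballI)
    show "finite Z'" "Z' \<subseteq> I t" by fact+
    show "- \<theta> z > 0" if "z \<in> Z'" for z using Z'(4)[OF that] by simp
    fix k assume k: "k \<in> {s..m} - insert j J"
    have ev: "\<forall>\<^sub>F x in cofinite. x \<notin> Z \<union> Z' \<union> Z2"
      using Z(1) Z'(1) Z2(1) by (simp add: eventually_cofinite)
    show "\<forall>\<^sub>F x in cofinite. f k x / f j x = l0 k + l1 k * x + (\<Sum>y\<in>Z'. - \<sigma> * Ht k y * - \<theta> y / (x - y))"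
    proof (cases "k = s")
      case True
      from ev fk[OF j] show ?thesis
      proof eventually_elim
        case (elim x)
        then have "f k x / f j x = G x" using FG(2)[of x] f(2) True by (simp add: F_def)
        then show ?case using True by (simp add: G_def l0_def l1_def Ht_def)
      qed
    next
      case False
      then have k': "k \<in> {Suc s..m} - insert j J" using k by auto
      then have k'': "k \<in> {Suc s..m} - J" by auto
      from ev fk[OF j] fk[OF k''] show ?thesis
      proof eventually_elim
        case (elim x)
        have x: "x \<notin> Z" "x \<notin> Z'" "x \<notin> Z2" using elim(1) by auto
        have fx: "f j x = F x" using elim(2) by (simp add: F_def)
        have "f k x = R k x + \<phi> k x * F x" using f_minus[OF k' x(1,3) elim(3)] lin[OF k'] by simp
        then have "f k x / f j x = \<phi> k x + R k x * G x"
          using FG(1)[OF x(1,2)] fx by (simp add: add_divide_distrib FG(2)[OF x(1,2), symmetric])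
        also have "\<phi> k x = l0' k + l1' k * x + (\<Sum>u\<in>Z2. \<eta> k u * G u / (x - u))"
        proof -
          have "h' k u * \<tau>2 u = \<eta> k u * G u" if "u \<in> Z2" for u
            using FG[OF Z2ZZ'[OF that]] by (simp add: \<eta>_def field_simps)
          then show ?thesis by (simp add: \<phi>_def)
        qed
        also have "l0' k + l1' k * x + (\<Sum>u\<in>Z2. \<eta> k u * G u / (x - u)) + R k x * G x
          = (l0' k + a k * (\<sigma> * A) - \<sigma> * B * (\<Sum>u\<in>Z2. \<eta> k u)) + (l1' k + a k * (\<sigma> * B)) * x
            + (\<Sum>z\<in>Z'. R k z * (\<sigma> * \<theta> z) / (x - z))"
          unfolding G_def R_def \<eta>_def[symmetric]
          by (rule quotient_identity) (use x Z2ZZ' in auto)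
        finally show ?case using False HtR[OF k'] by (simp add: l0_def l1_def mult_ac)
      qed
    qed
  qed
  then show ?thesis using that[of Ht a "- \<sigma>"] properHt Ht_eq \<sigma>(1) Z'(3) by (auto simp: Ht_def)
qed

end

section \<open>Dividing in an arbitrary order\<close>

context atomic_nikishin begin

text \<open>
  The vectors produced by \<open>eliminate\<close>: column \<open>s\<close> is 1, and the other columns are Cauchy sums of a
  vector \<open>h\<close> on the next level, which has to withstand one division less. The
  quantifier over the predecessor \<open>n'\<close> makes this condition void when no division remains.
\<close>

definition special :: "nat \<Rightarrow> nat \<Rightarrow> nat set \<Rightarrow> (nat \<Rightarrow> real \<Rightarrow> real) \<Rightarrow> bool" where
  "special n s J f \<longleftrightarrow> proper s J f \<and> (\<forall>x. f s x = 1) \<and>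
     (\<forall>n'. n = Suc n' \<longrightarrow> (\<exists>h Z \<tau> c. good n' (Suc s) J h \<and> finite Z \<and> Z \<subseteq> I (Suc (s + card J)) \<and>
        (\<forall>y\<in>Z. \<tau> y > 0) \<and> K \<le> card Z + card J \<and>
        (\<forall>k\<in>{Suc s..m} - J. \<forall>\<^sub>F x in cofinite. f k x = c k + (\<Sum>y\<in>Z. h k y * \<tau> y / (x - y)))))"

text \<open>
  Dividing by column \<open>s\<close> yields \<open>h\<close>; dividing by another column yields, by \<open>eliminate\<close>, a special
  vector with one more column removed.
\<close>

lemma good_of_special:
  assumes "s \<le> m" "J \<subseteq> {Suc s..m}" "n + s + card J = m" "special n s J f"
  shows "good n s J f"
  using assms(2-4)
proof (induction n arbitrary: J f)
  case 0
  then show ?case by (simp add: special_def)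
next
  case (Suc n)
  have fJ: "finite J" "s \<notin> J" using Suc.prems(1) finite_subset by auto
  have p: "proper s J f" and fs: "\<And>x. f s x = 1" using Suc.prems(3) by (auto simp: special_def)
  then have vf: "valid s J f" by (simp add: proper_def)
  from Suc.prems(3)[unfolded special_def, THEN conjunct2, THEN conjunct2, rule_format, OF refl]
  obtain h Z \<tau> c where hZ: "good n (Suc s) J h \<and> finite Z \<and> Z \<subseteq> I (Suc (s + card J)) \<and>
        (\<forall>y\<in>Z. \<tau> y > 0) \<and> K \<le> card Z + card J \<and>
        (\<forall>k\<in>{Suc s..m} - J. \<forall>\<^sub>F x in cofinite. f k x = c k + (\<Sum>y\<in>Z. h k y * \<tau> y / (x - y)))"
    by (elim exE) (rule that)
  then have h: "good n (Suc s) J h" and Z: "finite Z" "Z \<subseteq> I (Suc (s + card J))"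
      "\<And>y. y \<in> Z \<Longrightarrow> \<tau> y > 0" "K \<le> card Z + card J"
    and fk: "\<And>k. k \<in> {Suc s..m} - J \<Longrightarrow> \<forall>\<^sub>F x in cofinite. f k x = c k + (\<Sum>y\<in>Z. h k y * \<tau> y / (x - y))"
    by (simp_all only: simp_thms)
  have Zne: "Z \<noteq> {}" using Z(4) K_large Suc.prems(2) by auto
  have "\<exists>Z \<tau> W' l0 l1. expansion s J j f Z \<tau> W' l0 l1 \<and> K \<le> card Z + card J + 1 \<and> good n s (insert j J) W'"
    if j: "j \<in> {s..m} - J" for j
  proof (cases "j = s")
    case True
    have set: "{s..m} - insert j J = {Suc s..m} - J" using True by auto
    have "expansion s J j f Z \<tau> (h(s := \<lambda>_. 0)) c (\<lambda>_. 0)"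
      unfolding expansion_def set
    proof (intro conjI ballI)
      fix k assume k: "k \<in> {Suc s..m} - J"
      then have "k \<noteq> s" by auto
      then show "\<forall>\<^sub>F x in cofinite. f k x / f j x = c k + 0 * x + (\<Sum>y\<in>Z. (h(s := \<lambda>_. 0)) k y * \<tau> y / (x - y))"
        using fk[OF k] True fs by simp
    qed (use Z in auto)
    moreover have "good n s (insert j J) (h(s := \<lambda>_. 0))"
      unfolding True using h Suc.prems(1) assms(1) by (rule good_shift)
    moreover have "K \<le> card Z + card J + 1" using Z(4) by simp
    ultimately show ?thesis by blast
  next
    case False
    then have j': "j \<in> {Suc s..m} - J" using j by auto
    define t where "t = Suc (s + card J)"
    have "\<exists>Z2 \<tau>2 h' l0 l1. expansion (Suc s) J j h Z2 \<tau>2 h' l0 l1 \<and>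
        (\<forall>n'. n = Suc n' \<longrightarrow> K \<le> card Z2 + card J + 1 \<and> good n' (Suc s) (insert j J) h')"
    proof (cases n)
      case 0
      have "card ({Suc s..m} - J) = 1" using Suc.prems(1,2) fJ 0 by (simp add: card_Diff_subset)
      then have "{Suc s..m} - J = {j}" using j' by (metis card_1_singletonE singletonD)
      then have "{Suc s..m} - insert j J = {}" by auto
      then have "expansion (Suc s) J j h {} (\<lambda>_. 1) h (\<lambda>_. 0) (\<lambda>_. 0)"
        unfolding expansion_def by (simp only: ball_empty) simp
      then show ?thesis using 0 by blast
    next
      case (Suc n')
      then show ?thesis using h j' unfolding Suc good.simps by blast
    qed
    then obtain Z2 \<tau>2 h' l0' l1' where e2: "expansion (Suc s) J j h Z2 \<tau>2 h' l0' l1'"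
      and next_good: "\<And>n'. n = Suc n' \<Longrightarrow> K \<le> card Z2 + card J + 1 \<and> good n' (Suc s) (insert j J) h'"
      by blast
    obtain H Z' \<tau>' l0 l1 \<kappa> a where H: "proper s (insert j J) H" "\<And>x. H s x = 1"
        "\<And>k x. k \<in> {Suc s..m} - insert j J \<Longrightarrow> H k x = a k + (\<Sum>u\<in>Z2. h' k u * (- (\<tau>2 u * f j u)) / (x - u))"
      and \<kappa>: "\<kappa> = 1 \<or> \<kappa> = (-1::real)" and e: "expansion s J j f Z' \<tau>' (\<lambda>k x. \<kappa> * H k x) l0 l1" "card Z \<le> card Z' + 1"
    proof (rule eliminate[OF assms(1) Suc.prems(1) j' vf fs good_proper[OF h] Z(1) Zne Z(2,3) fk e2], goal_cases)
      case (3 H Z' \<tau>' l0 l1 \<kappa> a)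
      then show ?case by (intro that)
    qed
    have cardj: "card (insert j J) = Suc (card J)" using fJ j' by simp
    have "special n s (insert j J) H"
      unfolding special_def
    proof (intro conjI allI impI)
      fix n' assume n': "n = Suc n'"
      have Z2: "finite Z2" "Z2 \<subseteq> I (Suc t)" "\<And>u. u \<in> Z2 \<Longrightarrow> \<tau>2 u > 0" using e2 by (auto simp: expansion_def t_def)
      have disj: "I t \<inter> I (Suc t) = {}" by (rule I_disjoint)
      have jm: "j \<in> {s..m} - J" by (rule j)
      have "continuous_on (- I t) (f j)" using vf jm by (auto simp: valid_def t_def)
      then have "continuous_on (I (Suc t)) (f j)" by (rule continuous_on_subset) (use disj in auto)
      moreover have "f j x \<noteq> 0" if "x \<in> I (Suc t)" for x
      proof -
        have "J \<subseteq> {s..m}" using Suc.prems(1) by auto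
        then show ?thesis using valid_nonvanishing[OF vf _ jm, of x] that disj by (auto simp: t_def)
      qed
      \<comment> \<open>The masses \<open>- \<tau>2 f\<^sub>j\<close> have constant sign; a sign is moved into the
        density to make them positive.\<close>
      ultimately obtain \<epsilon> where \<epsilon>: "\<epsilon> = 1 \<or> \<epsilon> = -1" "\<And>x. x \<in> I (Suc t) \<Longrightarrow> \<epsilon> * f j x > 0"
        using constant_sign_on_interval[OF is_interval_I] by metis
      have "good n' (Suc s) (insert j J) (\<lambda>k x. - \<epsilon> * h' k x)"
        using next_good[OF n'] \<epsilon>(1) by (intro good_scale) auto
      moreover have "Z2 \<subseteq> I (Suc (s + card (insert j J)))" using Z2(2) cardj by (simp add: t_def)
      moreover have "\<forall>y\<in>Z2. \<tau>2 y * (\<epsilon> * f j y) > 0" using Z2 \<epsilon>(2) by auto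
      moreover have "K \<le> card Z2 + card (insert j J)" using next_good[OF n'] cardj by simp
      moreover have "\<forall>k\<in>{Suc s..m} - insert j J. \<forall>\<^sub>F x in cofinite.
          H k x = a k + (\<Sum>y\<in>Z2. (- \<epsilon> * h' k y) * (\<tau>2 y * (\<epsilon> * f j y)) / (x - y))"
      proof
        fix k assume k: "k \<in> {Suc s..m} - insert j J"
        have "- \<epsilon> * h' k y * (\<tau>2 y * (\<epsilon> * f j y)) = h' k y * (- (\<tau>2 y * f j y))" for y
          using \<epsilon>(1) by auto
        then show "\<forall>\<^sub>F x in cofinite. H k x = a k + (\<Sum>y\<in>Z2. (- \<epsilon> * h' k y) * (\<tau>2 y * (\<epsilon> * f j y)) / (x - y))"
          by (simp only: H(3)[OF k]) simp
      qed
      ultimately show "\<exists>h Z \<tau> c. good n' (Suc s) (insert j J) h \<and> finite Z \<and> Z \<subseteq> I (Suc (s + card (insert j J))) \<and>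
        (\<forall>y\<in>Z. \<tau> y > 0) \<and> K \<le> card Z + card (insert j J) \<and>
        (\<forall>k\<in>{Suc s..m} - insert j J. \<forall>\<^sub>F x in cofinite. H k x = c k + (\<Sum>y\<in>Z. h k y * \<tau> y / (x - y)))"
        using Z2(1) by (intro exI[of _ "\<lambda>k x. - \<epsilon> * h' k x"] exI[of _ Z2] exI[of _ "\<lambda>y. \<tau>2 y * (\<epsilon> * f j y)"] exI[of _ a] conjI)
    qed (use H in auto)
    then have "good n s (insert j J) H"
      using Suc.prems(1,2) j' cardj by (intro Suc.IH) auto
    then have "good n s (insert j J) (\<lambda>k x. \<kappa> * H k x)" using \<kappa> by (intro good_scale) auto
    moreover have "K \<le> card Z' + card J + 1" using e(2) Z(4) by simp
    ultimately show ?thesis using e(1) by blast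
  qed
  then show ?case using p unfolding good.simps by blast
qed

lemma proper_tower: "s \<le> m \<Longrightarrow> proper s {} (v s)"
  unfolding proper_def valid_def
proof (intro conjI ballI allI impI)
  assume s: "s \<le> m"
  show "continuous_on (- I (Suc (s + card {}))) (v s k)" for k
    using Y_subset[of "Suc s"] by (intro continuous_on_subset[OF continuous_on_v]) auto
  show "\<exists>k\<in>{s..m}. v s k x \<noteq> 0" for x using s by (intro bexI[of _ s]) auto
  have "in_span s (Suc (s + card {})) (\<lambda>k. v s k x) x" for x
    unfolding in_span_def by (intro exI[of _ "\<lambda>_. 1"]) simp
  then show "\<forall>\<^sub>F x in cofinite. (\<forall>k\<in>{}. v s k x = 0) \<and> in_span s (Suc (s + card {})) (\<lambda>k. v s k x) x"
    by simp
  note valid = this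
  fix k assume k: "k \<in> {s..m} - {}"
  show "\<forall>\<^sub>F x in cofinite. v s k x \<noteq> 0"
  proof (cases "k = s")
    case False
    then have sk: "s < k" using k by auto
    define x0 where "x0 = hi (Suc s) + 1"
    have x0: "x0 \<notin> I (Suc s)" unfolding x0_def by (rule point_outside_I)
    have "v s k x0 \<noteq> 0"
    proof
      assume "v s k x0 = 0"
      then have "(1::real) = 0"
        using x0 k by (intro chebyshev_constants[of "{k}" s "{x0}" "\<lambda>_. 1" k]) auto
      then show False by simp
    qed
    then have "0 + 0 * x0 + (\<Sum>y\<in>Y (Suc s). \<mu> (Suc s) y * v (Suc s) k y / (x0 - y)) \<noteq> 0"
      using cauchy_tower_step[OF sk] by simp
    then have "\<forall>\<^sub>F x in cofinite. 0 + 0 * x + (\<Sum>y\<in>Y (Suc s). \<mu> (Suc s) y * v (Suc s) k y / (x - y)) \<noteq> 0"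
      using x0 Y_subset[of "Suc s"] by (intro affine_cauchy_sum_finite_zeros) auto
    then show ?thesis using cauchy_tower_step[OF sk] by simp
  qed simp
qed

lemma good_tower:
  assumes "s \<le> m"
  shows "good (m - s) s {} (v s)"
  using assms
proof (induction s rule: inc_induct)
  case base
  show ?case using proper_tower[of m] by simp
next
  case (step s)
  have ms: "m - s = Suc (m - Suc s)" using step.hyps by simp
  show ?case
  proof (rule good_of_special)
    show "special (m - s) s {} (v s)"
      unfolding special_def ms
    proof (intro conjI allI impI)
      show "proper s {} (v s)" using step.hyps by (intro proper_tower) simp
      fix n' assume n': "Suc (m - Suc s) = Suc n'"
      show "\<exists>h Z \<tau> c. good n' (Suc s) {} h \<and> finite Z \<and> Z \<subseteq> I (Suc (s + card {})) \<and>
         (\<forall>y\<in>Z. \<tau> y > 0) \<and> K \<le> card Z + card {} \<and>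
         (\<forall>k\<in>{Suc s..m} - {}. \<forall>\<^sub>F x in cofinite. v s k x = c k + (\<Sum>y\<in>Z. h k y * \<tau> y / (x - y)))"
      proof (intro exI conjI ballI)
        show "good n' (Suc s) {} (v (Suc s))" using step.IH n' by simp
        show "Y (Suc s) \<subseteq> I (Suc (s + card {}))" using Y_subset by simp
        show "\<mu> (Suc s) y > 0" if "y \<in> Y (Suc s)" for y using mass_pos that by blast
        show "K \<le> card (Y (Suc s)) + card {}" using card_Y[of "Suc s"] step.hyps by simp
        show "\<forall>\<^sub>F x in cofinite. v s k x = 0 + (\<Sum>y\<in>Y (Suc s). v (Suc s) k y * \<mu> (Suc s) y / (x - y))"
          if "k \<in> {Suc s..m} - {}" for k
          using that by (auto simp: cauchy_tower_step[of s k] mult.commute)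
      qed simp
    qed simp
  qed (use step.hyps in auto)
qed

section \<open>The Chebyshev property of towers\<close>

lemma largest_then_first:
  fixes d :: "nat \<Rightarrow> nat"
  assumes "finite R" "R \<noteq> {}"
  obtains j where "j \<in> R" "\<And>k. k \<in> R \<Longrightarrow> d k \<le> d j" "\<And>k. k \<in> R \<Longrightarrow> k < j \<Longrightarrow> d k < d j"
proof -
  define M where "M = {k\<in>R. d k = Max (d ` R)}"
  have "Max (d ` R) \<in> d ` R" using assms by (intro Max_in) auto
  then have "M \<noteq> {}" by (auto simp: M_def)
  have fM: "finite M" using assms by (simp add: M_def)
  define j where "j = Min M"
  have j: "j \<in> M" unfolding j_def using fM \<open>M \<noteq> {}\<close> by (rule Min_in)
  have le: "d k \<le> d j" if "k \<in> R" for k using j that assms by (simp add: M_def)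
  moreover have "d k < d j" if k: "k \<in> R" "k < j" for k
  proof -
    have "k \<notin> M"
    proof
      assume "k \<in> M"
      then have "j \<le> k" unfolding j_def by (rule Min_le[OF fM])
      then show False using k(2) by simp
    qed
    then show ?thesis using le[OF k(1)] j k(1) by (auto simp: M_def)
  qed
  ultimately show ?thesis using that j by (auto simp: M_def)
qed

text \<open>
  Dividing \<open>\<Sum> p\<^sub>k W\<^sub>k\<close> by \<open>W\<^sub>j\<close> and moving the polynomials into the Cauchy sums by synthetic division
  gives \<open>P + \<Sum> \<Phi> \<tau>/(x - y)\<close> with \<open>\<Phi> = \<Sum> p\<^sub>k W'\<^sub>k\<close>. By \<open>zeros_pass_to_density\<close>, the form \<open>\<Phi>\<close>, which
  misses column \<open>j\<close>, inherits all but \<open>d j\<close> of the zeros, provided that \<open>deg P < d j\<close>. The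
  critical terms of \<open>P\<close> are \<open>l\<^sub>1 x p\<^sub>k\<close>: for \<open>k > j\<close> growth forces \<open>l\<^sub>1 = 0\<close>, and for \<open>k < j\<close> the
  choice of \<open>j\<close> gives \<open>d k < d j\<close>.
\<close>

lemma chebyshev_good:
  fixes p :: "nat \<Rightarrow> real poly" and d :: "nat \<Rightarrow> nat"
  assumes "good n s J W" "J \<subseteq> {s..m}" "n + s + card J = m"
    and "\<And>k. k \<in> {s..m} - J \<Longrightarrow> deg_below (p k) (d k)"
    and "finite X" "X \<inter> I (Suc (s + card J)) = {}" "(\<Sum>k\<in>{s..m}-J. d k) \<le> card X"
    and "(\<Sum>k\<in>{s..m}-J. d k) + m + 1 \<le> K"
    and "\<And>x. x \<in> X \<Longrightarrow> (\<Sum>k\<in>{s..m}-J. poly (p k) x * W k x) = 0"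
    and "k \<in> {s..m} - J"
  shows "p k = 0"
  using assms
proof (induction n arbitrary: J W X k)
  case (0 J W X k)
  have fJ: "finite J" using 0(2) finite_subset by blast
  have "card ({s..m} - J) = 1"
  proof -
    have "s \<le> m" using 0(10) by auto
    then show ?thesis using 0(2,3) fJ by (simp add: card_Diff_subset)
  qed
  then have R: "{s..m} - J = {k}" using 0(10) by (metis card_1_singletonE singletonD)
  have vW: "valid s J W" using 0(1) by (simp add: proper_def)
  show ?case
  proof (rule deg_below_many_zeros)
    show "deg_below (p k) (d k)" "d k \<le> card X" "finite X" using 0 R by auto
    fix x assume "x \<in> X"
    then have "poly (p k) x * W k x = 0" using 0(9)[of x] R by simp
    moreover have "W k x \<noteq> 0" using \<open>x \<in> X\<close> 0(6) by (intro valid_nonvanishing[OF vW 0(2,10)]) auto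
    ultimately show "poly (p k) x = 0" by simp
  qed
next
  case (Suc n J W X k)
  define t where "t = Suc (s + card J)"
  let ?R = "{s..m} - J"
  have fJ: "finite J" using Suc.prems(2) finite_subset by blast
  have vW: "valid s J W" using good_proper[OF Suc.prems(1)] by (simp add: proper_def)
  obtain j where j: "j \<in> ?R" "\<And>k. k \<in> ?R \<Longrightarrow> d k \<le> d j" "\<And>k. k \<in> ?R \<Longrightarrow> k < j \<Longrightarrow> d k < d j"
  proof -
    have "finite ?R" "?R \<noteq> {}" using Suc.prems(10) by auto
    from largest_then_first[OF this, of d] show ?thesis using that by blast
  qed
  obtain Z \<tau> W' l0 l1 where e: "expansion s J j W Z \<tau> W' l0 l1" "K \<le> card Z + card J + 1"
      "good n s (insert j J) W'"
    using Suc.prems(1) j(1) unfolding good.simps by blast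
  let ?R' = "{s..m} - insert j J"
  have R: "?R = insert j ?R'" using j(1) by auto
  have split: "(\<Sum>k\<in>?R. g k) = g j + (\<Sum>k\<in>?R'. g k)" for g :: "nat \<Rightarrow> real"
    by (subst R) simp
  have Z: "finite Z" "Z \<subseteq> I t" "\<And>y. y \<in> Z \<Longrightarrow> \<tau> y > 0" using e(1) by (auto simp: expansion_def t_def)
  have Xt: "X \<inter> I t = {}" using Suc.prems(6) by (simp add: t_def)
  have Wj: "W j x \<noteq> 0" if "x \<notin> I t" for x
    using valid_nonvanishing[OF vW Suc.prems(2) j(1)] that by (simp add: t_def)
  have l1: "l1 k = 0" if k: "k \<in> ?R'" "j < k" for k
  proof -
    have lim: "((\<lambda>x::real. 1 / x) \<longlongrightarrow> 0) at_top" "((\<lambda>x::real. x / x) \<longlongrightarrow> 1) at_top"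
       "((\<lambda>x. 1 / (x - u) * (1 / x)) \<longlongrightarrow> 0) at_top" for u :: real by real_asymp+
    have "((\<lambda>x. l0 k * (1 / x) + l1 k * (x / x) + (\<Sum>y\<in>Z. W' k y * \<tau> y * (1 / (x - y) * (1 / x))))
        \<longlongrightarrow> l0 k * 0 + l1 k * 1 + (\<Sum>y\<in>Z. W' k y * \<tau> y * 0)) at_top"
      by (intro tendsto_add tendsto_mult tendsto_sum tendsto_const lim)
    moreover have "\<forall>\<^sub>F x in at_top. l0 k * (1 / x) + l1 k * (x / x) + (\<Sum>y\<in>Z. W' k y * \<tau> y * (1 / (x - y) * (1 / x)))
        = W k x / (x * W j x)"
      using eventually_gt_at_top[of "hi t"]
    proof eventually_elim
      case (elim x)
      then have "x \<notin> I t" by (auto simp: I_def)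
      then have "W k x / W j x = l0 k + l1 k * x + (\<Sum>y\<in>Z. W' k y * \<tau> y / (x - y))"
        using expansion_pointwise[OF vW Suc.prems(2) j(1) e(1) k(1)] by (simp add: t_def)
      then have "W k x / (x * W j x) = (l0 k + l1 k * x + (\<Sum>y\<in>Z. W' k y * \<tau> y / (x - y))) / x"
        by (metis divide_divide_eq_left mult.commute)
      then show ?case by (simp add: add_divide_distrib sum_divide_distrib mult.assoc)
    qed
    ultimately have "((\<lambda>x. W k x / (x * W j x)) \<longlongrightarrow> l1 k) at_top"
      by (auto elim: Lim_transform_eventually)
    moreover have "((\<lambda>x. W k x / (x * W j x)) \<longlongrightarrow> 0) at_top"
      using k j(1) by (intro later_column_grows_slower[OF vW Suc.prems(2)]) auto
    ultimately show ?thesis using tendsto_unique[OF trivial_limit_at_top_linorder] by blast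
  qed
  define \<Phi> where "\<Phi> y = (\<Sum>k\<in>?R'. poly (p k) y * W' k y)" for y
  define P where "P = p j + (\<Sum>k\<in>?R'. smult (l0 k) (p k) + smult (l1 k) (pCons 0 (p k))
      + (\<Sum>y\<in>Z. smult (W' k y * \<tau> y) (synthetic_div (p k) y)))"
  have degP: "deg_below P (d j)"
    unfolding P_def
  proof (intro deg_below_add deg_below_sum)
    show "deg_below (p j) (d j)" using Suc.prems(4) j(1) by blast
    fix k assume k: "k \<in> ?R'"
    then have dk: "deg_below (p k) (d k)" "d k \<le> d j" using Suc.prems(4) j(2) by auto
    show "deg_below (smult (l0 k) (p k)) (d j)" using deg_below_mono[OF dk] by (rule deg_below_smult)
    show "deg_below (smult (l1 k) (pCons 0 (p k))) (d j)"
    proof (cases "j < k")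
      case True
      then show ?thesis using l1[OF k] by (simp add: deg_below_def)
    next
      case False
      then have "d k < d j" using j(3) k by (auto simp: not_less le_less)
      then show ?thesis using deg_below_pCons[OF dk(1), of 0]
        by (intro deg_below_smult) (auto elim: deg_below_mono)
    qed
    show "deg_below (smult (W' k y * \<tau> y) (synthetic_div (p k) y)) (d j)" for y
      using deg_below_mono[OF deg_below_synthetic_div[OF dk(1)] dk(2)] by (rule deg_below_smult)
  qed
  have F: "poly P x + (\<Sum>y\<in>Z. \<Phi> y * \<tau> y / (x - y)) = 0" if x: "x \<in> X" for x
  proof -
    have xt: "x \<notin> I t" using x Xt by auto
    have "(\<Sum>k\<in>?R'. poly (p k) x * (W k x / W j x))
       = (\<Sum>k\<in>?R'. poly (p k) x * (l0 k + l1 k * x) + (\<Sum>y\<in>Z. W' k y * \<tau> y * poly (synthetic_div (p k) y) x)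
           + (\<Sum>y\<in>Z. poly (p k) y * W' k y * \<tau> y / (x - y)))"
    proof (intro sum.cong refl)
      fix k assume k: "k \<in> ?R'"
      have "poly (p k) x * (W' k y * \<tau> y / (x - y))
          = W' k y * \<tau> y * poly (synthetic_div (p k) y) x + poly (p k) y * W' k y * \<tau> y / (x - y)" if "y \<in> Z" for y
      proof -
        have xy: "x - y \<noteq> 0" using that Z xt by auto
        have eq: "poly (p k) x = (x - y) * poly (synthetic_div (p k) y) x + poly (p k) y"
        proof -
          have "poly ([:-y, 1:] * synthetic_div (p k) y + [:poly (p k) y:]) x = poly (p k) x"
            by (simp only: synthetic_div_correct')
          then show ?thesis by (simp add: algebra_simps)
        qed
        have "(u * q + r) * (w / u) = w * q + r * w / u" if "u \<noteq> 0" for u q r w :: real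
          using that by (simp add: field_simps)
        from this[OF xy, of "poly (synthetic_div (p k) y) x" "poly (p k) y" "W' k y * \<tau> y"]
        show ?thesis unfolding eq by (simp add: mult.assoc)
      qed
      then have "(\<Sum>y\<in>Z. poly (p k) x * (W' k y * \<tau> y / (x - y)))
          = (\<Sum>y\<in>Z. W' k y * \<tau> y * poly (synthetic_div (p k) y) x) + (\<Sum>y\<in>Z. poly (p k) y * W' k y * \<tau> y / (x - y))"
        by (simp add: sum.distrib)
      then show "poly (p k) x * (W k x / W j x) = poly (p k) x * (l0 k + l1 k * x) + (\<Sum>y\<in>Z. W' k y * \<tau> y * poly (synthetic_div (p k) y) x)
           + (\<Sum>y\<in>Z. poly (p k) y * W' k y * \<tau> y / (x - y))"
        using expansion_pointwise[OF vW Suc.prems(2) j(1) e(1) k] xt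
        by (simp add: t_def distrib_left sum_distrib_left)
    qed
    also have "\<dots> = poly (P - p j) x + (\<Sum>k\<in>?R'. \<Sum>y\<in>Z. poly (p k) y * W' k y * \<tau> y / (x - y))"
      by (simp add: P_def poly_sum sum.distrib algebra_simps)
    also have "(\<Sum>k\<in>?R'. \<Sum>y\<in>Z. poly (p k) y * W' k y * \<tau> y / (x - y)) = (\<Sum>y\<in>Z. \<Phi> y * \<tau> y / (x - y))"
      unfolding \<Phi>_def by (subst sum.swap) (simp add: sum_distrib_right sum_divide_distrib)
    finally have 1: "(\<Sum>k\<in>?R'. poly (p k) x * (W k x / W j x)) = poly (P - p j) x + (\<Sum>y\<in>Z. \<Phi> y * \<tau> y / (x - y))" .
    have "(\<Sum>k\<in>?R. poly (p k) x * W k x) = poly (p j) x * W j x + (\<Sum>k\<in>?R'. poly (p k) x * W k x)"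
      by (rule split)
    then have "poly (p j) x * W j x + (\<Sum>k\<in>?R'. poly (p k) x * W k x) = 0" using Suc.prems(9)[OF x] by simp
    then have "(poly (p j) x * W j x + (\<Sum>k\<in>?R'. poly (p k) x * W k x)) / W j x = 0" by simp
    then have "poly (p j) x + (\<Sum>k\<in>?R'. poly (p k) x * (W k x / W j x)) = 0"
      using Wj[OF xt] by (simp add: add_divide_distrib sum_divide_distrib)
    then show ?thesis using 1 by simp
  qed
  have sumR: "(\<Sum>k\<in>?R. d k) = d j + (\<Sum>k\<in>?R'. d k)" by (subst R) simp
  have cardj: "card (insert j J) = Suc (card J)" using fJ j(1) by simp
  have rest: "p k = 0" if k: "k \<in> ?R'" for k
  proof -
    have It: "I t = {lo t..hi t}" if "Z \<noteq> {}" using that Z(2) unfolding I_def by (auto split: if_splits)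
    have "card J < card {s..m}" using j(1) Suc.prems(2) by (intro psubset_card_mono) auto
    then have cJ: "card J \<le> m" by simp
    have Zne: "Z \<noteq> {}" using e(2) K_large Suc.prems(2,3) by auto
    have "\<exists>X'. finite X' \<and> X' \<subseteq> {lo t..hi t} \<and> card X' = (\<Sum>k\<in>?R'. d k) \<and> (\<forall>x\<in>X'. \<Phi> x = 0)"
    proof (rule zeros_pass_to_density[OF Z(1) _ Z(3) _ _ Suc.prems(5)])
      show "Z \<subseteq> {lo t..hi t}" "X \<inter> {lo t..hi t} = {}" using Z(2) Xt It[OF Zne] by auto
      have vW': "valid s (insert j J) W'" using good_proper[OF e(3)] by (simp add: proper_def)
      then have "continuous_on (- I (Suc t)) (W' k)" if "k \<in> {s..m}" for k
        using that cardj by (auto simp: valid_def t_def)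
      then have "continuous_on (I t) \<Phi>" unfolding \<Phi>_def using I_disjoint[of t]
        by (intro continuous_intros) (auto intro: continuous_on_subset)
      then show "continuous_on {lo t..hi t} \<Phi>" using It[OF Zne] by simp
      show "(\<Sum>k\<in>?R'. d k) \<le> card Z" using e(2) Suc.prems(8) sumR cJ by simp
      show "P = 0 \<and> (\<Sum>k\<in>?R'. d k) \<le> card X \<or> (\<Sum>k\<in>?R'. d k) + degree P + 1 \<le> card X \<or>
        P = 0 \<and> (\<Sum>y\<in>Z. \<Phi> y * \<tau> y) = 0 \<and> (\<Sum>k\<in>?R'. d k) \<le> card X + 1"
        using degP Suc.prems(7) sumR by (auto simp: deg_below_degree)
    qed (use F in auto)
    then obtain X' where X': "finite X'" "X' \<subseteq> I t" "card X' = (\<Sum>k\<in>?R'. d k)" "\<forall>x\<in>X'. \<Phi> x = 0"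
      using It[OF Zne] by auto
    show ?thesis
    proof (rule Suc.IH[OF e(3)])
      show "insert j J \<subseteq> {s..m}" "n + s + card (insert j J) = m" using Suc.prems(2,3) j(1) cardj by auto
      show "X' \<inter> I (Suc (s + card (insert j J))) = {}"
        using X'(2) I_disjoint[of t] cardj by (auto simp: t_def)
      show "(\<Sum>k\<in>?R'. d k) + m + 1 \<le> K" using Suc.prems(8) sumR by simp
      show "(\<Sum>k\<in>?R'. poly (p k) x * W' k x) = 0" if "x \<in> X'" for x
        using X'(4) that by (simp add: \<Phi>_def)
    qed (use X' k Suc.prems(4) in auto)
  qed
  show ?case
  proof (cases "k = j")
    case True
    show ?thesis unfolding True
    proof (rule deg_below_many_zeros[of _ "d j" X])
      show "deg_below (p j) (d j)" "finite X" "d j \<le> card X" using Suc.prems(4,5,7) j(1) sumR by auto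
      fix x assume x: "x \<in> X"
      have "(\<Sum>k\<in>?R. poly (p k) x * W k x) = poly (p j) x * W j x"
        unfolding split using rest by simp
      then show "poly (p j) x = 0" using Suc.prems(9)[OF x] Wj x Xt by auto
    qed
  qed (use rest Suc.prems(10) in auto)
qed

lemma chebyshev_tower:
  fixes p :: "nat \<Rightarrow> real poly" and d :: "nat \<Rightarrow> nat"
  assumes "\<And>k. k \<le> m \<Longrightarrow> deg_below (p k) (d k)"
    and "finite X" "X \<inter> I 1 = {}" "(\<Sum>k\<le>m. d k) \<le> card X" "(\<Sum>k\<le>m. d k) + m + 1 \<le> K"
    and "\<And>x. x \<in> X \<Longrightarrow> (\<Sum>k\<le>m. poly (p k) x * v 0 k x) = 0" "k \<le> m"
  shows "p k = 0"
proof (rule chebyshev_good[of m 0 "{}" "v 0" p d X k])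
  show "good m 0 {} (v 0)" using good_tower[of 0] by simp
qed (use assms in \<open>auto simp: atMost_atLeast0\<close>)

end

section \<open>Exact quadrature\<close>

text \<open>
  Among more than \<open>card A\<close> points there is a linear relation between the vectors \<open>(F i v)\<^sub>i\<close>. Moving the
  weights along it until the first one becomes zero removes a point.
\<close>

lemma conic_caratheodory:
  fixes F :: "'i \<Rightarrow> real \<Rightarrow> real"
  assumes "finite A" "finite V" "\<And>v. v \<in> V \<Longrightarrow> w v > 0"
  shows "\<exists>V' w'. V' \<subseteq> V \<and> card V' \<le> card A \<and> (\<forall>v\<in>V'. w' v > 0) \<and>
     (\<forall>i\<in>A. (\<Sum>v\<in>V'. w' v * F i v) = (\<Sum>v\<in>V. w v * F i v))"
  using assms(2,3)
proof (induction "card V" arbitrary: V w rule: less_induct)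
  case less
  show ?case
  proof (cases "card V \<le> card A")
    case True
    then show ?thesis using less.prems by blast
  next
    case False
    then obtain x where x: "\<exists>b\<in>V. x b \<noteq> 0" "\<forall>a\<in>A. (\<Sum>b\<in>V. F a b * x b) = 0"
      using homogeneous_system_solvable[of A V F] assms(1) less.prems(1) by auto
    have "\<exists>x. (\<exists>b\<in>V. x b > 0) \<and> (\<forall>a\<in>A. (\<Sum>b\<in>V. x b * F a b) = 0)"
    proof (cases "\<exists>b\<in>V. x b > 0")
      case True
      then show ?thesis using x(2) by (intro exI[of _ x]) (auto simp: mult.commute)
    next
      case False
      then have "\<exists>b\<in>V. - x b > 0" using x(1) by force
      moreover have "(\<Sum>b\<in>V. - x b * F a b) = 0" if "a \<in> A" for a
        using x(2) that by (simp add: sum_negf mult.commute)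
      ultimately show ?thesis by (intro exI[of _ "\<lambda>b. - x b"]) auto
    qed
    then obtain x where x: "\<exists>b\<in>V. x b > 0" "\<And>a. a \<in> A \<Longrightarrow> (\<Sum>b\<in>V. x b * F a b) = 0" by blast
    define R where "R = (\<lambda>v. w v / x v) ` {v\<in>V. x v > 0}"
    have R: "finite R" "R \<noteq> {}" using x(1) less.prems(1) by (auto simp: R_def)
    define s where "s = Min R"
    have "s \<in> R" unfolding s_def using R by (rule Min_in)
    then obtain v0 where v0: "v0 \<in> V" "x v0 > 0" "s = w v0 / x v0" by (auto simp: R_def)
    have s: "s > 0" using v0 less.prems(2) by simp
    define w' where "w' v = w v - s * x v" for v
    have nonneg: "w' v \<ge> 0" if "v \<in> V" for v
    proof (cases "x v > 0")
      case True
      then have "s \<le> w v / x v" unfolding s_def using R(1) that by (intro Min_le) (auto simp: R_def)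
      then show ?thesis using True by (simp add: w'_def field_simps)
    next
      case False
      then have "s * x v \<le> 0" using s by (simp add: mult_le_0_iff)
      then show ?thesis using less.prems(2)[OF that] by (simp add: w'_def)
    qed
    define V1 where "V1 = {v\<in>V. w' v > 0}"
    have "v0 \<notin> V1" using v0 by (simp add: V1_def w'_def)
    then have "card V1 < card V" using v0(1) less.prems(1) by (intro psubset_card_mono) (auto simp: V1_def)
    moreover have "finite V1" using less.prems(1) by (simp add: V1_def)
    ultimately obtain V' w'' where V': "V' \<subseteq> V1" "card V' \<le> card A" "\<forall>v\<in>V'. w'' v > 0"
       "\<forall>i\<in>A. (\<Sum>v\<in>V'. w'' v * F i v) = (\<Sum>v\<in>V1. w' v * F i v)"
    proof -
      assume "card V1 < card V" "finite V1"
      moreover have "\<And>v. v \<in> V1 \<Longrightarrow> w' v > 0" by (simp add: V1_def)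
      ultimately show ?thesis using less.hyps[of V1 w'] that by blast
    qed
    have "(\<Sum>v\<in>V1. w' v * F i v) = (\<Sum>v\<in>V. w v * F i v)" if "i \<in> A" for i
    proof -
      have "(\<Sum>v\<in>V1. w' v * F i v) = (\<Sum>v\<in>V. w' v * F i v)"
      proof (rule sum.mono_neutral_left)
        show "\<forall>v\<in>V - V1. w' v * F i v = 0" using nonneg by (force simp: V1_def)
      qed (use less.prems(1) in \<open>auto simp: V1_def\<close>)
      also have "\<dots> = (\<Sum>v\<in>V. w v * F i v) - s * (\<Sum>v\<in>V. x v * F i v)"
        by (simp add: w'_def left_diff_distrib sum_subtractf sum_distrib_left mult.assoc)
      finally show ?thesis using x(2)[OF that] by simp
    qed
    then have "\<forall>i\<in>A. (\<Sum>v\<in>V'. w'' v * F i v) = (\<Sum>v\<in>V. w v * F i v)" using V'(4) by simp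
    moreover have "V' \<subseteq> V" using V'(1) unfolding V1_def by blast
    ultimately show ?thesis using V'(2,3) by (intro exI[of _ V'] exI[of _ w''] conjI)
  qed
qed

lemma common_convergent_subsequence:
  fixes X :: "nat \<Rightarrow> nat \<Rightarrow> real"
  assumes "\<And>i. i < d \<Longrightarrow> bounded (range (\<lambda>n. X n i))"
  shows "\<exists>r l. strict_mono (r :: nat \<Rightarrow> nat) \<and> (\<forall>i<d. (\<lambda>n. X (r n) i) \<longlonglongrightarrow> l i)"
  using assms
proof (induction d)
  case 0
  show ?case by (intro exI[of _ id]) (auto simp: strict_mono_def)
next
  case (Suc d)
  then obtain r l where r: "strict_mono r" "\<forall>i<d. (\<lambda>n. X (r n) i) \<longlonglongrightarrow> l i" by auto
  have "bounded (range (\<lambda>n. X (r n) d))"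
    by (rule bounded_subset[OF Suc.prems[of d]]) auto
  then obtain l' r' where r': "strict_mono r'" "((\<lambda>n. X (r n) d) \<circ> r') \<longlonglongrightarrow> l'"
    using bounded_imp_convergent_subsequence by blast
  have "strict_mono (r \<circ> r')" using r(1) r'(1) by (rule strict_mono_o)
  moreover have "(\<lambda>n. X ((r \<circ> r') n) i) \<longlonglongrightarrow> (if i = d then l' else l i)" if i: "i < Suc d" for i
  proof (cases "i = d")
    case True
    then show ?thesis using r'(2) by (simp add: o_def)
  next
    case False
    then have "(\<lambda>n. X (r n) i) \<longlonglongrightarrow> l i" using r(2) i by auto
    from LIMSEQ_subseq_LIMSEQ[OF this r'(1)] show ?thesis using False by (simp add: o_def)
  qed
  ultimately show ?case by (intro exI[of _ "r \<circ> r'"] exI[of _ "\<lambda>i. if i = d then l' else l i"]) blast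
qed

lemma discretized_integral:
  fixes \<nu> :: "real measure" and f \<phi> :: "real \<Rightarrow> real"
  assumes "finite_measure \<nu>" "sets \<nu> = sets borel" "\<phi> \<in> borel_measurable borel" "finite (\<phi> ` S)" "S \<in> sets borel"
  shows "(\<integral>x. indicator S x * f (\<phi> x) \<partial>\<nu>) = (\<Sum>v\<in>\<phi> ` S. measure \<nu> {x\<in>S. \<phi> x = v} * f v)"
proof -
  interpret finite_measure \<nu> by fact
  have m: "{x\<in>S. \<phi> x = v} \<in> sets \<nu>" for v
  proof -
    have "{x\<in>S. \<phi> x = v} = S \<inter> (\<phi> -` {v} \<inter> space borel)" by auto
    then show ?thesis using assms(2,3,5) measurable_sets[OF assms(3), of "{v}"] by auto
  qed
  have "(\<integral>x. indicator S x * f (\<phi> x) \<partial>\<nu>) = (\<integral>x. (\<Sum>v\<in>\<phi> ` S. f v * indicator {x\<in>S. \<phi> x = v} x) \<partial>\<nu>)"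
  proof (intro Bochner_Integration.integral_cong refl)
    fix x
    show "indicator S x * f (\<phi> x) = (\<Sum>v\<in>\<phi> ` S. f v * indicator {x\<in>S. \<phi> x = v} x)"
    proof (cases "x \<in> S")
      case True
      have "(\<Sum>v\<in>\<phi> ` S. f v * indicator {x\<in>S. \<phi> x = v} x) = (\<Sum>v\<in>\<phi> ` S. if v = \<phi> x then f v else 0)"
        using True by (intro sum.cong) auto
      then show ?thesis using True assms(4) by simp
    qed simp
  qed
  also have "\<dots> = (\<Sum>v\<in>\<phi> ` S. f v * measure \<nu> {x\<in>S. \<phi> x = v})"
    using m by (subst Bochner_Integration.integral_sum) (auto simp: emeasure_eq_measure)
  finally show ?thesis by (simp add: mult.commute)
qed

text \<open>
  Round the points to a grid, so that the measure becomes discrete; \<open>conic_caratheodory\<close> reduces it to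
  \<open>card A\<close> nodes. As the grid becomes finer, nodes and weights converge along a subsequence. The
  constant function \<open>F i0\<close> keeps the weights bounded.
\<close>

lemma exact_quadrature:
  fixes \<nu> :: "real measure" and F :: "'i \<Rightarrow> real \<Rightarrow> real"
  assumes fin: "finite_measure \<nu>" "sets \<nu> = sets borel" and null: "emeasure \<nu> (- {a..b}) = 0" and ab: "a \<le> b"
    and A: "finite A" "i0 \<in> A" "F i0 = (\<lambda>_. 1)"
    and F: "\<And>i. i \<in> A \<Longrightarrow> F i \<in> borel_measurable borel" "\<And>i. i \<in> A \<Longrightarrow> continuous_on {a..b} (F i)"
  shows "\<exists>Y \<mu>. finite Y \<and> Y \<subseteq> {a..b} \<and> (\<forall>y\<in>Y. \<mu> y > 0) \<and> (\<forall>i\<in>A. (\<integral>x. F i x \<partial>\<nu>) = (\<Sum>y\<in>Y. \<mu> y * F i y))"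
proof -
  interpret finite_measure \<nu> by fact
  \<comment> \<open>Rounding down to a multiple of \<open>1/(n + 1)\<close>, clipped to the interval.\<close>
  define \<phi> where "\<phi> n x = max a (min b (real_of_int \<lfloor>real (Suc n) * x\<rfloor> / real (Suc n)))" for n :: nat and x :: real
  have \<phi>_meas [measurable]: "\<phi> n \<in> borel_measurable borel" for n unfolding \<phi>_def by measurable
  have \<phi>_in: "\<phi> n x \<in> {a..b}" for n x using ab by (auto simp: \<phi>_def)
  have \<phi>_lim: "(\<lambda>n. \<phi> n x) \<longlonglongrightarrow> x" if "x \<in> {a..b}" for x
  proof -
    have "\<bar>\<phi> n x - x\<bar> \<le> 1 / real (Suc n)" for n
    proof -
      let ?q = "real_of_int \<lfloor>real (Suc n) * x\<rfloor> / real (Suc n)"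
      have "?q \<le> x" by (simp add: divide_le_eq mult.commute del: of_nat_Suc)
      moreover have "real (Suc n) * x < real_of_int \<lfloor>real (Suc n) * x\<rfloor> + 1" by linarith
      then have "x < (real_of_int \<lfloor>real (Suc n) * x\<rfloor> + 1) / real (Suc n)"
        by (simp add: less_divide_eq mult.commute del: of_nat_Suc)
      then have "x \<le> ?q + 1 / real (Suc n)" by (simp add: add_divide_distrib del: of_nat_Suc)
      ultimately show ?thesis using that by (auto simp: \<phi>_def)
    qed
    then have "(\<lambda>n. \<phi> n x - x) \<longlonglongrightarrow> 0"
      by (intro Lim_null_comparison[OF _ LIMSEQ_inverse_real_of_nat]) (auto simp: inverse_eq_divide)
    then show ?thesis by (simp add: LIM_zero_iff)
  qed
  have \<phi>_fin: "finite (\<phi> n ` {a..b})" for n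
  proof -
    have "\<phi> n ` {a..b} \<subseteq> (\<lambda>z. max a (min b (real_of_int z / real (Suc n)))) ` {\<lfloor>real (Suc n) * a\<rfloor>..\<lfloor>real (Suc n) * b\<rfloor>}"
      unfolding \<phi>_def by (auto intro!: imageI floor_mono mult_left_mono simp del: of_nat_Suc)
    then show ?thesis by (rule finite_subset) auto
  qed
  have AE_in: "AE x in \<nu>. x \<in> {a..b}"
    using null fin(2) by (intro AE_I[of _ _ "- {a..b}"]) auto
  define M where "M = measure \<nu> {a..b}"
  have int_F: "(\<integral>x. F i x \<partial>\<nu>) = (\<integral>x. indicator {a..b} x * F i x \<partial>\<nu>)" if "i \<in> A" for i
    using F(1)[OF that] fin(2) AE_in by (intro integral_cong_AE) (auto cong: measurable_cong_sets)
  have lim_int: "(\<lambda>n. \<integral>x. indicator {a..b} x * F i (\<phi> n x) \<partial>\<nu>) \<longlonglongrightarrow> (\<integral>x. F i x \<partial>\<nu>)" if i: "i \<in> A" for i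
  proof -
    have "bounded (F i ` {a..b})"
      using F(2)[OF i] by (intro compact_imp_bounded compact_continuous_image) auto
    then obtain B where B: "\<And>x. x \<in> {a..b} \<Longrightarrow> \<bar>F i x\<bar> \<le> B" unfolding bounded_iff real_norm_def by blast
    have B0: "B \<ge> 0" using B[of a] ab by auto
    show ?thesis unfolding int_F[OF i]
    proof (rule integral_dominated_convergence[where w = "\<lambda>_. B"])
      show "(\<lambda>x. indicator {a..b} x * F i x) \<in> borel_measurable \<nu>"
        using F(1)[OF i] fin(2) by (auto cong: measurable_cong_sets)
      have "(\<lambda>x. F i (\<phi> n x)) \<in> borel_measurable borel" for n
        using measurable_compose[OF \<phi>_meas F(1)[OF i]] .
      then show "(\<lambda>x. indicator {a..b} x * F i (\<phi> n x)) \<in> borel_measurable \<nu>" for n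
        using fin(2) by (auto cong: measurable_cong_sets)
      show "AE x in \<nu>. (\<lambda>n. indicator {a..b} x * F i (\<phi> n x)) \<longlonglongrightarrow> indicator {a..b} x * F i x"
      proof (rule AE_I2)
        fix x
        show "(\<lambda>n. indicator {a..b} x * F i (\<phi> n x)) \<longlonglongrightarrow> indicator {a..b} x * F i x"
        proof (cases "x \<in> {a..b}")
          case True
          have "(\<lambda>n. F i (\<phi> n x)) \<longlonglongrightarrow> F i x"
            using continuous_on_tendsto_compose[OF F(2)[OF i] \<phi>_lim[OF True] True] \<phi>_in by auto
          then show ?thesis using True by simp
        qed simp
      qed
      show "AE x in \<nu>. norm (indicator {a..b} x * F i (\<phi> n x)) \<le> B" for n
        using B[OF \<phi>_in] B0 by (intro AE_I2) (simp add: indicator_def)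
    qed simp
  qed
  define d where "d = card A"
  have ex: "\<exists>P C. (\<forall>k<d. P k \<in> {a..b} \<and> 0 \<le> C k) \<and>
     (\<forall>i\<in>A. (\<integral>x. indicator {a..b} x * F i (\<phi> n x) \<partial>\<nu>) = (\<Sum>k<d. C k * F i (P k)))" for n
  proof -
    define w where "w v = measure \<nu> {x\<in>{a..b}. \<phi> n x = v}" for v
    define V where "V = {v \<in> \<phi> n ` {a..b}. w v > 0}"
    have fV: "finite V" using \<phi>_fin by (simp add: V_def)
    obtain V' w' where V': "V' \<subseteq> V" "card V' \<le> d" "\<forall>v\<in>V'. w' v > 0"
       "\<forall>i\<in>A. (\<Sum>v\<in>V'. w' v * F i v) = (\<Sum>v\<in>V. w v * F i v)"
      using conic_caratheodory[OF A(1) fV, of w F] by (auto simp: V_def d_def)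
    have fV': "finite V'" using V'(1) fV finite_subset by blast
    then obtain e where e: "bij_betw e {..<card V'} V'"
      using ex_bij_betw_nat_finite[of V'] by (auto simp: atLeast0LessThan)
    define P where "P k = (if k < card V' then e k else a)" for k
    define C where "C k = (if k < card V' then w' (e k) else 0)" for k
    have "P k \<in> {a..b} \<and> 0 \<le> C k" for k
    proof (cases "k < card V'")
      case True
      then have "e k \<in> V'" using e by (auto simp: bij_betw_def)
      then show ?thesis using True V' \<phi>_in by (auto simp: P_def C_def V_def less_imp_le)
    qed (use ab in \<open>auto simp: P_def C_def\<close>)
    moreover have "(\<integral>x. indicator {a..b} x * F i (\<phi> n x) \<partial>\<nu>) = (\<Sum>k<d. C k * F i (P k))" if i: "i \<in> A" for i
    proof -
      have "(\<integral>x. indicator {a..b} x * F i (\<phi> n x) \<partial>\<nu>) = (\<Sum>v\<in>\<phi> n ` {a..b}. w v * F i v)"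
        unfolding w_def by (rule discretized_integral[OF fin \<phi>_meas \<phi>_fin]) auto
      also have "\<dots> = (\<Sum>v\<in>V. w v * F i v)"
      proof (rule sum.mono_neutral_right)
        show "\<forall>v\<in>\<phi> n ` {a..b} - V. w v * F i v = 0"
        proof
          fix v assume "v \<in> \<phi> n ` {a..b} - V"
          then have "\<not> w v > 0" by (auto simp: V_def)
          moreover have "w v \<ge> 0" by (simp add: w_def)
          ultimately show "w v * F i v = 0" by simp
        qed
      qed (use \<phi>_fin in \<open>auto simp: V_def\<close>)
      also have "\<dots> = (\<Sum>v\<in>V'. w' v * F i v)" using V'(4) i by simp
      also have "\<dots> = (\<Sum>k<card V'. w' (e k) * F i (e k))"
        using sum.reindex_bij_betw[OF e, of "\<lambda>v. w' v * F i v"] by simp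
      also have "\<dots> = (\<Sum>k<card V'. C k * F i (P k))" by (intro sum.cong) (auto simp: C_def P_def)
      also have "\<dots> = (\<Sum>k<d. C k * F i (P k))"
        using V'(2) by (intro sum.mono_neutral_left) (auto simp: C_def)
      finally show ?thesis .
    qed
    ultimately show ?thesis by blast
  qed
  then obtain P C where PC: "\<And>n k. k < d \<Longrightarrow> P n k \<in> {a..b} \<and> 0 \<le> C n k"
     "\<And>n i. i \<in> A \<Longrightarrow> (\<integral>x. indicator {a..b} x * F i (\<phi> n x) \<partial>\<nu>) = (\<Sum>k<d. C n k * F i (P n k))"
    by metis
  have mass: "(\<Sum>k<d. C n k) = M" for n
  proof -
    have "(\<Sum>k<d. C n k * F i0 (P n k)) = (\<integral>x. indicator {a..b} x * F i0 (\<phi> n x) \<partial>\<nu>)" using PC(2)[OF A(2)] by simp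
    also have "\<dots> = M" using fin(2) by (simp add: A(3) M_def)
    finally show ?thesis by (simp add: A(3))
  qed
  have bP: "bounded (range (\<lambda>n. P n k))" if "k < d" for k
    by (rule bounded_subset[of "{a..b}"]) (use PC(1)[OF that] in auto)
  have bC: "bounded (range (\<lambda>n. C n k))" if "k < d" for k
  proof (rule bounded_subset[of "{0..M}"])
    have "C n k \<le> M" for n
      unfolding mass[of n, symmetric] using PC(1) that by (intro member_le_sum) auto
    then show "range (\<lambda>n. C n k) \<subseteq> {0..M}" using PC(1)[OF that] by auto
  qed simp
  obtain r P' where r: "strict_mono r" "\<forall>k<d. (\<lambda>n. P (r n) k) \<longlonglongrightarrow> P' k"
    using common_convergent_subsequence[of d P] bP by blast
  have "bounded (range (\<lambda>n. C (r n) k))" if "k < d" for k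
    using bC[OF that] by (rule bounded_subset) auto
  then obtain r' C' where r': "strict_mono r'" "\<forall>k<d. (\<lambda>n. C (r (r' n)) k) \<longlonglongrightarrow> C' k"
    using common_convergent_subsequence[of d "\<lambda>n. C (r n)"] by blast
  define \<rho> where "\<rho> = r \<circ> r'"
  have \<rho>: "strict_mono \<rho>" unfolding \<rho>_def using r(1) r'(1) by (rule strict_mono_o)
  have limP: "(\<lambda>n. P (\<rho> n) k) \<longlonglongrightarrow> P' k" if "k < d" for k
    using LIMSEQ_subseq_LIMSEQ[of "\<lambda>n. P (r n) k" "P' k" r'] r(2) r'(1) that by (simp add: \<rho>_def o_def)
  have limC: "(\<lambda>n. C (\<rho> n) k) \<longlonglongrightarrow> C' k" if "k < d" for k
    using r'(2) that by (simp add: \<rho>_def)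
  have P': "P' k \<in> {a..b}" if "k < d" for k
    using closed_sequentially[OF closed_atLeastAtMost _ limP[OF that]] PC(1)[OF that] by blast
  have C': "C' k \<ge> 0" if "k < d" for k
    using LIMSEQ_le_const[OF limC[OF that]] PC(1)[OF that] by blast
  have quad: "(\<integral>x. F i x \<partial>\<nu>) = (\<Sum>k<d. C' k * F i (P' k))" if i: "i \<in> A" for i
  proof -
    have "(\<lambda>n. \<Sum>k<d. C (\<rho> n) k * F i (P (\<rho> n) k)) \<longlonglongrightarrow> (\<Sum>k<d. C' k * F i (P' k))"
    proof (intro tendsto_sum tendsto_mult)
      fix k assume "k \<in> {..<d}"
      then have k: "k < d" by simp
      show "(\<lambda>n. C (\<rho> n) k) \<longlonglongrightarrow> C' k" using limC[OF k] .
      show "(\<lambda>n. F i (P (\<rho> n) k)) \<longlonglongrightarrow> F i (P' k)"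
        by (rule continuous_on_tendsto_compose[OF F(2)[OF i] limP[OF k] P'[OF k]]) (use PC(1)[OF k] in auto)
    qed
    moreover have "(\<lambda>n. \<Sum>k<d. C (\<rho> n) k * F i (P (\<rho> n) k)) \<longlonglongrightarrow> (\<integral>x. F i x \<partial>\<nu>)"
      using LIMSEQ_subseq_LIMSEQ[OF lim_int[OF i] \<rho>] by (simp add: o_def PC(2)[OF i])
    ultimately show ?thesis using LIMSEQ_unique by blast
  qed
  define Q where "Q = {k\<in>{..<d}. C' k > 0}"
  define Y where "Y = P' ` Q"
  define \<mu> where "\<mu> y = (\<Sum>k\<in>{k\<in>Q. P' k = y}. C' k)" for y
  have fQ: "finite Q" by (simp add: Q_def)
  have "\<mu> y > 0" if "y \<in> Y" for y
    unfolding \<mu>_def using that fQ by (intro sum_pos) (auto simp: Y_def Q_def)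
  moreover have "(\<integral>x. F i x \<partial>\<nu>) = (\<Sum>y\<in>Y. \<mu> y * F i y)" if i: "i \<in> A" for i
  proof -
    have "(\<integral>x. F i x \<partial>\<nu>) = (\<Sum>k\<in>Q. C' k * F i (P' k))"
      unfolding quad[OF i] Q_def using C' by (intro sum.mono_neutral_right) (auto simp: le_less)
    also have "\<dots> = (\<Sum>y\<in>Y. \<Sum>k\<in>{k\<in>Q. P' k = y}. C' k * F i (P' k))"
      unfolding Y_def using fQ by (rule sum.image_gen)
    also have "\<dots> = (\<Sum>y\<in>Y. \<mu> y * F i y)"
      unfolding \<mu>_def sum_distrib_right by (intro sum.cong) auto
    finally show ?thesis .
  qed
  moreover have "finite Y" "Y \<subseteq> {a..b}" using fQ P' by (auto simp: Y_def Q_def)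
  ultimately show ?thesis by blast
qed

locale interval_measure =
  fixes \<nu> :: "real measure" and a b :: real
  assumes finite_measure: "finite_measure \<nu>" and sets_\<nu>: "sets \<nu> = sets borel"
    and null_outside: "emeasure \<nu> (- {a..b}) = 0"
    and not_finitely_supported: "finite S \<Longrightarrow> emeasure \<nu> (- S) \<noteq> 0"
begin

lemma AE_interval: "AE x in \<nu>. x \<in> {a..b}"
  using null_outside sets_\<nu> by (intro AE_I[of _ _ "- {a..b}"]) auto

lemma measurable_\<nu>:
  fixes f :: "real \<Rightarrow> 'b::topological_space"
  shows "f \<in> borel_measurable borel \<Longrightarrow> f \<in> borel_measurable \<nu>"
  using sets_\<nu> by (simp cong: measurable_cong_sets)

lemma integrable_continuous:
  fixes f :: "real \<Rightarrow> 'b::{banach, second_countable_topology}"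
  assumes "f \<in> borel_measurable borel" "continuous_on {a..b} f"
  shows "integrable \<nu> f"
proof -
  interpret finite_measure \<nu> by (rule finite_measure)
  have "bounded (f ` {a..b})"
    using assms(2) by (intro compact_imp_bounded compact_continuous_image) auto
  then obtain C where C: "\<And>x. x \<in> {a..b} \<Longrightarrow> norm (f x) \<le> C" unfolding bounded_iff by blast
  show ?thesis
  proof (rule integrable_const_bound[of f C])
    show "AE x in \<nu>. norm (f x) \<le> C" using AE_interval by eventually_elim (use C in auto)
  qed (rule measurable_\<nu>[OF assms(1)])
qed

lemma interval_nondegenerate: "a < b"
proof (rule ccontr)
  assume "\<not> a < b"
  then have "- {a} \<subseteq> - {a..b}" by auto
  then have "emeasure \<nu> (- {a}) \<le> emeasure \<nu> (- {a..b})"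
    using sets_\<nu> by (intro emeasure_mono) auto
  then show False using not_finitely_supported[of "{a}"] null_outside by simp
qed

lemma integral_nonzero_of_finite_zeros:
  fixes f :: "real \<Rightarrow> real"
  assumes f: "f \<in> borel_measurable borel" "continuous_on {a..b} f"
    and Z: "finite Z" and pos: "\<And>x. x \<in> {a<..<b} - Z \<Longrightarrow> f x > 0" "\<And>x. x \<in> {a<..<b} \<inter> Z \<Longrightarrow> f x \<ge> 0"
  shows "(\<integral>x. f x \<partial>\<nu>) \<noteq> 0"
proof
  assume zero: "(\<integral>x. f x \<partial>\<nu>) = 0"
  have ge: "f x \<ge> 0" if "x \<in> {a..b}" for x
  proof (rule continuous_ge_on_closure[of "{a<..<b}" f x 0])
    show "continuous_on (closure {a<..<b}) f" "x \<in> closure {a<..<b}"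
      using f(2) that interval_nondegenerate by (simp_all add: closure_greaterThanLessThan)
    show "f x \<ge> 0" if "x \<in> {a<..<b}" for x using pos[of x] that by (cases "x \<in> Z") auto
  qed
  have "AE x in \<nu>. f x \<ge> 0" using AE_interval by eventually_elim (use ge in auto)
  then have "AE x in \<nu>. f x = 0"
    using integral_nonneg_eq_0_iff_AE[OF integrable_continuous[OF f]] zero by blast
  then have "AE x in \<nu>. x \<in> Z \<union> {a, b}" using AE_interval
  proof eventually_elim
    case (elim x)
    then show ?case using pos(1)[of x] by (cases "x = a"; cases "x = b") auto
  qed
  moreover have "- (Z \<union> {a, b}) \<in> sets \<nu>" using Z sets_\<nu> by (simp add: finite_imp_closed borel_open open_Compl)
  ultimately have "emeasure \<nu> (- (Z \<union> {a, b})) = 0"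
    using AE_iff_measurable[of "- (Z \<union> {a, b})" \<nu> "\<lambda>x. x \<in> Z \<union> {a, b}"] sets_eq_imp_space_eq[OF sets_\<nu>] by auto
  then show False using not_finitely_supported[of "Z \<union> {a, b}"] Z by blast
qed

end

text \<open>
  The monomials up to \<open>2 K\<close> are added to the family. With fewer than \<open>K\<close> nodes, the square of the nodal
  polynomial would have integral zero, and the measure would be concentrated on the nodes.
\<close>

lemma (in interval_measure) exact_quadrature_many_nodes:
  fixes F :: "'i \<Rightarrow> real \<Rightarrow> real"
  assumes A: "finite A"
    and F: "\<And>i. i \<in> A \<Longrightarrow> F i \<in> borel_measurable borel" "\<And>i. i \<in> A \<Longrightarrow> continuous_on {a..b} (F i)"
  shows "\<exists>Y \<mu>. finite Y \<and> Y \<subseteq> {a..b} \<and> K \<le> card Y \<and> (\<forall>y\<in>Y. \<mu> y > 0) \<and> (\<forall>i\<in>A. (\<integral>x. F i x \<partial>\<nu>) = (\<Sum>y\<in>Y. \<mu> y * F i y))"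
proof -
  define G :: "'i + nat \<Rightarrow> real \<Rightarrow> real" where "G = case_sum F (\<lambda>k x. x ^ k)"
  define B where "B = Inl ` A \<union> Inr ` {..2 * K}"
  have "\<exists>Y \<mu>. finite Y \<and> Y \<subseteq> {a..b} \<and> (\<forall>y\<in>Y. \<mu> y > 0) \<and> (\<forall>i\<in>B. (\<integral>x. G i x \<partial>\<nu>) = (\<Sum>y\<in>Y. \<mu> y * G i y))"
  proof (rule exact_quadrature[OF finite_measure sets_\<nu> null_outside, of B "Inr 0"])
    show "G i \<in> borel_measurable borel" if "i \<in> B" for i
      using that F(1) by (cases i) (auto simp: B_def G_def)
    show "continuous_on {a..b} (G i)" if "i \<in> B" for i
      using that F(2) by (cases i) (auto simp: B_def G_def intro!: continuous_intros)
  qed (use A interval_nondegenerate in \<open>auto simp: B_def G_def\<close>)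
  then obtain Y \<mu> where Y: "finite Y" "Y \<subseteq> {a..b}" "\<forall>y\<in>Y. \<mu> y > 0"
     and quad: "\<And>i. i \<in> B \<Longrightarrow> (\<integral>x. G i x \<partial>\<nu>) = (\<Sum>y\<in>Y. \<mu> y * G i y)" by blast
  have pow: "(\<integral>x. x ^ k \<partial>\<nu>) = (\<Sum>y\<in>Y. \<mu> y * y ^ k)" if "k \<le> 2 * K" for k
    using quad[of "Inr k"] that by (simp add: B_def G_def)
  have "K \<le> card Y"
  proof (rule ccontr)
    assume "\<not> K \<le> card Y"
    define q where "q = (\<Prod>y\<in>Y. [:-y, 1:])"
    have "degree q = card Y" unfolding q_def by (subst degree_prod_eq_sum_degree) auto
    then have dq: "degree (q * q) \<le> 2 * K" using degree_mult_le[of q q] \<open>\<not> K \<le> card Y\<close> by simp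
    have q0: "poly q y = 0 \<longleftrightarrow> y \<in> Y" for y using Y(1) by (auto simp: q_def poly_prod)
    have "(\<integral>x. poly (q * q) x \<partial>\<nu>) = (\<Sum>k\<le>degree (q * q). coeff (q * q) k * (\<integral>x. x ^ k \<partial>\<nu>))"
      unfolding poly_altdef
      by (subst Bochner_Integration.integral_sum) (auto intro!: integrable_continuous continuous_intros)
    also have "\<dots> = (\<Sum>k\<le>degree (q * q). coeff (q * q) k * (\<Sum>y\<in>Y. \<mu> y * y ^ k))"
      using dq pow by (intro sum.cong) auto
    also have "\<dots> = (\<Sum>y\<in>Y. \<mu> y * poly (q * q) y)"
      unfolding poly_altdef sum_distrib_left by (subst sum.swap) (simp add: mult_ac)
    also have "\<dots> = 0" by (intro sum.neutral) (simp add: q0)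
    finally have "(\<integral>x. poly (q * q) x \<partial>\<nu>) = 0" .
    moreover have "(\<integral>x. poly (q * q) x \<partial>\<nu>) \<noteq> 0"
    proof (rule integral_nonzero_of_finite_zeros[OF _ _ Y(1)])
      have "continuous_on S (poly (q * q))" for S
        by (intro continuous_at_imp_continuous_on ballI poly_isCont)
      then show "poly (q * q) \<in> borel_measurable borel" "continuous_on {a..b} (poly (q * q))"
        by (auto intro: borel_measurable_continuous_onI)
      show "poly (q * q) x > 0" if "x \<in> {a<..<b} - Y" for x
        using that q0[of x] by (auto simp: zero_less_mult_iff linorder_neq_iff)
    qed simp
    ultimately show False by blast
  qed
  moreover have "(\<integral>x. F i x \<partial>\<nu>) = (\<Sum>y\<in>Y. \<mu> y * F i y)" if "i \<in> A" for i
    using quad[of "Inl i"] that by (simp add: B_def G_def)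
  ultimately show ?thesis using Y by (intro exI[of _ Y] exI[of _ \<mu>]) blast
qed

section \<open>Reduction of Nikishin systems to finite towers\<close>

text \<open>
  By the Lindelof property, countably many of the open null sets cover the complement of the support.
\<close>

lemma null_outside_supp:
  assumes "sets (fst s) = sets borel"
  shows "emeasure (total_variation s) (- supp s) = 0" "closed (supp s)"
proof -
  let ?\<nu> = "total_variation s"
  have sets: "sets ?\<nu> = sets borel" using assms by (simp add: total_variation_def)
  define \<U> where "\<U> = {U. open U \<and> emeasure ?\<nu> U = 0}"
  have eq: "- supp s = \<Union>\<U>" unfolding supp_def \<U>_def by auto
  have op: "\<And>U. U \<in> \<U> \<Longrightarrow> open U" by (simp add: \<U>_def)
  then show "closed (supp s)" unfolding closed_def eq by blast
  obtain \<F> where \<F>: "\<F> \<subseteq> \<U>" "countable \<F>" "\<Union>\<F> = \<Union>\<U>" using Lindelof[OF op] by blast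
  have "(\<Union>U\<in>\<F>. U) \<in> null_sets ?\<nu>"
  proof (rule null_sets_UN'[OF \<F>(2)])
    fix U assume "U \<in> \<F>"
    then have "open U" "emeasure ?\<nu> U = 0" using \<F>(1) by (auto simp: \<U>_def)
    then show "U \<in> null_sets ?\<nu>" using sets by (simp add: null_sets_def)
  qed
  then show "emeasure ?\<nu> (- supp s) = 0" using eq \<F>(3) by (auto simp: null_sets_def)
qed

lemma supp_subset_of_null_complement:
  assumes "sets (fst s) = sets borel" "closed S" "emeasure (total_variation s) (- S) = 0"
  shows "supp s \<subseteq> S"
  using assms(2,3) by (auto simp: supp_def open_Compl)

lemma measure_class_facts:
  assumes "s \<in> measure_class \<Delta>"
  obtains a b \<epsilon> where "\<Delta> = {a..b}" "a \<le> b" "\<epsilon> = 1 \<or> \<epsilon> = (-1::real)"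
    "sets (total_variation s) = sets borel" "finite_measure (total_variation s)"
    "emeasure (total_variation s) (- {a..b}) = 0"
    "\<And>S. finite S \<Longrightarrow> emeasure (total_variation s) (- S) \<noteq> 0"
    "\<And>f :: real \<Rightarrow> real. f \<in> borel_measurable borel \<Longrightarrow> sintegral s f = \<epsilon> * (\<integral>x. f x \<partial>total_variation s)"
    "\<And>f :: real \<Rightarrow> complex. f \<in> borel_measurable borel \<Longrightarrow> sintegral s f = \<epsilon> *\<^sub>R (\<integral>x. f x \<partial>total_variation s)"
proof -
  let ?\<nu> = "total_variation s" and ?M = "fst s" and ?g = "snd s"
  have s: "sets ?M = sets borel" "finite_measure ?M" "integrable ?M ?g" "constant_sign s"
      "compact (supp s)" "infinite (supp s)" "\<Delta> = convex hull (supp s)"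
    using assms by (auto simp: measure_class_def)
  have g [measurable]: "?g \<in> borel_measurable ?M" using s(3) by auto
  have sets: "sets ?\<nu> = sets borel" using s(1) by (simp add: total_variation_def)
  have "connected \<Delta>" "compact \<Delta>" using s by (simp_all add: compact_convex_hull convex_connected)
  then obtain a b where ab: "\<Delta> = {a..b}" using connected_compact_interval_1 by metis
  have sub: "supp s \<subseteq> {a..b}" using s(7) ab hull_subset[of "supp s" convex] by simp
  have "supp s \<noteq> {}" using s(6) by auto
  then have "a \<le> b" using sub by auto
  obtain \<epsilon> where \<epsilon>: "\<epsilon> = 1 \<or> \<epsilon> = (-1::real)" "AE x in ?M. ?g x = \<epsilon> * \<bar>?g x\<bar>"
  proof (cases "AE x in ?M. 0 \<le> ?g x")
    case True
    then have "AE x in ?M. ?g x = 1 * \<bar>?g x\<bar>" by eventually_elim simp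
    then show ?thesis using that by blast
  next
    case False
    then have "AE x in ?M. ?g x \<le> 0" using s(4) by (auto simp: constant_sign_def)
    then have "AE x in ?M. ?g x = -1 * \<bar>?g x\<bar>" by eventually_elim simp
    then show ?thesis using that by blast
  qed
  have "emeasure ?\<nu> (space ?\<nu>) < \<infinity>"
  proof -
    have "emeasure ?\<nu> (space ?\<nu>) = (\<integral>\<^sup>+x. ennreal \<bar>?g x\<bar> * indicator (space ?M) x \<partial>?M)"
      unfolding total_variation_def by (subst emeasure_density) auto
    also have "\<dots> = (\<integral>\<^sup>+x. ennreal (norm (?g x)) \<partial>?M)"
      by (intro nn_integral_cong) simp
    finally show ?thesis using s(3) by (simp add: integrable_iff_bounded)
  qed
  then have fin: "finite_measure ?\<nu>" by (intro finite_measureI) auto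
  have null: "emeasure ?\<nu> (- {a..b}) = 0"
  proof -
    have "emeasure ?\<nu> (- {a..b}) \<le> emeasure ?\<nu> (- supp s)"
      using sub null_outside_supp(2)[OF s(1)] sets by (intro emeasure_mono) auto
    then show ?thesis using null_outside_supp(1)[OF s(1)] by simp
  qed
  have inf: "emeasure ?\<nu> (- S) \<noteq> 0" if "finite S" for S
  proof
    assume "emeasure ?\<nu> (- S) = 0"
    then have "supp s \<subseteq> S"
      using that by (intro supp_subset_of_null_complement s(1) finite_imp_closed)
    then show False using s(6) that finite_subset by blast
  qed
  have sint: "sintegral s f = \<epsilon> *\<^sub>R (\<integral>x. f x \<partial>?\<nu>)" if f: "f \<in> borel_measurable borel"
    for f :: "real \<Rightarrow> 'b::{banach, second_countable_topology}"
  proof -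
    have f' [measurable]: "f \<in> borel_measurable ?M" using f s(1) by (simp cong: measurable_cong_sets)
    have "sintegral s f = (\<integral>x. \<epsilon> *\<^sub>R (\<bar>?g x\<bar> *\<^sub>R f x) \<partial>?M)"
      unfolding sintegral_def
    proof (rule integral_cong_AE)
      show "AE x in ?M. ?g x *\<^sub>R f x = \<epsilon> *\<^sub>R (\<bar>?g x\<bar> *\<^sub>R f x)"
        using \<epsilon>(2) by eventually_elim (metis scaleR_scaleR)
    qed auto
    also have "\<dots> = \<epsilon> *\<^sub>R (\<integral>x. \<bar>?g x\<bar> *\<^sub>R f x \<partial>?M)"
      by (simp only: integral_scaleR_right)
    also have "(\<integral>x. \<bar>?g x\<bar> *\<^sub>R f x \<partial>?M) = (\<integral>x. f x \<partial>?\<nu>)"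
      unfolding total_variation_def by (subst integral_density) auto
    finally show ?thesis .
  qed
  show ?thesis
  proof (rule that[OF ab \<open>a \<le> b\<close> \<epsilon>(1) sets fin null])
    show "emeasure ?\<nu> (- S) \<noteq> 0" if "finite S" for S using inf that .
    show "sintegral s f = \<epsilon> * (\<integral>x. f x \<partial>?\<nu>)" if "f \<in> borel_measurable borel" for f :: "real \<Rightarrow> real"
      using sint[OF that] by simp
    show "sintegral s f = \<epsilon> *\<^sub>R (\<integral>x. f x \<partial>?\<nu>)" if "f \<in> borel_measurable borel" for f :: "real \<Rightarrow> complex"
      using sint[OF that] .
  qed
qed

text \<open>
  Row \<open>q\<close>, from the diagonal entry on, of the unitriangular matrix belonging to the measures
  themselves; \<open>cauchy_tower\<close> is its discrete analogue.
\<close>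

definition level_vector :: "(nat \<Rightarrow> smeasure) \<Rightarrow> nat \<Rightarrow> nat \<Rightarrow> real \<Rightarrow> real" where
  "level_vector \<sigma> q k x = (if k = q then 1 else cauchy_transform (nikishin_measure \<sigma> (Suc q) k) x)"

lemma nikishin_vector_level: "nikishin_vector \<sigma> k = level_vector \<sigma> 0 k"
  by (simp add: nikishin_vector_def level_vector_def fun_eq_iff)

lemma level_vector_step:
  assumes "q < k"
  shows "level_vector \<sigma> q k x = sintegral (\<sigma> (Suc q)) (\<lambda>y. level_vector \<sigma> (Suc q) k y * (1 / (x - y)))"
proof (cases "k = Suc q")
  case True
  then show ?thesis by (simp add: level_vector_def nikishin_measure_def cauchy_transform_def)
next
  case False
  then have k: "Suc q < k" using assms by simp
  have "map \<sigma> [Suc q..<Suc k] = \<sigma> (Suc q) # map \<sigma> [Suc (Suc q)..<Suc k]"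
    using k by (simp add: upt_conv_Cons)
  moreover obtain t ts where ts: "map \<sigma> [Suc (Suc q)..<Suc k] = t # ts"
    using k by (cases "map \<sigma> [Suc (Suc q)..<Suc k]") auto
  ultimately have "nikishin_measure \<sigma> (Suc q) k = bracket (\<sigma> (Suc q)) (nikishin_measure \<sigma> (Suc (Suc q)) k)"
    unfolding nikishin_measure_def by simp
  then show ?thesis using k
    by (simp add: level_vector_def cauchy_transform_def sintegral_def bracket_def mult_ac)
qed

lemma measure_class_measurable:
  assumes "s \<in> measure_class \<Delta>"
  shows "sets (fst s) = sets borel" "snd s \<in> borel_measurable borel" "sigma_finite_measure (fst s)"
proof -
  show s: "sets (fst s) = sets borel" using assms by (simp add: measure_class_def)
  have "snd s \<in> borel_measurable (fst s)" using assms by (auto simp: measure_class_def)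
  then show "snd s \<in> borel_measurable borel" using s by (simp cong: measurable_cong_sets)
  show "sigma_finite_measure (fst s)"
    using assms by (auto simp: measure_class_def dest: finite_measure.axioms(1))
qed

lemma borel_measurable_cauchy_sintegral:
  fixes f :: "real \<Rightarrow> real"
  assumes "s \<in> measure_class \<Delta>" and [measurable]: "f \<in> borel_measurable borel"
  shows "(\<lambda>x. sintegral s (\<lambda>y. f y * (1 / (x - y)))) \<in> borel_measurable borel"
proof -
  interpret sigma_finite_measure "fst s" by (rule measure_class_measurable[OF assms(1)])
  have [measurable_cong]: "sets (fst s) = sets borel" and [measurable]: "snd s \<in> borel_measurable borel"
    using measure_class_measurable[OF assms(1)] by auto
  show ?thesis unfolding sintegral_def by measurable
qed

lemma continuous_on_cauchy_integral:
  fixes f :: "real \<Rightarrow> real"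
  assumes fin: "finite_measure \<nu>" "sets \<nu> = sets borel" and null: "emeasure \<nu> (- {a..b}) = 0"
    and f: "f \<in> borel_measurable borel" and B: "\<And>y. y \<in> {a..b} \<Longrightarrow> \<bar>f y\<bar> \<le> B"
  shows "continuous_on (- {a..b}) (\<lambda>x. \<integral>y. f y * (1 / (x - y)) \<partial>\<nu>)"
proof (rule continuous_on_sequentiallyI)
  interpret finite_measure \<nu> by fact
  fix u x0 assume u: "\<forall>n. u n \<in> - {a..b}" "x0 \<in> - {a..b}" "u \<longlonglongrightarrow> x0"
  define \<delta> where "\<delta> = max (a - x0) (x0 - b)"
  have \<delta>: "\<delta> > 0" using u(2) by (auto simp: \<delta>_def)
  have far: "\<bar>x0 - y\<bar> \<ge> \<delta>" if "y \<in> {a..b}" for y using that u(2) by (auto simp: \<delta>_def)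
  have AE_in: "AE x in \<nu>. x \<in> {a..b}" using null fin(2) by (intro AE_I[of _ _ "- {a..b}"]) auto
  obtain N where N: "\<And>n. n \<ge> N \<Longrightarrow> \<bar>u n - x0\<bar> < \<delta> / 2"
    using LIMSEQ_D[OF u(3), of "\<delta> / 2"] \<delta> by auto
  have meas: "(\<lambda>y. f y * (1 / (x - y))) \<in> borel_measurable \<nu>" for x
    using f fin(2) by (simp cong: measurable_cong_sets)
  have "(\<lambda>n. \<integral>y. f y * (1 / (u (n + N) - y)) \<partial>\<nu>) \<longlonglongrightarrow> (\<integral>y. f y * (1 / (x0 - y)) \<partial>\<nu>)"
  proof (rule integral_dominated_convergence[where w = "\<lambda>_. B * (2 / \<delta>)"])
    show "AE y in \<nu>. (\<lambda>n. f y * (1 / (u (n + N) - y))) \<longlonglongrightarrow> f y * (1 / (x0 - y))"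
      using AE_in
    proof eventually_elim
      case (elim y)
      then have "x0 - y \<noteq> 0" using u(2) by auto
      then show ?case using LIMSEQ_ignore_initial_segment[OF u(3)] by (intro tendsto_intros) auto
    qed
    show "AE y in \<nu>. norm (f y * (1 / (u (n + N) - y))) \<le> B * (2 / \<delta>)" for n
      using AE_in
    proof eventually_elim
      case (elim y)
      have "\<bar>u (n + N) - y\<bar> \<ge> \<delta> / 2"
        using far[OF elim] N[of "n + N"] abs_triangle_ineq4[of "u (n + N) - y" "u (n + N) - x0"] by simp
      then have "1 / \<bar>u (n + N) - y\<bar> \<le> 2 / \<delta>"
        using le_imp_inverse_le[of "\<delta> / 2" "\<bar>u (n + N) - y\<bar>"] \<delta> by (simp add: inverse_eq_divide)
      then have "\<bar>f y\<bar> * (1 / \<bar>u (n + N) - y\<bar>) \<le> B * (2 / \<delta>)"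
        using B[OF elim] order_trans[OF abs_ge_zero B[OF elim]] by (intro mult_mono) auto
      then show ?case by (simp add: abs_mult)
    qed
  qed (use meas in auto)
  then show "(\<lambda>n. \<integral>y. f y * (1 / (u n - y)) \<partial>\<nu>) \<longlonglongrightarrow> (\<integral>y. f y * (1 / (x0 - y)) \<partial>\<nu>)"
    by (rule LIMSEQ_offset)
qed

text \<open>
  Level 0 is left out because the Chebyshev property concerns points off the interval of level 1; the
  empty set beyond \<open>m\<close> matches \<open>atomic_nikishin\<close>.
\<close>

definition support_interval :: "nat \<Rightarrow> (nat \<Rightarrow> real set) \<Rightarrow> nat \<Rightarrow> real set" where
  "support_interval m \<Delta> j = (if 1 \<le> j \<and> j \<le> m then \<Delta> j else {})"

lemma support_interval_disjoint:
  assumes "nikishin_generators m \<Delta> \<sigma>"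
  shows "support_interval m \<Delta> j \<inter> support_interval m \<Delta> (Suc j) = {}"
  using assms by (auto simp: nikishin_generators_def support_interval_def Suc_le_eq)

lemma level_vector_regular:
  assumes gen: "nikishin_generators m \<Delta> \<sigma>" and k: "q \<le> k" "k \<le> m"
  shows "level_vector \<sigma> q k \<in> borel_measurable borel"
    and "continuous_on (- support_interval m \<Delta> (Suc q)) (level_vector \<sigma> q k)"
proof -
  have "level_vector \<sigma> q k \<in> borel_measurable borel \<and> continuous_on (- support_interval m \<Delta> (Suc q)) (level_vector \<sigma> q k)"
    using k(1)
  proof (induction q rule: inc_induct)
    case base
    have "level_vector \<sigma> k k = (\<lambda>_. 1)" by (simp add: level_vector_def fun_eq_iff)
    then show ?case by simp
  next
    case (step q)
    have qm: "Suc q \<le> m" using step.hyps k by simp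
    then have s: "\<sigma> (Suc q) \<in> measure_class (\<Delta> (Suc q))" using gen by (simp add: nikishin_generators_def)
    obtain a b \<epsilon> where ab: "\<Delta> (Suc q) = {a..b}" and \<nu>: "sets (total_variation (\<sigma> (Suc q))) = sets borel"
      "finite_measure (total_variation (\<sigma> (Suc q)))" "emeasure (total_variation (\<sigma> (Suc q))) (- {a..b}) = 0"
      and sint: "\<And>f :: real \<Rightarrow> real. f \<in> borel_measurable borel \<Longrightarrow>
        sintegral (\<sigma> (Suc q)) f = \<epsilon> * (\<integral>x. f x \<partial>total_variation (\<sigma> (Suc q)))"
      using measure_class_facts[OF s] by metis
    have S: "support_interval m \<Delta> (Suc q) = {a..b}" using qm ab by (simp add: support_interval_def)
    have f: "level_vector \<sigma> (Suc q) k \<in> borel_measurable borel"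
       "continuous_on (- support_interval m \<Delta> (Suc (Suc q))) (level_vector \<sigma> (Suc q) k)" using step.IH by auto
    have cont: "continuous_on {a..b} (level_vector \<sigma> (Suc q) k)"
      using f(2) by (rule continuous_on_subset) (use support_interval_disjoint[OF gen, of "Suc q"] S in auto)
    have "bounded (level_vector \<sigma> (Suc q) k ` {a..b})"
      using cont by (intro compact_imp_bounded compact_continuous_image) auto
    then obtain B where B: "\<And>y. y \<in> {a..b} \<Longrightarrow> \<bar>level_vector \<sigma> (Suc q) k y\<bar> \<le> B"
      unfolding bounded_iff real_norm_def by blast
    have eq1: "level_vector \<sigma> q k = (\<lambda>x. sintegral (\<sigma> (Suc q)) (\<lambda>y. level_vector \<sigma> (Suc q) k y * (1 / (x - y))))"
      using level_vector_step[of q k] step.hyps by (simp add: fun_eq_iff)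
    have eq2: "level_vector \<sigma> q k = (\<lambda>x. \<epsilon> * (\<integral>y. level_vector \<sigma> (Suc q) k y * (1 / (x - y)) \<partial>total_variation (\<sigma> (Suc q))))"
      unfolding eq1 using f(1) by (intro ext sint) auto
    have "level_vector \<sigma> q k \<in> borel_measurable borel"
      unfolding eq1 using s f(1) by (rule borel_measurable_cauchy_sintegral)
    moreover have "continuous_on (- {a..b}) (level_vector \<sigma> q k)"
      unfolding eq2 by (intro continuous_on_mult_left continuous_on_cauchy_integral[OF \<nu>(2,1,3) f(1) B])
    ultimately show ?case using S by simp
  qed
  then show "level_vector \<sigma> q k \<in> borel_measurable borel"
    and "continuous_on (- support_interval m \<Delta> (Suc q)) (level_vector \<sigma> q k)" by auto
qed

lemma cauchy_tower_cong:
  assumes "\<And>j. q < j \<Longrightarrow> Y j = Y' j \<and> \<mu> j = \<mu>' j"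
  shows "cauchy_tower Y \<mu> q k x = cauchy_tower Y' \<mu>' q k x"
proof (cases "k < q")
  case True
  then show ?thesis by (simp add: cauchy_tower_less)
next
  case False
  then have "q \<le> k" by simp
  then show ?thesis using assms
  proof (induction q arbitrary: x rule: inc_induct)
    case (step q)
    have "Y (Suc q) = Y' (Suc q)" "\<mu> (Suc q) = \<mu>' (Suc q)" using step.prems[of "Suc q"] by auto
    moreover have "cauchy_tower Y \<mu> (Suc q) k y = cauchy_tower Y' \<mu>' (Suc q) k y" for y
      using step.prems by (intro step.IH) auto
    ultimately show ?case using step.hyps by (simp add: cauchy_tower_step)
  qed simp
qed

text \<open>
  At the finitely many points of \<open>X\<close>, row \<open>q\<close> is given by finitely many integrals of row \<open>Suc q\<close>. Exact
  quadrature turns them into sums over nodes, and these nodes are the points at which row \<open>Suc q\<close>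
  must be reproduced next. Quadrature needs positive measures; the signs of the generators are
  collected in \<open>sg\<close>.
\<close>

lemma reduction_to_atomic:
  assumes gen: "nikishin_generators m \<Delta> \<sigma>" and "q \<le> m" "finite X" "X \<inter> support_interval m \<Delta> (Suc q) = {}"
  shows "\<exists>Y \<mu> sg. (\<forall>j. finite (Y j) \<and> Y j \<subseteq> support_interval m \<Delta> j) \<and> (\<forall>j. q < j \<and> j \<le> m \<longrightarrow> K \<le> card (Y j)) \<and>
     (\<forall>j. \<forall>y\<in>Y j. \<mu> j y > 0) \<and>
     (\<forall>k\<in>{q..m}. (sg k = 1 \<or> sg k = (-1::real)) \<and> (\<forall>x\<in>X. level_vector \<sigma> q k x = sg k * cauchy_tower Y \<mu> q k x))"
  using assms(2-4)
proof (induction q arbitrary: X rule: inc_induct)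
  case base
  show ?case
    by (intro exI[of _ "\<lambda>_. {}"] exI[of _ "\<lambda>_ _. 1"] exI[of _ "\<lambda>_. 1"]) (auto simp: level_vector_def)
next
  case (step q)
  have qm: "Suc q \<le> m" using step.hyps by simp
  then have s: "\<sigma> (Suc q) \<in> measure_class (\<Delta> (Suc q))" using gen by (simp add: nikishin_generators_def)
  let ?\<nu> = "total_variation (\<sigma> (Suc q))"
  obtain a b \<epsilon> where ab: "\<Delta> (Suc q) = {a..b}" "a \<le> b" and \<epsilon>: "\<epsilon> = 1 \<or> \<epsilon> = (-1::real)"
    and \<nu>: "sets ?\<nu> = sets borel" "finite_measure ?\<nu>" "emeasure ?\<nu> (- {a..b}) = 0"
    and inf: "\<And>S. finite S \<Longrightarrow> emeasure ?\<nu> (- S) \<noteq> 0"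
    and sint: "\<And>f :: real \<Rightarrow> real. f \<in> borel_measurable borel \<Longrightarrow> sintegral (\<sigma> (Suc q)) f = \<epsilon> * (\<integral>x. f x \<partial>?\<nu>)"
    using measure_class_facts[OF s] by metis
  have S: "support_interval m \<Delta> (Suc q) = {a..b}" using qm ab by (simp add: support_interval_def)
  define F where "F = (\<lambda>(x, k) y. level_vector \<sigma> (Suc q) k y * (1 / (x - y)))"
  have reg: "level_vector \<sigma> (Suc q) k \<in> borel_measurable borel" "continuous_on {a..b} (level_vector \<sigma> (Suc q) k)"
    if "k \<in> {Suc q..m}" for k
  proof -
    show "level_vector \<sigma> (Suc q) k \<in> borel_measurable borel" using level_vector_regular(1)[OF gen] that by auto
    have "continuous_on (- support_interval m \<Delta> (Suc (Suc q))) (level_vector \<sigma> (Suc q) k)"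
      using level_vector_regular(2)[OF gen] that by auto
    then show "continuous_on {a..b} (level_vector \<sigma> (Suc q) k)"
      by (rule continuous_on_subset) (use support_interval_disjoint[OF gen, of "Suc q"] S in auto)
  qed
  have "\<exists>Y \<mu>. finite Y \<and> Y \<subseteq> {a..b} \<and> K \<le> card Y \<and> (\<forall>y\<in>Y. \<mu> y > 0) \<and>
      (\<forall>i\<in>X \<times> {Suc q..m}. (\<integral>x. F i x \<partial>?\<nu>) = (\<Sum>y\<in>Y. \<mu> y * F i y))"
  proof (rule interval_measure.exact_quadrature_many_nodes)
    show "interval_measure ?\<nu> a b" using \<nu> inf by (intro interval_measure.intro)
    show "finite (X \<times> {Suc q..m})" using step.prems by auto
    fix i assume i: "i \<in> X \<times> {Suc q..m}"
    then obtain x k where xk: "i = (x, k)" "x \<in> X" "k \<in> {Suc q..m}" by auto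
    show "F i \<in> borel_measurable borel" using reg(1)[OF xk(3)] by (simp add: F_def xk(1))
    have "x \<notin> {a..b}" using xk(2) step.prems(2) S by auto
    then have "continuous_on {a..b} (\<lambda>y. level_vector \<sigma> (Suc q) k y * (1 / (x - y)))"
      using reg(2)[OF xk(3)] by (intro continuous_intros) auto
    then show "continuous_on {a..b} (F i)" by (simp add: F_def xk(1))
  qed
  then obtain Y0 \<mu>0 where Y0: "finite Y0" "Y0 \<subseteq> {a..b}" "K \<le> card Y0" "\<forall>y\<in>Y0. \<mu>0 y > 0"
     "\<forall>i\<in>X \<times> {Suc q..m}. (\<integral>x. F i x \<partial>?\<nu>) = (\<Sum>y\<in>Y0. \<mu>0 y * F i y)" by blast
  have "Y0 \<inter> support_interval m \<Delta> (Suc (Suc q)) = {}"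
    using Y0(2) S support_interval_disjoint[OF gen, of "Suc q"] by auto
  from step.IH[OF Y0(1) this] obtain Y \<mu> sg where YY: "(\<forall>j. finite (Y j) \<and> Y j \<subseteq> support_interval m \<Delta> j) \<and> (\<forall>j. Suc q < j \<and> j \<le> m \<longrightarrow> K \<le> card (Y j)) \<and>
     (\<forall>j. \<forall>y\<in>Y j. \<mu> j y > 0) \<and>
     (\<forall>k\<in>{Suc q..m}. (sg k = 1 \<or> sg k = (-1::real)) \<and> (\<forall>x\<in>Y0. level_vector \<sigma> (Suc q) k x = sg k * cauchy_tower Y \<mu> (Suc q) k x))"
    by (elim exE) (rule that)
  then have Y: "\<And>j. finite (Y j) \<and> Y j \<subseteq> support_interval m \<Delta> j"
     "\<And>j. Suc q < j \<Longrightarrow> j \<le> m \<Longrightarrow> K \<le> card (Y j)" "\<And>j y. y \<in> Y j \<Longrightarrow> \<mu> j y > 0"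
     "\<And>k. k \<in> {Suc q..m} \<Longrightarrow> sg k = 1 \<or> sg k = (-1::real)"
     "\<And>k y. k \<in> {Suc q..m} \<Longrightarrow> y \<in> Y0 \<Longrightarrow> level_vector \<sigma> (Suc q) k y = sg k * cauchy_tower Y \<mu> (Suc q) k y"
    by (blast+)
  define Y' where "Y' = Y(Suc q := Y0)"
  define \<mu>' where "\<mu>' = \<mu>(Suc q := \<mu>0)"
  define sg' where "sg' k = (if k = q then 1 else \<epsilon> * sg k)" for k
  have tower: "level_vector \<sigma> q k x = sg' k * cauchy_tower Y' \<mu>' q k x" if k: "k \<in> {q..m}" and x: "x \<in> X" for k x
  proof (cases "k = q")
    case True
    then show ?thesis by (simp add: level_vector_def sg'_def)
  next
    case False
    then have qk: "q < k" "k \<in> {Suc q..m}" using k by auto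
    have "level_vector \<sigma> q k x = \<epsilon> * (\<integral>y. F (x, k) y \<partial>?\<nu>)"
      unfolding level_vector_step[OF qk(1)] F_def prod.case using reg(1)[OF qk(2)] by (intro sint) auto
    also have "\<dots> = \<epsilon> * (\<Sum>y\<in>Y0. \<mu>0 y * F (x, k) y)" using Y0(5) x qk(2) by auto
    also have "(\<Sum>y\<in>Y0. \<mu>0 y * F (x, k) y) = (\<Sum>y\<in>Y0. sg k * (\<mu>0 y * cauchy_tower Y' \<mu>' (Suc q) k y / (x - y)))"
    proof (intro sum.cong refl)
      fix y assume y: "y \<in> Y0"
      have "cauchy_tower Y \<mu> (Suc q) k y = cauchy_tower Y' \<mu>' (Suc q) k y"
        by (rule cauchy_tower_cong) (auto simp: Y'_def \<mu>'_def)
      then show "\<mu>0 y * F (x, k) y = sg k * (\<mu>0 y * cauchy_tower Y' \<mu>' (Suc q) k y / (x - y))"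
        using Y(5)[OF qk(2) y] by (simp add: F_def)
    qed
    also have "\<dots> = sg k * cauchy_tower Y' \<mu>' q k x"
      unfolding cauchy_tower_step[OF qk(1)] by (simp add: sum_distrib_left Y'_def \<mu>'_def)
    finally show ?thesis using False by (simp add: sg'_def)
  qed
  show ?case
  proof (intro exI conjI allI ballI impI)
    show "finite (Y' j)" "Y' j \<subseteq> support_interval m \<Delta> j" for j using Y(1) Y0 S by (auto simp: Y'_def)
    show "K \<le> card (Y' j)" if "q < j \<and> j \<le> m" for j using Y(2)[of j] Y0(3) that by (auto simp: Y'_def)
    show "\<mu>' j y > 0" if "y \<in> Y' j" for j y using that Y(3) Y0(4) by (auto simp: Y'_def \<mu>'_def split: if_splits)
    show "sg' k = 1 \<or> sg' k = -1" if "k \<in> {q..m}" for k using Y(4)[of k] that \<epsilon> by (auto simp: sg'_def)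
    show "level_vector \<sigma> q k x = sg' k * cauchy_tower Y' \<mu>' q k x" if "k \<in> {q..m}" "x \<in> X" for k x
      using tower that .
  qed
qed

lemma nikishin_chebyshev:
  fixes p :: "nat \<Rightarrow> real poly" and d :: "nat \<Rightarrow> nat"
  assumes gen: "nikishin_generators m \<Delta> \<sigma>"
    and p: "\<And>k. k \<le> m \<Longrightarrow> deg_below (p k) (d k)"
    and X: "finite X" "X \<inter> support_interval m \<Delta> 1 = {}" "(\<Sum>k\<le>m. d k) \<le> card X"
    and zero: "\<And>x. x \<in> X \<Longrightarrow> (\<Sum>k\<le>m. poly (p k) x * nikishin_vector \<sigma> k x) = 0"
    and k: "k \<le> m"
  shows "p k = 0"
proof -
  \<comment> \<open>Enough nodes for \<open>|d|\<close> zeros on each level after up to \<open>m\<close> divisions,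
    which lose one node each.\<close>
  define K where "K = (\<Sum>k\<le>m. d k) + m + 1"
  have "\<exists>l h. support_interval m \<Delta> j = (if 1 \<le> j \<and> j \<le> m then {l..h} else {})" for j
  proof (cases "1 \<le> j \<and> j \<le> m")
    case True
    then have "\<sigma> j \<in> measure_class (\<Delta> j)" using gen by (simp add: nikishin_generators_def)
    then obtain l h where "\<Delta> j = {l..h}" by (rule measure_class_facts)
    then show ?thesis using True by (auto simp: support_interval_def)
  qed (auto simp: support_interval_def)
  then obtain lo hi where I: "\<And>j. support_interval m \<Delta> j = (if 1 \<le> j \<and> j \<le> m then {lo j..hi j} else {})" by metis
  have "X \<inter> support_interval m \<Delta> (Suc 0) = {}" using X(2) by simp
  from reduction_to_atomic[OF gen le0 X(1) this, of K]
  obtain Y \<mu> sg where YY: "(\<forall>j. finite (Y j) \<and> Y j \<subseteq> support_interval m \<Delta> j) \<and> (\<forall>j. 0 < j \<and> j \<le> m \<longrightarrow> K \<le> card (Y j)) \<and>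
     (\<forall>j. \<forall>y\<in>Y j. \<mu> j y > 0) \<and>
     (\<forall>k\<in>{0..m}. (sg k = 1 \<or> sg k = (-1::real)) \<and> (\<forall>x\<in>X. level_vector \<sigma> (0) k x = sg k * cauchy_tower Y \<mu> (0) k x))"
    by (elim exE) (rule that)
  then have Y: "\<And>j. finite (Y j) \<and> Y j \<subseteq> support_interval m \<Delta> j"
     "\<And>j. 0 < j \<Longrightarrow> j \<le> m \<Longrightarrow> K \<le> card (Y j)" "\<And>j y. y \<in> Y j \<Longrightarrow> \<mu> j y > 0"
     "\<And>k. k \<in> {0..m} \<Longrightarrow> sg k = 1 \<or> sg k = (-1::real)"
     "\<And>k x. k \<in> {0..m} \<Longrightarrow> x \<in> X \<Longrightarrow> level_vector \<sigma> 0 k x = sg k * cauchy_tower Y \<mu> 0 k x"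
    by (blast+)
  interpret atomic_nikishin m lo hi Y \<mu> K "\<lambda>q. if 1 \<le> q \<and> q \<le> m then {lo q..hi q} else {}"
  proof -
    show "atomic_nikishin m lo hi Y \<mu> K"
    proof
    show "(if 1 \<le> q \<and> q \<le> m then {lo q..hi q} else {}) \<inter> (if 1 \<le> Suc q \<and> Suc q \<le> m then {lo (Suc q)..hi (Suc q)} else {}) = {}" for q
      unfolding I[symmetric] by (rule support_interval_disjoint[OF gen])
    show "Y q \<subseteq> (if 1 \<le> q \<and> q \<le> m then {lo q..hi q} else {})" for q
      using Y(1) unfolding I[symmetric] by blast
    qed (use Y in \<open>auto simp: K_def\<close>)
  qed (rule reflexive)
  have "smult (sg k) (p k) = 0"
  proof (rule chebyshev_tower[of "\<lambda>k. smult (sg k) (p k)" d X])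
    show "deg_below (smult (sg k) (p k)) (d k)" if "k \<le> m" for k using p[OF that] by (rule deg_below_smult)
    show "X \<inter> (if (1::nat) \<le> 1 \<and> 1 \<le> m then {lo 1..hi 1} else {}) = {}" using X(2) unfolding I .
    show "(\<Sum>k\<le>m. poly (smult (sg k) (p k)) x * cauchy_tower Y \<mu> 0 k x) = 0" if x: "x \<in> X" for x
    proof -
      have "(\<Sum>k\<le>m. poly (smult (sg k) (p k)) x * cauchy_tower Y \<mu> 0 k x) = (\<Sum>k\<le>m. poly (p k) x * nikishin_vector \<sigma> k x)"
        using Y(5)[OF _ x] by (intro sum.cong) (auto simp: nikishin_vector_level)
      then show ?thesis using zero[OF x] by simp
    qed
  qed (use X k in \<open>auto simp: K_def\<close>)
  then show ?thesis using Y(4)[of k] k by auto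
qed

section \<open>Forms with prescribed sign changes\<close>

text \<open>
  A form of a Haar space that vanishes on \<open>T\<close> exists by dimension and has no other zeros; it remains
  to see that it changes sign at every \<open>l \<in> T\<close>. If it only touches zero at \<open>l\<close>, subtract a small
  multiple of a form \<open>d\<close> that vanishes on the rest of \<open>T\<close> and at one more point \<open>xs\<close>, hence not at
  \<open>l\<close>. The zero at \<open>l\<close> then splits into two, which is one zero too many.
\<close>

lemma haar_form_with_sign_pattern:
  fixes \<phi> :: "'b \<Rightarrow> real \<Rightarrow> real"
  assumes ab: "a < b" and B: "finite B" and cont: "\<And>\<beta>. \<beta> \<in> B \<Longrightarrow> continuous_on {a<..<b} (\<phi> \<beta>)"
    and haar: "\<And>c X. finite X \<Longrightarrow> X \<subseteq> {a<..<b} \<Longrightarrow> card B \<le> card X \<Longrightarrow>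
        (\<And>x. x \<in> X \<Longrightarrow> (\<Sum>\<beta>\<in>B. c \<beta> * \<phi> \<beta> x) = 0) \<Longrightarrow> \<forall>\<beta>\<in>B. c \<beta> = 0"
    and T: "finite T" "T \<subseteq> {a<..<b}" "card T + 1 = card B"
  shows "\<exists>c. \<forall>x\<in>{a<..<b}-T. (\<Sum>\<beta>\<in>B. c \<beta> * \<phi> \<beta> x) * (\<Prod>t\<in>T. x - t) > 0"
proof -
  define form where "form c x = (\<Sum>\<beta>\<in>B. c \<beta> * \<phi> \<beta> x)" for c x
  have form_cont: "continuous_on {a<..<b} (form c)" for c
    unfolding form_def by (intro continuous_intros cont)
  have interp: "\<exists>c. (\<exists>\<beta>\<in>B. c \<beta> \<noteq> 0) \<and> (\<forall>x\<in>X. form c x = 0)" if "finite X" "card X < card B" for X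
    using homogeneous_system_solvable[OF that(1) B that(2), of "\<lambda>x \<beta>. \<phi> \<beta> x"]
    by (auto simp: form_def mult.commute)
  have few: "\<not> card B \<le> card X" if "finite X" "X \<subseteq> {a<..<b}" "\<exists>\<beta>\<in>B. c \<beta> \<noteq> 0" "\<And>x. x \<in> X \<Longrightarrow> form c x = 0" for X c
    using haar[of X c] that by (auto simp: form_def)
  obtain c where c: "\<exists>\<beta>\<in>B. c \<beta> \<noteq> 0" "\<forall>x\<in>T. form c x = 0" using interp[OF T(1)] T(3) by auto
  have nz: "form c x \<noteq> 0" if "x \<in> {a<..<b} - T" for x
  proof
    assume "form c x = 0"
    then have "\<not> card B \<le> card (insert x T)" using c T that by (intro few[of _ c]) auto
    then show False using T that by simp
  qed
  obtain S \<epsilon> where S: "S \<subseteq> T" "\<epsilon> = 1 \<or> \<epsilon> = (-1::real)"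
     "\<forall>x\<in>{a<..<b}-T. \<epsilon> * form c x * (\<Prod>t\<in>S. x - t) > 0"
  proof -
    have "continuous_on ({a<..<b} - T) (form c)" by (rule continuous_on_subset[OF form_cont]) auto
    from sign_pattern_of_nonvanishing[OF T(1) is_interval_oo this nz] show ?thesis using that by blast
  qed
  have "S = T"
  proof (rule ccontr)
    assume "S \<noteq> T"
    then obtain l where l: "l \<in> T" "l \<notin> S" using S(1) by auto
    have fS: "finite S" using S(1) T(1) finite_subset by blast
    have "{a<..<b} - T \<noteq> {}" using ab T(1) by (metis finite_Diff2 finite.emptyI infinite_Ioo)
    then obtain xs where "xs \<in> {a<..<b} - T" by blast
    then have xs: "xs \<in> {a<..<b}" "xs \<notin> T" by auto
    have cT: "card (T - {l}) + 1 = card T" using card.remove[OF T(1) l(1)] by simp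
    have "card (insert xs (T - {l})) \<le> card (T - {l}) + 1" using T(1) by (simp add: card_insert_if)
    then have "card (insert xs (T - {l})) < card B" using cT T(3) by simp
    then obtain d where d: "\<exists>\<beta>\<in>B. d \<beta> \<noteq> 0" "\<forall>x\<in>insert xs (T - {l}). form d x = 0"
      using interp[of "insert xs (T - {l})"] T(1) by auto
    have dl: "form d l \<noteq> 0"
    proof
      assume "form d l = 0"
      then have "\<not> card B \<le> card (insert xs T)" using d T xs by (intro few[of _ d]) auto
      then show False using T xs by simp
    qed
    define p where "p x = (\<Prod>t\<in>S. x - t)" for x
    have pl: "p l \<noteq> 0" using l fS by (auto simp: p_def)
    define s where "s = \<epsilon> * sgn (p l)"
    have s: "\<bar>s\<bar> = 1" using S(2) pl by (auto simp: s_def abs_mult abs_sgn_eq)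
    have p_cont: "continuous_on UNIV p" unfolding p_def by (intro continuous_intros)
    define R where "R = {l - a, b - l} \<union> (\<lambda>t. \<bar>l - t\<bar>) ` (T - {l})"
    define r where "r = Min R / 2"
    have lab: "l \<in> {a<..<b}" using l T by auto
    have R: "finite R" "R \<noteq> {}" using T(1) by (auto simp: R_def)
    have "\<forall>\<rho>\<in>R. \<rho> > 0" using lab by (auto simp: R_def)
    then have rpos: "r > 0" using Min_in[OF R] by (simp add: r_def)
    have rle: "2 * r \<le> l - a" "2 * r \<le> b - l" "\<And>t. t \<in> T - {l} \<Longrightarrow> 2 * r \<le> \<bar>l - t\<bar>"
    proof -
      have "2 * r \<le> \<rho>" if "\<rho> \<in> R" for \<rho> using Min_le[OF R(1) that] by (simp add: r_def)
      then show "2 * r \<le> l - a" "2 * r \<le> b - l" "\<And>t. t \<in> T - {l} \<Longrightarrow> 2 * r \<le> \<bar>l - t\<bar>"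
        by (auto simp: R_def)
    qed
    have near: "x \<in> {a<..<b}" "x \<notin> T - {l}" "p x * p l > 0" if "\<bar>x - l\<bar> \<le> r" for x
    proof -
      show "x \<in> {a<..<b}" using rle(1,2) that rpos by (auto simp: abs_le_iff)
      show "x \<notin> T - {l}"
      proof
        assume "x \<in> T - {l}"
        then have "2 * r \<le> \<bar>l - x\<bar>" by (rule rle(3))
        then show False using that rpos by (simp add: abs_minus_commute)
      qed
      show "p x * p l > 0"
      proof -
        have "(x - t) * (l - t) > 0" if t: "t \<in> S" for t
        proof -
          have "2 * r \<le> \<bar>l - t\<bar>" using rle(3) t S(1) l(2) by auto
          then show ?thesis using \<open>\<bar>x - l\<bar> \<le> r\<close> rpos
            by (cases "l > t") (auto intro: mult_pos_pos mult_neg_neg)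
        qed
        then have "(\<Prod>t\<in>S. (x - t) * (l - t)) > 0" by (intro prod_pos) auto
        then show ?thesis by (simp add: p_def prod.distrib)
      qed
    qed
    \<comment> \<open>Since \<open>l \<notin> S\<close>, the form has the same sign \<open>s\<close> on both sides of
      \<open>l\<close>.\<close>
    have pos: "s * form c x > 0" if x: "\<bar>x - l\<bar> \<le> r" "x \<noteq> l" for x
    proof -
      have "\<epsilon> * form c x * p x > 0" using S(3) near(1,2)[OF x(1)] x(2) by (auto simp: p_def)
      then have "(\<epsilon> * form c x * p x) * (p x * p l) > 0" using near(3)[OF x(1)] by simp
      then have "(\<epsilon> * form c x * p l) * (p x * p x) > 0" by (simp add: mult_ac)
      moreover have "p x \<noteq> 0" using near(3)[OF x(1)] by auto
      then have "p x * p x > 0" using not_real_square_gt_zero[of "p x"] by blast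
      ultimately have "\<epsilon> * form c x * p l > 0" by (rule zero_less_mult_pos2)
      then have "\<epsilon> * form c x * sgn (p l) > 0" using pl by (auto simp: sgn_if zero_less_mult_iff mult_less_0_iff)
      then show ?thesis by (simp add: s_def mult_ac)
    qed
    define \<eta>0 where "\<eta>0 = min (s * form c (l - r)) (s * form c (l + r))"
    have \<eta>0: "\<eta>0 > 0" unfolding \<eta>0_def using pos[of "l - r"] pos[of "l + r"] rpos by auto
    define Bd where "Bd = \<bar>form d (l - r)\<bar> + \<bar>form d (l + r)\<bar> + 1"
    define \<eta> where "\<eta> = \<eta>0 / Bd"
    have Bd: "Bd > 0" by (simp add: Bd_def add_nonneg_pos)
    have \<eta>: "\<eta> > 0" using \<eta>0 Bd by (simp add: \<eta>_def)
    define \<kappa> where "\<kappa> = \<eta> * s * sgn (form d l)"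
    define g where "g \<beta> = c \<beta> - \<kappa> * d \<beta>" for \<beta>
    have formg: "form g x = form c x - \<kappa> * form d x" for x
      by (simp add: form_def g_def left_diff_distrib sum_subtractf sum_distrib_left mult.assoc)
    have ss: "s * s = 1" using s by (metis abs_mult_self_eq mult.right_neutral)
    have sg: "s * form g x = s * form c x - \<eta> * (sgn (form d l) * form d x)" for x
    proof -
      have "s * (\<kappa> * form d x) = (s * s) * (\<eta> * (sgn (form d l) * form d x))" by (simp add: \<kappa>_def mult_ac)
      then show ?thesis using ss by (simp add: formg right_diff_distrib)
    qed
    have gl: "s * form g l < 0"
    proof -
      have "form c l = 0" using c(2) l by simp
      moreover have "sgn (form d l) * form d l > 0" using dl by (simp add: sgn_mult_self_eq[symmetric] sgn_if)
      ultimately show ?thesis using sg[of l] \<eta> by simp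
    qed
    have gpos: "s * form g x > 0" if x: "x = l - r \<or> x = l + r" for x
    proof -
      have "\<eta> * (sgn (form d l) * form d x) \<le> \<eta> * \<bar>form d x\<bar>"
        using \<eta> by (intro mult_left_mono) (auto simp: sgn_if)
      also have "\<dots> < \<eta> * Bd" using \<eta> x by (intro mult_strict_left_mono) (auto simp: Bd_def)
      also have "\<dots> = \<eta>0" using Bd by (simp add: \<eta>_def)
      also have "\<dots> \<le> s * form c x" using x by (auto simp: \<eta>0_def)
      finally show ?thesis by (simp add: sg)
    qed
    have contg: "continuous_on {l - r..l + r} (\<lambda>x. s * form g x)"
      using near(1) rpos by (intro continuous_intros continuous_on_subset[OF form_cont]) (auto simp: abs_le_iff)
    obtain x1 where x1: "l - r \<le> x1" "x1 \<le> l" "s * form g x1 = 0"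
      using IVT2'[of "\<lambda>x. s * form g x" l 0 "l - r"] gl gpos[of "l - r"] rpos
        continuous_on_subset[OF contg, of "{l - r..l}"] by force
    obtain x2 where x2: "l \<le> x2" "x2 \<le> l + r" "s * form g x2 = 0"
      using IVT'[of "\<lambda>x. s * form g x" l 0 "l + r"] gl gpos[of "l + r"] rpos
        continuous_on_subset[OF contg, of "{l..l + r}"] by force
    have x12: "x1 \<noteq> l" "x2 \<noteq> l" using x1 x2 gl by auto
    have ne: "\<exists>\<beta>\<in>B. g \<beta> \<noteq> 0"
    proof (rule ccontr)
      assume "\<not> ?thesis"
      then have "form g l = 0" by (simp add: form_def)
      then show False using gl by simp
    qed
    let ?X = "insert x1 (insert x2 (T - {l}))"
    have near12: "\<bar>x1 - l\<bar> \<le> r" "\<bar>x2 - l\<bar> \<le> r" using x1 x2 by auto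
    have "\<not> card B \<le> card ?X"
    proof (rule few[OF _ _ ne])
      show "finite ?X" using T(1) by simp
      show "?X \<subseteq> {a<..<b}" using near(1)[OF near12(1)] near(1)[OF near12(2)] T(2) by auto
      show "form g x = 0" if "x \<in> ?X" for x
        using that x1(3) x2(3) s c(2) d(2) by (auto simp: formg)
    qed
    moreover have "card ?X = card T + 1"
    proof -
      have "x1 \<noteq> x2" using x1(2) x2(1) x12 by auto
      then have "card ?X = Suc (Suc (card (T - {l})))"
        using near(2)[OF near12(1)] near(2)[OF near12(2)] T(1) by (subst card_insert_disjoint; simp)+
      then show ?thesis using cT by simp
    qed
    ultimately show False using T(3) by simp
  qed
  then have "\<forall>x\<in>{a<..<b}-T. (\<Sum>\<beta>\<in>B. (\<epsilon> * c \<beta>) * \<phi> \<beta> x) * (\<Prod>t\<in>T. x - t) > 0"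
    using S(3) by (simp add: form_def sum_distrib_left mult.assoc)
  then show ?thesis by (rule exI[of _ "\<lambda>\<beta>. \<epsilon> * c \<beta>"])
qed

lemma smaller_index_with_sum:
  fixes n :: "nat \<Rightarrow> nat"
  assumes "N \<le> (\<Sum>k\<le>m. n k)"
  shows "\<exists>n'. (\<forall>k. n' k \<le> n k) \<and> (\<Sum>k\<le>m. n' k) = N"
  using assms
proof (induction N)
  case 0
  show ?case by (intro exI[of _ "\<lambda>_. 0"]) auto
next
  case (Suc N)
  then obtain n' where n': "\<forall>k. n' k \<le> n k" "(\<Sum>k\<le>m. n' k) = N" by auto
  have "\<exists>k\<le>m. n' k < n k"
  proof (rule ccontr)
    assume "\<not> ?thesis"
    then have "(\<Sum>k\<le>m. n k) \<le> (\<Sum>k\<le>m. n' k)" by (intro sum_mono) (auto simp: not_less)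
    then show False using Suc.prems n'(2) by simp
  qed
  then obtain k where k: "k \<le> m" "n' k < n k" by blast
  have "(\<Sum>i\<le>m. (n'(k := Suc (n' k))) i) = (\<Sum>i\<le>m. n' i + (if i = k then 1 else 0))"
    by (intro sum.cong) auto
  also have "\<dots> = Suc N" using n'(2) k(1) by (simp add: sum.distrib)
  finally show ?case using n'(1) k(2) by (intro exI[of _ "n'(k := Suc (n' k))"]) auto
qed

text \<open>
  Identifies coefficient families indexed by the pairs \<open>(k, i)\<close> with \<open>i < n k\<close> with polynomial vectors.
\<close>

definition poly_of :: "(nat \<times> nat \<Rightarrow> 'a::comm_semiring_1) \<Rightarrow> (nat \<Rightarrow> nat) \<Rightarrow> nat \<Rightarrow> 'a poly" where
  "poly_of c n k = (\<Sum>i<n k. monom (c (k, i)) i)"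

lemma coeff_poly_of: "coeff (poly_of c n k) i = (if i < n k then c (k, i) else 0)"
  by (simp add: poly_of_def coeff_sum)

lemma deg_below_poly_of: "deg_below (poly_of c n k) (n k)"
  by (simp add: deg_below_def coeff_poly_of)

lemma poly_poly_of: "poly (poly_of c n k) x = (\<Sum>i<n k. c (k, i) * x ^ i)"
  by (simp add: poly_of_def poly_sum poly_monom)

lemma sum_poly_of:
  "(\<Sum>k\<le>m. poly (poly_of c n k) x * g k) = (\<Sum>\<beta>\<in>(SIGMA k:{..m}. {..<n k}). c \<beta> * (x ^ snd \<beta> * g (fst \<beta>)))"
  by (simp add: poly_poly_of sum_distrib_right mult.assoc sum.Sigma split_beta)

lemma base_interval_disjoint:
  assumes "nikishin_generators m \<Delta> \<sigma>"
  shows "\<Delta> 0 \<inter> support_interval m \<Delta> 1 = {}"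
  using assms by (auto simp: nikishin_generators_def support_interval_def Suc_le_eq)

text \<open>
  Lower the multi-index until the form has exactly one coefficient more than \<open>T\<close> has points. This is
  possible because the Chebyshev property holds for every multi-index.
\<close>

lemma nikishin_form_with_sign_pattern:
  assumes gen: "nikishin_generators m \<Delta> \<sigma>" and ab: "\<Delta> 0 = {a..b}" "a < b"
    and T: "finite T" "T \<subseteq> {a<..<b}" "card T < (\<Sum>k\<le>m. n k)"
  shows "\<exists>q. (\<forall>k\<le>m. deg_below (q k) (n k)) \<and>
     (\<forall>x\<in>{a<..<b}-T. (\<Sum>k\<le>m. poly (q k) x * nikishin_vector \<sigma> k x) * (\<Prod>t\<in>T. x - t) > 0)"
proof -
  have "card T + 1 \<le> (\<Sum>k\<le>m. n k)" using T(3) by simp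
  then obtain n' where n': "\<forall>k. n' k \<le> n k" "(\<Sum>k\<le>m. n' k) = card T + 1"
    using smaller_index_with_sum by blast
  define B where "B = (SIGMA k:{..m}. {..<n' k})"
  have cardB: "card B = card T + 1" using n'(2) by (simp add: B_def)
  have sub: "{a<..<b} \<subseteq> - support_interval m \<Delta> 1" using base_interval_disjoint[OF gen] ab by auto
  have "\<exists>c. \<forall>x\<in>{a<..<b}-T. (\<Sum>\<beta>\<in>B. c \<beta> * (x ^ snd \<beta> * nikishin_vector \<sigma> (fst \<beta>) x)) * (\<Prod>t\<in>T. x - t) > 0"
  proof (rule haar_form_with_sign_pattern[OF ab(2) _ _ _ T(1,2)])
    show "finite B" by (simp add: B_def)
    show "card T + 1 = card B" using cardB by simp
    fix \<beta> assume "\<beta> \<in> B"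
    then have "fst \<beta> \<le> m" by (auto simp: B_def)
    then have "continuous_on {a<..<b} (nikishin_vector \<sigma> (fst \<beta>))"
      unfolding nikishin_vector_level using level_vector_regular(2)[OF gen le0] sub
      by (auto intro: continuous_on_subset)
    then show "continuous_on {a<..<b} (\<lambda>x. x ^ snd \<beta> * nikishin_vector \<sigma> (fst \<beta>) x)"
      by (intro continuous_intros)
  next
    fix c X assume X: "finite X" "X \<subseteq> {a<..<b}" "card B \<le> card X"
      and zero: "\<And>x. x \<in> X \<Longrightarrow> (\<Sum>\<beta>\<in>B. c \<beta> * (x ^ snd \<beta> * nikishin_vector \<sigma> (fst \<beta>) x)) = 0"
    have "poly_of c n' k = 0" if "k \<le> m" for k
    proof (rule nikishin_chebyshev[OF gen deg_below_poly_of X(1) _ _ _ that])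
      show "X \<inter> support_interval m \<Delta> 1 = {}" using X(2) sub by auto
      show "(\<Sum>k\<le>m. n' k) \<le> card X" using X(3) cardB n'(2) by simp
      show "(\<Sum>k\<le>m. poly (poly_of c n' k) x * nikishin_vector \<sigma> k x) = 0" if "x \<in> X" for x
        using zero[OF that] by (simp add: sum_poly_of B_def)
    qed
    then have "c (k, i) = 0" if "k \<le> m" "i < n' k" for k i
      using coeff_poly_of[of c n' k i] that by simp
    then show "\<forall>\<beta>\<in>B. c \<beta> = 0" by (auto simp: B_def)
  qed
  then obtain c where c: "\<forall>x\<in>{a<..<b}-T. (\<Sum>\<beta>\<in>B. c \<beta> * (x ^ snd \<beta> * nikishin_vector \<sigma> (fst \<beta>) x)) * (\<Prod>t\<in>T. x - t) > 0"
    by blast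
  show ?thesis
  proof (intro exI[of _ "poly_of c n'"] conjI allI impI)
    show "deg_below (poly_of c n' k) (n k)" for k
      using deg_below_mono[OF deg_below_poly_of] n'(1) by blast
    show "\<forall>x\<in>{a<..<b}-T. (\<Sum>k\<le>m. poly (poly_of c n' k) x * nikishin_vector \<sigma> k x) * (\<Prod>t\<in>T. x - t) > 0"
      using c by (simp add: sum_poly_of B_def)
  qed
qed

section \<open>Orthogonal forms vanish\<close>

lemma nikishin_vector_regular:
  assumes "nikishin_generators m \<Delta> \<sigma>" "k \<le> m" "\<Delta> 0 = {a..b}"
  shows "nikishin_vector \<sigma> k \<in> borel_measurable borel" "continuous_on {a..b} (nikishin_vector \<sigma> k)"
proof -
  show "nikishin_vector \<sigma> k \<in> borel_measurable borel"
    unfolding nikishin_vector_level by (rule level_vector_regular(1)[OF assms(1) le0 assms(2)])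
  have "continuous_on (- support_interval m \<Delta> (Suc 0)) (nikishin_vector \<sigma> k)"
    unfolding nikishin_vector_level by (rule level_vector_regular(2)[OF assms(1) le0 assms(2)])
  then show "continuous_on {a..b} (nikishin_vector \<sigma> k)"
    by (rule continuous_on_subset) (use base_interval_disjoint[OF assms(1)] assms(3) in auto)
qed

lemma borel_measurable_poly [measurable]:
  "poly p \<in> borel_measurable (borel :: real measure)" for p :: "real poly"
  by (intro borel_measurable_continuous_onI continuous_at_imp_continuous_on ballI poly_isCont)

locale mixed_system = interval_measure \<nu> a b for \<nu> a b +
  fixes m1 m2 :: nat and \<Delta>1 \<Delta>2 :: "nat \<Rightarrow> real set" and \<sigma>1 \<sigma>2 :: "nat \<Rightarrow> smeasure"
  assumes gen1: "nikishin_generators m1 \<Delta>1 \<sigma>1" and gen2: "nikishin_generators m2 \<Delta>2 \<sigma>2"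
    and base1: "\<Delta>1 0 = {a..b}" and base2: "\<Delta>2 0 = {a..b}"
begin

abbreviation U where "U \<equiv> nikishin_vector \<sigma>2"
abbreviation V where "V \<equiv> nikishin_vector \<sigma>1"

lemma UV_regular:
  "j \<le> m2 \<Longrightarrow> U j \<in> borel_measurable borel" "j \<le> m2 \<Longrightarrow> continuous_on {a..b} (U j)"
  "k \<le> m1 \<Longrightarrow> V k \<in> borel_measurable borel" "k \<le> m1 \<Longrightarrow> continuous_on {a..b} (V k)"
  using nikishin_vector_regular[OF gen1 _ base1] nikishin_vector_regular[OF gen2 _ base2] by auto

text \<open>
  A nonzero form has fewer than \<open>|n1| \<le> |n2|\<close> zeros, so the second system provides a form \<open>B\<close> of
  degrees below \<open>n2\<close> with the same sign changes. Then \<open>A B\<close> has constant sign, yet its integral is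
  a combination of the vanishing ones.
\<close>

lemma real_orthogonal_form_vanishes:
  fixes p :: "nat \<Rightarrow> real poly"
  assumes p: "\<And>k. k \<le> m1 \<Longrightarrow> deg_below (p k) (n1 k)" and n: "(\<Sum>k\<le>m1. n1 k) \<le> (\<Sum>j\<le>m2. n2 j)"
    and orth: "\<And>j l. j \<le> m2 \<Longrightarrow> l < n2 j \<Longrightarrow> (\<integral>x. x ^ l * U j x * (\<Sum>k\<le>m1. poly (p k) x * V k x) \<partial>\<nu>) = 0"
    and k: "k \<le> m1"
  shows "p k = 0"
proof (rule ccontr)
  assume "p k \<noteq> 0"
  define A where "A x = (\<Sum>k\<le>m1. poly (p k) x * V k x)" for x
  have A: "A \<in> borel_measurable borel" "continuous_on {a..b} A"
    unfolding A_def using UV_regular(3,4) by (auto intro!: continuous_intros borel_measurable_sum borel_measurable_times)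
  have ab: "a < b" by (rule interval_nondegenerate)
  define Z where "Z = {x\<in>{a<..<b}. A x = 0}"
  have few: "card X < (\<Sum>k\<le>m1. n1 k)" if "finite X" "X \<subseteq> Z" for X
  proof (rule ccontr)
    assume "\<not> card X < (\<Sum>k\<le>m1. n1 k)"
    moreover have "X \<subseteq> {a..b}" using that(2) by (auto simp: Z_def)
    then have "X \<inter> support_interval m1 \<Delta>1 1 = {}" using base_interval_disjoint[OF gen1] base1 by blast
    ultimately have "p k = 0" using that(2)
      by (intro nikishin_chebyshev[OF gen1 p that(1) _ _ _ k]) (auto simp: Z_def A_def not_less)
    then show False using \<open>p k \<noteq> 0\<close> by blast
  qed
  have Zfin: "finite Z"
  proof (rule ccontr)
    assume "infinite Z"
    then obtain X where "X \<subseteq> Z" "finite X" "card X = (\<Sum>k\<le>m1. n1 k)" using infinite_arbitrarily_large by blast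
    then show False using few[of X] by simp
  qed
  have A_cont: "continuous_on ({a<..<b} - Z) A" by (rule continuous_on_subset[OF A(2)]) auto
  have A_nz: "A x \<noteq> 0" if "x \<in> {a<..<b} - Z" for x using that by (auto simp: Z_def)
  from sign_pattern_of_nonvanishing[OF Zfin is_interval_oo A_cont A_nz]
  obtain T \<epsilon> where T: "T \<subseteq> Z" "\<epsilon> = 1 \<or> \<epsilon> = (-1::real)"
     "\<forall>x\<in>{a<..<b}-Z. \<epsilon> * A x * (\<Prod>t\<in>T. x - t) > 0"
    by blast
  have Tfin: "finite T" using T(1) Zfin finite_subset by blast
  have "card T < (\<Sum>j\<le>m2. n2 j)" using few[OF Tfin T(1)] n by simp
  moreover have "T \<subseteq> {a<..<b}" using T(1) by (auto simp: Z_def)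
  ultimately obtain q where q: "\<And>j. j \<le> m2 \<Longrightarrow> deg_below (q j) (n2 j)"
     "\<forall>x\<in>{a<..<b}-T. (\<Sum>j\<le>m2. poly (q j) x * U j x) * (\<Prod>t\<in>T. x - t) > 0"
    using nikishin_form_with_sign_pattern[OF gen2 base2 ab Tfin] by blast
  define B where "B x = (\<Sum>j\<le>m2. poly (q j) x * U j x)" for x
  have B: "B \<in> borel_measurable borel" "continuous_on {a..b} B"
    unfolding B_def using UV_regular(1,2) by (auto intro!: continuous_intros borel_measurable_sum borel_measurable_times)
  have int: "integrable \<nu> (\<lambda>x. x ^ l * U j x * A x)" if "j \<le> m2" for j l
    using A UV_regular(1,2)[OF that] by (intro integrable_continuous borel_measurable_times continuous_intros) auto
  have "(\<integral>x. \<epsilon> * (A x * B x) \<partial>\<nu>) = 0"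
  proof -
    have "B x * A x = (\<Sum>j\<le>m2. \<Sum>l<n2 j. coeff (q j) l * (x ^ l * U j x * A x))" for x
    proof -
      have "poly (q j) x = (\<Sum>l<n2 j. coeff (q j) l * x ^ l)" if "j \<le> m2" for j
      proof (cases "q j = 0")
        case False
        then have "degree (q j) < n2 j" using q(1)[OF that] by (simp add: deg_below_degree)
        then have "(\<Sum>l\<le>degree (q j). coeff (q j) l * x ^ l) = (\<Sum>l<n2 j. coeff (q j) l * x ^ l)"
          by (intro sum.mono_neutral_left) (auto simp: coeff_eq_0)
        then show ?thesis by (simp add: poly_altdef)
      qed simp
      then show ?thesis by (simp add: B_def sum_distrib_right mult.assoc)
    qed
    then have "(\<integral>x. \<epsilon> * (A x * B x) \<partial>\<nu>) = (\<integral>x. (\<Sum>j\<le>m2. \<Sum>l<n2 j. \<epsilon> * coeff (q j) l * (x ^ l * U j x * A x)) \<partial>\<nu>)"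
      by (simp add: mult.commute[of "A _"] sum_distrib_left mult.assoc)
    also have "\<dots> = (\<Sum>j\<le>m2. \<Sum>l<n2 j. \<epsilon> * coeff (q j) l * (\<integral>x. x ^ l * U j x * A x \<partial>\<nu>))"
      using int by (simp add: Bochner_Integration.integral_sum)
    also have "\<dots> = 0"
    proof (intro sum.neutral ballI)
      fix j l assume "j \<in> {..m2}" "l \<in> {..<n2 j}"
      then show "\<epsilon> * coeff (q j) l * (\<integral>x. x ^ l * U j x * A x \<partial>\<nu>) = 0" using orth[of j l] by (simp add: A_def)
    qed
    finally show ?thesis .
  qed
  moreover have "(\<integral>x. \<epsilon> * (A x * B x) \<partial>\<nu>) \<noteq> 0"
  proof (rule integral_nonzero_of_finite_zeros[OF _ _ Zfin])
    show "(\<lambda>x. \<epsilon> * (A x * B x)) \<in> borel_measurable borel" using A B by auto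
    show "continuous_on {a..b} (\<lambda>x. \<epsilon> * (A x * B x))" using A B by (intro continuous_intros)
    fix x assume x: "x \<in> {a<..<b} - Z"
    have xT: "x \<in> {a<..<b} - T" using x T(1) by auto
    have "(\<epsilon> * A x * (\<Prod>t\<in>T. x - t)) * (B x * (\<Prod>t\<in>T. x - t)) > 0"
      using T(3)[rule_format, OF x] q(2)[rule_format, OF xT] unfolding B_def by (rule mult_pos_pos)
    then have "(\<epsilon> * (A x * B x)) * ((\<Prod>t\<in>T. x - t) * (\<Prod>t\<in>T. x - t)) > 0" by (simp add: mult_ac)
    moreover have "(\<Prod>t\<in>T. x - t) \<noteq> 0" using xT Tfin by auto
    then have "(\<Prod>t\<in>T. x - t) * (\<Prod>t\<in>T. x - t) > 0" using not_real_square_gt_zero by blast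
    ultimately show "\<epsilon> * (A x * B x) > 0" by (rule zero_less_mult_pos2)
  next
    fix x assume "x \<in> {a<..<b} \<inter> Z"
    then show "\<epsilon> * (A x * B x) \<ge> 0" by (simp add: Z_def)
  qed
  ultimately show False by blast
qed

definition complex_form :: "(nat \<Rightarrow> complex poly) \<Rightarrow> real \<Rightarrow> complex" where
  "complex_form p x = (\<Sum>k\<le>m1. poly (p k) (of_real x) * of_real (V k x))"

definition moment :: "(nat \<Rightarrow> complex poly) \<Rightarrow> nat \<Rightarrow> nat \<Rightarrow> complex" where
  "moment p j l = (\<integral>x. of_real (x ^ l * U j x) * complex_form p x \<partial>\<nu>)"

lemma complex_form_regular:
  "complex_form p \<in> borel_measurable borel" "continuous_on {a..b} (complex_form p)"
proof -
  have cp: "continuous_on A (\<lambda>x. poly q (of_real x :: complex))" for q A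
    by (intro continuous_intros)
  have pm: "(\<lambda>x. poly q (of_real x :: complex)) \<in> borel_measurable borel" for q
    by (rule borel_measurable_continuous_onI[OF cp])
  show "complex_form p \<in> borel_measurable borel"
    unfolding complex_form_def using UV_regular(3) pm
    by (intro borel_measurable_sum borel_measurable_times borel_measurable_of_real) auto
  show "continuous_on {a..b} (complex_form p)"
    unfolding complex_form_def using UV_regular(4) cp by (intro continuous_intros) auto
qed

lemma integrable_moment:
  assumes "j \<le> m2"
  shows "integrable \<nu> (\<lambda>x. of_real (x ^ l * U j x) * complex_form p x)"
  using complex_form_regular UV_regular(1,2)[OF assms]
  by (intro integrable_continuous borel_measurable_times borel_measurable_of_real continuous_intros) auto

text \<open>
  The weights are real, so the real and imaginary parts of the coefficients satisfy the conditions
  separately.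
\<close>

lemma orthogonal_form_vanishes:
  assumes p: "\<And>k. k \<le> m1 \<Longrightarrow> deg_below (p k) (n1 k)" and n: "(\<Sum>k\<le>m1. n1 k) \<le> (\<Sum>j\<le>m2. n2 j)"
    and orth: "\<And>j l. j \<le> m2 \<Longrightarrow> l < n2 j \<Longrightarrow> moment p j l = 0" and k: "k \<le> m1"
  shows "p k = 0"
proof -
  have Re_poly: "Re (poly q (of_real x)) = poly (map_poly Re q) x" for q x
    by (induction q) (auto simp: map_poly_pCons)
  have Im_poly: "Im (poly q (of_real x)) = poly (map_poly Im q) x" for q x
    by (induction q) (auto simp: map_poly_pCons)
  have "map_poly Re (p k) = 0"
  proof (rule real_orthogonal_form_vanishes[OF _ n _ k])
    show "deg_below (map_poly Re (p k)) (n1 k)" if "k \<le> m1" for k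
      using p[OF that] by (simp add: deg_below_def coeff_map_poly)
    fix j l assume jl: "j \<le> m2" "l < n2 j"
    have "(\<integral>x. x ^ l * U j x * (\<Sum>k\<le>m1. poly (map_poly Re (p k)) x * V k x) \<partial>\<nu>)
        = (\<integral>x. Re (of_real (x ^ l * U j x) * complex_form p x) \<partial>\<nu>)"
      by (intro Bochner_Integration.integral_cong) (auto simp: complex_form_def Re_poly sum_distrib_left)
    also have "\<dots> = Re (moment p j l)" unfolding moment_def by (rule integral_Re[OF integrable_moment[OF jl(1)]])
    finally show "(\<integral>x. x ^ l * U j x * (\<Sum>k\<le>m1. poly (map_poly Re (p k)) x * V k x) \<partial>\<nu>) = 0" using orth[OF jl] by simp
  qed
  moreover have "map_poly Im (p k) = 0"
  proof (rule real_orthogonal_form_vanishes[OF _ n _ k])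
    show "deg_below (map_poly Im (p k)) (n1 k)" if "k \<le> m1" for k
      using p[OF that] by (simp add: deg_below_def coeff_map_poly)
    fix j l assume jl: "j \<le> m2" "l < n2 j"
    have "(\<integral>x. x ^ l * U j x * (\<Sum>k\<le>m1. poly (map_poly Im (p k)) x * V k x) \<partial>\<nu>)
        = (\<integral>x. Im (of_real (x ^ l * U j x) * complex_form p x) \<partial>\<nu>)"
      by (intro Bochner_Integration.integral_cong) (auto simp: complex_form_def Im_poly sum_distrib_left)
    also have "\<dots> = Im (moment p j l)" unfolding moment_def by (rule integral_Im[OF integrable_moment[OF jl(1)]])
    finally show "(\<integral>x. x ^ l * U j x * (\<Sum>k\<le>m1. poly (map_poly Im (p k)) x * V k x) \<partial>\<nu>) = 0" using orth[OF jl] by simp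
  qed
  ultimately show ?thesis by (auto simp: poly_eq_iff coeff_map_poly complex_eq_iff)
qed

end

section \<open>From order conditions to orthogonality\<close>

lemma poly_bigo_inverse_imp_zero:
  fixes Q :: "complex poly"
  assumes "(\<lambda>z. poly Q z) \<in> O[at_infinity](\<lambda>z. 1 / z)"
  shows "Q = 0"
proof -
  have inv: "((\<lambda>z::complex. 1 / z) \<longlongrightarrow> 0) at_infinity"
    using tendsto_inverse_0 by (simp only: inverse_eq_divide[abs_def])
  obtain C where "C > 0" and C: "\<forall>\<^sub>F z in at_infinity. norm (poly Q z) \<le> C * norm (1 / z)"
    using assms by (elim landau_o.bigE)
  have lim: "(poly Q \<longlongrightarrow> 0) at_infinity"
    using C by (intro tendsto_0_le[OF inv, of "poly Q" C]) (simp add: mult.commute)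
  have "degree Q = 0"
    using filterlim_poly_at_infinity[of Q] not_tendsto_and_filterlim_at_infinity[OF trivial_limit_at_infinity lim] by blast
  then obtain c where c: "Q = [:c:]" by (rule degree_eq_zeroE)
  then have "poly Q = (\<lambda>z. c)" by (simp add: fun_eq_iff)
  with lim have "((\<lambda>z::complex. c) \<longlongrightarrow> 0) at_infinity" by simp
  then show ?thesis using c by (simp add: tendsto_const_iff[OF trivial_limit_at_infinity])
qed

text \<open>
  In the application \<open>\<epsilon>\<close> is the sign of the common base measure, and \<open>\<nu>\<close> is its total variation.
\<close>

locale mixed_functions = mixed_system +
  fixes \<epsilon> :: real
  assumes \<epsilon>: "\<epsilon> \<noteq> 0"
    and sintegral_base: "\<And>f :: real \<Rightarrow> complex. f \<in> borel_measurable borel \<Longrightarrow> sintegral (\<sigma>2 0) f = \<epsilon> *\<^sub>R (\<integral>x. f x \<partial>\<nu>)"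
begin

definition cauchy_integral :: "(real \<Rightarrow> complex) \<Rightarrow> complex \<Rightarrow> complex" where
  "cauchy_integral g z = (\<integral>x. g x / (z - of_real x) \<partial>\<nu>)"

text \<open>
  Measurability is required on the whole line because that is what integration uses; continuity only
  holds on the interval.
\<close>

definition regular :: "(real \<Rightarrow> complex) \<Rightarrow> bool" where
  "regular g \<longleftrightarrow> g \<in> borel_measurable borel \<and> continuous_on {a..b} g"

lemma regular_integrable: "regular g \<Longrightarrow> integrable \<nu> g"
  unfolding regular_def by (intro integrable_continuous) auto

lemma regular_mult: "regular f \<Longrightarrow> regular g \<Longrightarrow> regular (\<lambda>x. f x * g x)"
  unfolding regular_def by (auto intro: continuous_intros)

lemma regular_poly: "regular (\<lambda>x. poly p (of_real x))"
  unfolding regular_def by (auto intro!: continuous_intros borel_measurable_continuous_onI)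

lemma regular_kernel:
  assumes "regular g" "z \<notin> of_real ` {a..b}"
  shows "integrable \<nu> (\<lambda>x. g x / (z - of_real x))"
  using assms unfolding regular_def by (intro integrable_continuous) (auto intro!: continuous_intros)

lemma cauchy_integral_times_z:
  assumes h: "regular h" and z: "z \<notin> of_real ` {a..b}"
  shows "z * cauchy_integral h z = (\<integral>x. h x \<partial>\<nu>) + cauchy_integral (\<lambda>x. of_real x * h x) z"
proof -
  have xh: "regular (\<lambda>x. of_real x * h x)" using regular_mult[OF regular_poly[of "[:0, 1:]"] h] by simp
  have "z * cauchy_integral h z = (\<integral>x. z * (h x / (z - of_real x)) \<partial>\<nu>)"
    unfolding cauchy_integral_def by (rule integral_mult_right_zero[symmetric])
  also have "\<dots> = (\<integral>x. h x + (of_real x * h x) / (z - of_real x) \<partial>\<nu>)"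
  proof (rule integral_cong_AE)
    show "(\<lambda>x. z * (h x / (z - of_real x))) \<in> borel_measurable \<nu>"
      "(\<lambda>x. h x + (of_real x * h x) / (z - of_real x)) \<in> borel_measurable \<nu>"
      using h xh by (auto intro!: measurable_\<nu> simp: regular_def)
    show "AE x in \<nu>. z * (h x / (z - of_real x)) = h x + (of_real x * h x) / (z - of_real x)"
      using AE_interval
    proof eventually_elim
      case (elim x)
      then have "z - of_real x \<noteq> 0" using z by auto
      then show ?case by (simp add: field_simps)
    qed
  qed
  also have "\<dots> = (\<integral>x. h x \<partial>\<nu>) + cauchy_integral (\<lambda>x. of_real x * h x) z"
    using regular_integrable[OF h] regular_kernel[OF xh z] by (simp add: cauchy_integral_def)
  finally show ?thesis .
qed

lemma poly_times_cauchy_integral: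
  assumes "regular g"
  shows "\<exists>D. \<forall>z. z \<notin> of_real ` {a..b} \<longrightarrow>
    poly p z * cauchy_integral g z = poly D z + cauchy_integral (\<lambda>x. g x * poly p (of_real x)) z"
proof (induction p)
  case 0
  show ?case by (intro exI[of _ 0]) (simp add: cauchy_integral_def)
next
  case (pCons c p)
  then obtain D where D: "\<And>z. z \<notin> of_real ` {a..b} \<Longrightarrow>
     poly p z * cauchy_integral g z = poly D z + cauchy_integral (\<lambda>x. g x * poly p (of_real x)) z" by blast
  define h where "h x = g x * poly p (of_real x)" for x
  have h: "regular h" unfolding h_def using assms regular_poly by (rule regular_mult)
  define C where "C = (\<integral>x. h x \<partial>\<nu>)"
  have "poly (pCons c p) z * cauchy_integral g z = poly (pCons C D) z + cauchy_integral (\<lambda>x. g x * poly (pCons c p) (of_real x)) z"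
    if z: "z \<notin> of_real ` {a..b}" for z
  proof -
    have xh: "regular (\<lambda>x. of_real x * h x)" using regular_poly[of "[:0, 1:]"] h regular_mult[of "\<lambda>x. of_real x" h] by simp
    have zh: "z * cauchy_integral h z = C + cauchy_integral (\<lambda>x. of_real x * h x) z"
      unfolding C_def by (rule cauchy_integral_times_z[OF h z])
    have "poly (pCons c p) z * cauchy_integral g z = c * cauchy_integral g z + z * (poly p z * cauchy_integral g z)"
      by (simp add: algebra_simps)
    also have "\<dots> = z * poly D z + C + (c * cauchy_integral g z + cauchy_integral (\<lambda>x. of_real x * h x) z)"
      unfolding D[OF z] distrib_left using zh by (simp add: h_def[abs_def])
    also have "c * cauchy_integral g z + cauchy_integral (\<lambda>x. of_real x * h x) z
        = (\<integral>x. c * (g x / (z - of_real x)) + (of_real x * h x) / (z - of_real x) \<partial>\<nu>)"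
      using regular_kernel[OF assms z] regular_kernel[OF xh z]
      by (simp add: cauchy_integral_def del: times_divide_eq_right)
    also have "\<dots> = cauchy_integral (\<lambda>x. g x * poly (pCons c p) (of_real x)) z"
      unfolding cauchy_integral_def
      by (intro Bochner_Integration.integral_cong) (auto simp: h_def add_divide_distrib[symmetric] algebra_simps)
    finally show ?thesis by simp
  qed
  then show ?case by blast
qed

text \<open>
  The polynomial part of \<open>z^n\<close> times the Cauchy integral of \<open>g\<close> at infinity. Its coefficients are the
  first \<open>n\<close> moments of \<open>g\<close>.
\<close>

primrec moment_poly :: "(real \<Rightarrow> complex) \<Rightarrow> nat \<Rightarrow> complex poly" where
  "moment_poly g 0 = 0"
| "moment_poly g (Suc n) = pCons (\<integral>x. of_real (x ^ n) * g x \<partial>\<nu>) (moment_poly g n)"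

lemma moment_poly_eq_0: "moment_poly g n = 0 \<longleftrightarrow> (\<forall>l<n. (\<integral>x. of_real (x ^ l) * g x \<partial>\<nu>) = 0)"
  by (induction n) (auto simp: less_Suc_eq)

lemma deg_below_moment_poly: "deg_below (moment_poly g n) n"
  by (induction n) (auto simp: deg_below_0 intro: deg_below_pCons)

lemma regular_power: "regular g \<Longrightarrow> regular (\<lambda>x. of_real (x ^ n) * g x)"
  using regular_mult[OF regular_poly[of "monom 1 n"]] by (simp add: poly_monom)

lemma cauchy_integral_expansion:
  assumes g: "regular g" and z: "z \<notin> of_real ` {a..b}"
  shows "z ^ n * cauchy_integral g z = poly (moment_poly g n) z + cauchy_integral (\<lambda>x. of_real (x ^ n) * g x) z"
proof (induction n)
  case 0
  show ?case by simp
next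
  case (Suc n)
  define h where "h x = of_real (x ^ n) * g x" for x
  have h: "regular h" unfolding h_def using g by (rule regular_power)
  have "z * cauchy_integral h z = (\<integral>x. h x \<partial>\<nu>) + cauchy_integral (\<lambda>x. of_real x * h x) z"
    by (rule cauchy_integral_times_z[OF h z])
  moreover have "z ^ Suc n * cauchy_integral g z = z * (poly (moment_poly g n) z + cauchy_integral h z)"
    using Suc.IH by (simp add: h_def[abs_def] mult.assoc)
  ultimately show ?case by (simp add: distrib_left h_def[abs_def] mult.assoc)
qed

lemma eventually_outside_interval: "\<forall>\<^sub>F z::complex in at_infinity. z \<notin> of_real ` {a..b} \<and> z \<noteq> 0"
proof -
  have "\<forall>\<^sub>F z::complex in at_infinity. \<bar>a\<bar> + \<bar>b\<bar> + 1 \<le> norm z" unfolding eventually_at_infinity by blast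
  then show ?thesis by eventually_elim auto
qed

lemma cauchy_integral_bigo:
  assumes g: "regular g"
  shows "cauchy_integral g \<in> O[at_infinity](\<lambda>z. 1 / z)"
proof -
  interpret finite_measure \<nu> by (rule finite_measure)
  have "bounded (g ` {a..b})"
    using g by (intro compact_imp_bounded compact_continuous_image) (auto simp: regular_def)
  then obtain B where B: "\<And>x. x \<in> {a..b} \<Longrightarrow> norm (g x) \<le> B" unfolding bounded_iff by blast
  define R where "R = \<bar>a\<bar> + \<bar>b\<bar> + 1"
  have "\<forall>\<^sub>F z::complex in at_infinity. 2 * R \<le> norm z" unfolding eventually_at_infinity by blast
  then have "\<forall>\<^sub>F z in at_infinity. norm (cauchy_integral g z) \<le> (B * 2 * measure \<nu> (space \<nu>)) * norm (1 / z)"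
    using eventually_outside_interval
  proof eventually_elim
    case (elim z)
    have z: "norm z > 0" using elim by simp
    have int: "integrable \<nu> (\<lambda>x. g x / (z - of_real x))" using elim by (intro regular_kernel[OF g]) auto
    have "norm (cauchy_integral g z) \<le> (\<integral>x. norm (g x / (z - of_real x)) \<partial>\<nu>)"
      unfolding cauchy_integral_def by (rule integral_norm_bound)
    also have "\<dots> \<le> (\<integral>x. B * (2 / norm z) \<partial>\<nu>)"
    proof (rule integral_mono_AE)
      show "AE x in \<nu>. norm (g x / (z - of_real x)) \<le> B * (2 / norm z)"
        using AE_interval
      proof eventually_elim
        fix x assume x: "x \<in> {a..b}"
        then have "norm (of_real x :: complex) \<le> R" by (auto simp: R_def)
        then have "norm (z - of_real x) \<ge> norm z / 2" using norm_triangle_ineq2[of z "of_real x"] elim(1) by simp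
        then have "1 / norm (z - of_real x) \<le> 2 / norm z"
          using le_imp_inverse_le[of "norm z / 2" "norm (z - of_real x)"] z by (simp add: inverse_eq_divide)
        then have "norm (g x) * (1 / norm (z - of_real x)) \<le> B * (2 / norm z)"
          using B[OF x] order_trans[OF norm_ge_zero B[OF x]] by (intro mult_mono) auto
        then show "norm (g x / (z - of_real x)) \<le> B * (2 / norm z)" by (simp add: norm_divide)
      qed
    qed (use int in auto)
    finally show ?case by (simp add: norm_divide mult_ac)
  qed
  then show ?thesis by (rule bigoI)
qed

lemma mixed_combination:
  assumes j: "j \<le> m2"
  shows "\<exists>D. \<forall>z. z \<notin> of_real ` {a..b} \<longrightarrow>
    (\<Sum>k\<le>m1. mixed_nikishin \<sigma>1 \<sigma>2 j k z * poly (p k) z)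
      = poly D z + \<epsilon> *\<^sub>R cauchy_integral (\<lambda>x. of_real (U j x) * complex_form p x) z"
proof -
  define w where "w k x = (of_real (U j x * V k x) :: complex)" for k x
  have w: "regular (w k)" if "k \<le> m1" for k
    using UV_regular(1,2)[OF j] UV_regular(3,4)[OF that]
    unfolding regular_def w_def by (auto intro!: continuous_intros)
  have "\<exists>D. \<forall>z. z \<notin> of_real ` {a..b} \<longrightarrow> poly (p k) z * cauchy_integral (w k) z
      = poly D z + cauchy_integral (\<lambda>x. w k x * poly (p k) (of_real x)) z" if "k \<le> m1" for k
    using poly_times_cauchy_integral[OF w[OF that]] .
  then obtain D where D: "\<And>k z. k \<le> m1 \<Longrightarrow> z \<notin> of_real ` {a..b} \<Longrightarrow> poly (p k) z * cauchy_integral (w k) z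
      = poly (D k) z + cauchy_integral (\<lambda>x. w k x * poly (p k) (of_real x)) z" by metis
  have "(\<Sum>k\<le>m1. mixed_nikishin \<sigma>1 \<sigma>2 j k z * poly (p k) z)
      = poly (smult (of_real \<epsilon>) (\<Sum>k\<le>m1. D k)) z + \<epsilon> *\<^sub>R cauchy_integral (\<lambda>x. of_real (U j x) * complex_form p x) z"
    if z: "z \<notin> of_real ` {a..b}" for z
  proof -
    have mix: "mixed_nikishin \<sigma>1 \<sigma>2 j k z = \<epsilon> *\<^sub>R cauchy_integral (w k) z" if "k \<le> m1" for k
      using w[OF that] unfolding mixed_nikishin_def mixed_weight_def cauchy_integral_def w_def
      by (subst sintegral_base) (auto simp: regular_def)
    have reg: "regular (\<lambda>x. w k x * poly (p k) (of_real x))" if "k \<le> m1" for k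
      using w[OF that] regular_poly by (rule regular_mult)
    have "(\<Sum>k\<le>m1. cauchy_integral (\<lambda>x. w k x * poly (p k) (of_real x)) z)
        = cauchy_integral (\<lambda>x. of_real (U j x) * complex_form p x) z"
    proof -
      have "(\<Sum>k\<le>m1. cauchy_integral (\<lambda>x. w k x * poly (p k) (of_real x)) z)
          = (\<integral>x. (\<Sum>k\<le>m1. w k x * poly (p k) (of_real x) / (z - of_real x)) \<partial>\<nu>)"
        unfolding cauchy_integral_def using regular_kernel[OF reg z]
        by (intro Bochner_Integration.integral_sum[symmetric]) auto
      also have "\<dots> = cauchy_integral (\<lambda>x. of_real (U j x) * complex_form p x) z"
        unfolding cauchy_integral_def complex_form_def w_def
        by (intro Bochner_Integration.integral_cong) (auto simp: sum_distrib_left sum_divide_distrib mult_ac)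
      finally show ?thesis .
    qed
    moreover have "(\<Sum>k\<le>m1. mixed_nikishin \<sigma>1 \<sigma>2 j k z * poly (p k) z)
        = \<epsilon> *\<^sub>R (\<Sum>k\<le>m1. poly (D k) z + cauchy_integral (\<lambda>x. w k x * poly (p k) (of_real x)) z)"
      unfolding scaleR_sum_right
    proof (intro sum.cong refl)
      fix k assume "k \<in> {..m1}"
      then have k: "k \<le> m1" by simp
      show "mixed_nikishin \<sigma>1 \<sigma>2 j k z * poly (p k) z
        = \<epsilon> *\<^sub>R (poly (D k) z + cauchy_integral (\<lambda>x. w k x * poly (p k) (of_real x)) z)"
        unfolding mix[OF k] D[OF k z, symmetric] by (simp add: mult.commute)
    qed
    ultimately show ?thesis by (simp add: sum.distrib distrib_left poly_sum scaleR_conv_of_real)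
  qed
  then show ?thesis by blast
qed

text \<open>
  Up to a polynomial, the left-hand side is a Cauchy integral. After multiplication by \<open>z^n\<close>, the
  order condition says that \<open>z^n (D - d) + \<epsilon> moment_poly g n\<close> is \<open>O(1/z)\<close>, hence zero. The two
  summands have no powers of \<open>z\<close> in common, so that the moments vanish.
\<close>

lemma order_condition_iff_moments:
  assumes j: "j \<le> m2"
  shows "(\<exists>d. (\<lambda>z. (\<Sum>k\<le>m1. mixed_nikishin \<sigma>1 \<sigma>2 j k z * poly (p k) z) - poly d z) \<in> O[at_infinity](\<lambda>z. 1 / z ^ (n + 1)))
    \<longleftrightarrow> (\<forall>l<n. moment p j l = 0)" (is "?L \<longleftrightarrow> ?R")
proof -
  define g where "g x = of_real (U j x) * complex_form p x" for x
  have Uj: "regular (\<lambda>x. of_real (U j x))"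
    using UV_regular(1,2)[OF j] unfolding regular_def by (auto intro!: continuous_intros)
  have g: "regular g" unfolding g_def
    using Uj complex_form_regular by (intro regular_mult) (auto simp: regular_def)
  have gn: "regular (\<lambda>x. of_real (x ^ n) * g x)" using g by (rule regular_power)
  have mom: "moment p j l = (\<integral>x. of_real (x ^ l) * g x \<partial>\<nu>)" for l
    by (simp add: moment_def g_def mult.assoc)
  obtain D where D: "\<And>z. z \<notin> of_real ` {a..b} \<Longrightarrow>
    (\<Sum>k\<le>m1. mixed_nikishin \<sigma>1 \<sigma>2 j k z * poly (p k) z) = poly D z + \<epsilon> *\<^sub>R cauchy_integral g z"
    using mixed_combination[OF j, of p] unfolding g_def by blast
  define h where "h z = cauchy_integral (\<lambda>x. of_real (x ^ n) * g x) z" for z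
  have h: "h \<in> O[at_infinity](\<lambda>z. 1 / z)" using cauchy_integral_bigo[OF gn] by (simp add: h_def[abs_def])
  have \<epsilon>h: "(\<lambda>z. of_real \<epsilon> * h z) \<in> O[at_infinity](\<lambda>z. 1 / z)" using h by simp
  show ?thesis
  proof
    assume ?L
    then obtain d where d: "(\<lambda>z. (\<Sum>k\<le>m1. mixed_nikishin \<sigma>1 \<sigma>2 j k z * poly (p k) z) - poly d z) \<in> O[at_infinity](\<lambda>z. 1 / z ^ (n + 1))"
      by blast
    define Q where "Q = monom 1 n * (D - d) + smult (of_real \<epsilon>) (moment_poly g n)"
    have "(\<lambda>z. z ^ n * ((\<Sum>k\<le>m1. mixed_nikishin \<sigma>1 \<sigma>2 j k z * poly (p k) z) - poly d z)) \<in> O[at_infinity](\<lambda>z. z ^ n * (1 / z ^ (n + 1)))"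
      using d by (intro landau_o.big.mult) auto
    also have "(\<lambda>z. z ^ n * (1 / z ^ (n + 1))) \<in> O[at_infinity](\<lambda>z::complex. 1 / z)"
      by (intro landau_o.bigI[of 1]) (auto intro!: always_eventually simp: norm_mult norm_divide norm_power field_simps)
    finally have "(\<lambda>z. z ^ n * ((\<Sum>k\<le>m1. mixed_nikishin \<sigma>1 \<sigma>2 j k z * poly (p k) z) - poly d z)) \<in> O[at_infinity](\<lambda>z. 1 / z)" .
    then have "(\<lambda>z. z ^ n * ((\<Sum>k\<le>m1. mixed_nikishin \<sigma>1 \<sigma>2 j k z * poly (p k) z) - poly d z) - of_real \<epsilon> * h z) \<in> O[at_infinity](\<lambda>z. 1 / z)"
      using \<epsilon>h by (rule sum_in_bigo(2))
    moreover have "\<forall>\<^sub>F z in at_infinity. z ^ n * ((\<Sum>k\<le>m1. mixed_nikishin \<sigma>1 \<sigma>2 j k z * poly (p k) z) - poly d z) - of_real \<epsilon> * h z = poly Q z"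
      using eventually_outside_interval
    proof eventually_elim
      case (elim z)
      then have z: "z \<notin> of_real ` {a..b}" by blast
      have "z ^ n * ((\<Sum>k\<le>m1. mixed_nikishin \<sigma>1 \<sigma>2 j k z * poly (p k) z) - poly d z)
         = z ^ n * (poly D z - poly d z) + of_real \<epsilon> * (z ^ n * cauchy_integral g z)"
        unfolding D[OF z] by (simp add: scaleR_conv_of_real algebra_simps)
      also have "z ^ n * cauchy_integral g z = poly (moment_poly g n) z + h z"
        unfolding h_def by (rule cauchy_integral_expansion[OF g z])
      finally show ?case by (simp add: Q_def poly_monom algebra_simps)
    qed
    ultimately have "(\<lambda>z. poly Q z) \<in> O[at_infinity](\<lambda>z. 1 / z)"
      by (rule landau_o.big.in_cong[THEN iffD1, rotated])
    then have Q: "Q = 0" by (rule poly_bigo_inverse_imp_zero)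
    have "coeff (moment_poly g n) i = 0" for i
    proof (cases "i < n")
      case True
      have "coeff Q i = of_real \<epsilon> * coeff (moment_poly g n) i"
        using True by (simp add: Q_def coeff_monom_mult)
      then show ?thesis using Q \<epsilon> by simp
    next
      case False
      then show ?thesis using deg_below_moment_poly[of g n] by (simp add: deg_below_def)
    qed
    then have "moment_poly g n = 0" by (simp add: poly_eq_iff)
    then show ?R by (simp add: moment_poly_eq_0 mom)
  next
    assume ?R
    then have P0: "moment_poly g n = 0" by (simp add: moment_poly_eq_0 mom)
    have "(\<lambda>z. (1 / z ^ n) * (of_real \<epsilon> * h z)) \<in> O[at_infinity](\<lambda>z. (1 / z ^ n) * (1 / z))"
      using \<epsilon>h by (intro landau_o.big.mult) auto
    also have "(\<lambda>z::complex. (1 / z ^ n) * (1 / z)) = (\<lambda>z. 1 / z ^ (n + 1))" by (simp add: fun_eq_iff mult.commute)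
    finally have "(\<lambda>z. (1 / z ^ n) * (of_real \<epsilon> * h z)) \<in> O[at_infinity](\<lambda>z. 1 / z ^ (n + 1))" .
    moreover have "\<forall>\<^sub>F z in at_infinity. (1 / z ^ n) * (of_real \<epsilon> * h z) = (\<Sum>k\<le>m1. mixed_nikishin \<sigma>1 \<sigma>2 j k z * poly (p k) z) - poly D z"
      using eventually_outside_interval
    proof eventually_elim
      case (elim z)
      then have z: "z \<notin> of_real ` {a..b}" "z ^ n \<noteq> 0" by auto
      have "z ^ n * cauchy_integral g z = h z"
        using cauchy_integral_expansion[OF g z(1), of n] P0 by (simp add: h_def)
      then have "cauchy_integral g z = h z / z ^ n" using z(2) by (simp add: field_simps)
      then show ?case using D[OF z(1)] by (simp add: scaleR_conv_of_real)
    qed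
    ultimately have "(\<lambda>z. (\<Sum>k\<le>m1. mixed_nikishin \<sigma>1 \<sigma>2 j k z * poly (p k) z) - poly D z) \<in> O[at_infinity](\<lambda>z. 1 / z ^ (n + 1))"
      by (rule landau_o.big.in_cong[THEN iffD1, rotated])
    then show ?L by blast
  qed
qed

lemma pdeg_le_iff: "pdeg p \<le> int n - 1 \<longleftrightarrow> deg_below p n"
  by (auto simp: pdeg_def deg_below_degree)

lemma mixed_type_poly_iff:
  "mixed_type_poly m1 m2 (mixed_nikishin \<sigma>1 \<sigma>2) n1 n2 p \<longleftrightarrow>
    (\<exists>k\<le>m1. p k \<noteq> 0) \<and> (\<forall>k\<le>m1. deg_below (p k) (n1 k)) \<and> (\<forall>j\<le>m2. \<forall>l<n2 j. moment p j l = 0)"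
proof -
  have "(\<exists>d. \<forall>j\<le>m2. (\<lambda>z. (\<Sum>k\<le>m1. mixed_nikishin \<sigma>1 \<sigma>2 j k z * poly (p k) z) - poly (d j) z)
        \<in> O[at_infinity](\<lambda>z. 1 / z ^ (n2 j + 1)))
     \<longleftrightarrow> (\<forall>j\<le>m2. \<exists>d. (\<lambda>z. (\<Sum>k\<le>m1. mixed_nikishin \<sigma>1 \<sigma>2 j k z * poly (p k) z) - poly d z)
        \<in> O[at_infinity](\<lambda>z. 1 / z ^ (n2 j + 1)))"
    (is "(\<exists>d. \<forall>j\<le>m2. ?P j (d j)) \<longleftrightarrow> _")
    using choice[of "\<lambda>j d. j \<le> m2 \<longrightarrow> ?P j d"] by blast
  then show ?thesis
    unfolding mixed_type_poly_def pdeg_le_iff using order_condition_iff_moments by simp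
qed

lemma moment_combination:
  assumes "j \<le> m2"
  shows "moment (\<lambda>k. p k - smult c (q k)) j l = moment p j l - c * moment q j l"
proof -
  have "moment (\<lambda>k. p k - smult c (q k)) j l
     = (\<integral>x. of_real (x ^ l * U j x) * complex_form p x - c * (of_real (x ^ l * U j x) * complex_form q x) \<partial>\<nu>)"
    unfolding moment_def
    by (intro Bochner_Integration.integral_cong)
       (auto simp: complex_form_def left_diff_distrib right_diff_distrib sum_subtractf sum_distrib_left mult_ac)
  also have "\<dots> = moment p j l - c * moment q j l"
    unfolding moment_def using integrable_moment[OF assms] by simp
  finally show ?thesis .
qed

text \<open>
  A vanishing top coefficient lowers \<open>n1 k\<close> by one, which leaves no more free coefficients than
  orthogonality conditions.
\<close>

lemma top_coefficient_nonzero: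
  assumes adm: "admissible_index m1 m2 n1 n2"
    and sol: "\<And>k. k \<le> m1 \<Longrightarrow> deg_below (p k) (n1 k)" "\<And>j l. j \<le> m2 \<Longrightarrow> l < n2 j \<Longrightarrow> moment p j l = 0"
    and k: "k \<le> m1" "0 < n1 k" "coeff (p k) (n1 k - 1) = 0" and i: "i \<le> m1"
  shows "p i = 0"
proof (rule orthogonal_form_vanishes[OF _ _ sol(2) i])
  let ?n = "n1(k := n1 k - 1)"
  show "deg_below (p i) (?n i)" if "i \<le> m1" for i
  proof (cases "i = k")
    case True
    have "coeff (p k) l = 0" if "n1 k - 1 \<le> l" for l
      using that sol(1)[OF k(1)] k(3) by (cases "l = n1 k - 1") (auto simp: deg_below_def)
    then show ?thesis using True by (simp add: deg_below_def)
  qed (use sol(1)[OF that] in simp)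
  have "(\<Sum>i\<le>m1. n1 i) = (\<Sum>i\<le>m1. ?n i + (if i = k then 1 else 0))"
    using k(2) by (intro sum.cong) auto
  also have "\<dots> = (\<Sum>i\<le>m1. ?n i) + 1" using k(1) by (simp add: sum.distrib)
  finally show "(\<Sum>i\<le>m1. ?n i) \<le> (\<Sum>j\<le>m2. n2 j)" using adm by (simp add: admissible_index_def)
qed

text \<open>
  There are \<open>|n1| = |n2| + 1\<close> unknown coefficients for \<open>|n2|\<close> linear conditions.
\<close>

lemma solution_exists:
  assumes "admissible_index m1 m2 n1 n2"
  shows "\<exists>p. mixed_type_poly m1 m2 (mixed_nikishin \<sigma>1 \<sigma>2) n1 n2 p"
proof -
  define A where "A = (SIGMA j:{..m2}. {..<n2 j})"
  define B where "B = (SIGMA k:{..m1}. {..<n1 k})"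
  define b where "b \<beta> x = (of_real (x ^ snd \<beta> * V (fst \<beta>) x) :: complex)" for \<beta> x
  define M where "M \<alpha> \<beta> = (\<integral>x. of_real (x ^ snd \<alpha> * U (fst \<alpha>) x) * b \<beta> x \<partial>\<nu>)" for \<alpha> \<beta>
  have "card A < card B" using assms by (simp add: A_def B_def admissible_index_def)
  moreover have "finite A" "finite B" by (auto simp: A_def B_def)
  ultimately obtain c where c: "\<exists>\<beta>\<in>B. c \<beta> \<noteq> 0" "\<forall>\<alpha>\<in>A. (\<Sum>\<beta>\<in>B. M \<alpha> \<beta> * c \<beta>) = 0"
    using homogeneous_system_solvable[of A B M] by blast
  let ?p = "poly_of c n1"
  have "moment ?p j l = 0" if jl: "j \<le> m2" "l < n2 j" for j l
  proof -
    have form: "complex_form ?p x = (\<Sum>\<beta>\<in>B. c \<beta> * b \<beta> x)" for x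
      unfolding complex_form_def B_def by (subst sum_poly_of) (simp add: b_def)
    have int: "integrable \<nu> (\<lambda>x. of_real (x ^ l * U j x) * b \<beta> x)" if "\<beta> \<in> B" for \<beta>
    proof -
      have "fst \<beta> \<le> m1" using that by (auto simp: B_def)
      then show ?thesis using UV_regular(1,2)[OF jl(1)] UV_regular(3,4)[of "fst \<beta>"] unfolding b_def
        by (intro integrable_continuous borel_measurable_times borel_measurable_of_real continuous_intros) auto
    qed
    have "moment ?p j l = (\<integral>x. (\<Sum>\<beta>\<in>B. c \<beta> * (of_real (x ^ l * U j x) * b \<beta> x)) \<partial>\<nu>)"
      unfolding moment_def form by (simp only: sum_distrib_left mult.left_commute)
    also have "\<dots> = (\<Sum>\<beta>\<in>B. c \<beta> * M (j, l) \<beta>)"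
      unfolding M_def using int by (subst Bochner_Integration.integral_sum) auto
    also have "\<dots> = 0" using c(2) jl by (auto simp: A_def mult.commute)
    finally show ?thesis .
  qed
  moreover obtain k i where "k \<le> m1" "i < n1 k" "c (k, i) \<noteq> 0" using c(1) by (auto simp: B_def)
  then have "\<exists>k\<le>m1. ?p k \<noteq> 0" using coeff_poly_of[of c n1 k i] by (metis coeff_0)
  ultimately show ?thesis unfolding mixed_type_poly_iff using deg_below_poly_of by blast
qed

lemma perfect_and_unique:
  "mixed_type_perfect m1 m2 (mixed_nikishin \<sigma>1 \<sigma>2) \<and>
    (\<forall>n1 n2. admissible_index m1 m2 n1 n2 \<longrightarrow>
      (\<exists>a. mixed_type_poly m1 m2 (mixed_nikishin \<sigma>1 \<sigma>2) n1 n2 a \<and>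
        (\<forall>b. mixed_type_poly m1 m2 (mixed_nikishin \<sigma>1 \<sigma>2) n1 n2 b \<longrightarrow>
          (\<exists>c. \<forall>k\<le>m1. b k = smult c (a k)))))"
proof (intro conjI allI impI)
  show "mixed_type_perfect m1 m2 (mixed_nikishin \<sigma>1 \<sigma>2)"
    unfolding mixed_type_perfect_def mixed_type_normal_def
  proof (intro allI impI)
    fix n1 n2 p k
    assume adm: "admissible_index m1 m2 n1 n2" and p: "mixed_type_poly m1 m2 (mixed_nikishin \<sigma>1 \<sigma>2) n1 n2 p"
      and k: "k \<le> m1"
    have sol: "\<exists>k\<le>m1. p k \<noteq> 0" "\<And>k. k \<le> m1 \<Longrightarrow> deg_below (p k) (n1 k)"
      "\<And>j l. j \<le> m2 \<Longrightarrow> l < n2 j \<Longrightarrow> moment p j l = 0"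
      using p unfolding mixed_type_poly_iff by blast+
    show "pdeg (p k) = int (n1 k) - 1"
    proof (cases "n1 k = 0")
      case True
      then show ?thesis using sol(2)[OF k] by (simp add: deg_below_0 pdeg_def)
    next
      case False
      then have "coeff (p k) (n1 k - 1) \<noteq> 0"
        using top_coefficient_nonzero[OF adm sol(2,3) k] sol(1) by blast
      then have "p k \<noteq> 0" "n1 k - 1 \<le> degree (p k)" by (auto intro: le_degree)
      then show ?thesis using sol(2)[OF k] False by (auto simp: deg_below_degree pdeg_def)
    qed
  qed
next
  fix n1 n2 assume adm: "admissible_index m1 m2 n1 n2"
  obtain p where p: "mixed_type_poly m1 m2 (mixed_nikishin \<sigma>1 \<sigma>2) n1 n2 p" using solution_exists[OF adm] by blast
  then have solp: "\<exists>k\<le>m1. p k \<noteq> 0" "\<And>k. k \<le> m1 \<Longrightarrow> deg_below (p k) (n1 k)"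
      "\<And>j l. j \<le> m2 \<Longrightarrow> l < n2 j \<Longrightarrow> moment p j l = 0"
    unfolding mixed_type_poly_iff by blast+
  have "(\<Sum>k\<le>m1. n1 k) \<noteq> 0" using adm by (simp add: admissible_index_def)
  then obtain k where "k \<in> {..m1}" "n1 k \<noteq> 0" by (rule sum.not_neutral_contains_not_neutral)
  then have k: "k \<le> m1" "n1 k > 0" by auto
  define \<alpha> where "\<alpha> = coeff (p k) (n1 k - 1)"
  have \<alpha>: "\<alpha> \<noteq> 0" unfolding \<alpha>_def using top_coefficient_nonzero[OF adm solp(2,3) k] solp(1) by blast
  show "\<exists>a. mixed_type_poly m1 m2 (mixed_nikishin \<sigma>1 \<sigma>2) n1 n2 a \<and>
        (\<forall>b. mixed_type_poly m1 m2 (mixed_nikishin \<sigma>1 \<sigma>2) n1 n2 b \<longrightarrow>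
          (\<exists>c. \<forall>k\<le>m1. b k = smult c (a k)))"
  proof (intro exI[of _ p] conjI allI impI p)
    fix q assume "mixed_type_poly m1 m2 (mixed_nikishin \<sigma>1 \<sigma>2) n1 n2 q"
    then have solq: "\<And>k. k \<le> m1 \<Longrightarrow> deg_below (q k) (n1 k)" "\<And>j l. j \<le> m2 \<Longrightarrow> l < n2 j \<Longrightarrow> moment q j l = 0"
      unfolding mixed_type_poly_iff by blast+
    define c where "c = coeff (q k) (n1 k - 1) / \<alpha>"
    define r where "r i = q i - smult c (p i)" for i
    have "r i = 0" if "i \<le> m1" for i
    proof (rule top_coefficient_nonzero[OF adm _ _ k _ that])
      show "deg_below (r i) (n1 i)" if "i \<le> m1" for i
        using solp(2)[OF that] solq(1)[OF that] by (simp add: r_def deg_below_def)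
      show "moment r j l = 0" if "j \<le> m2" "l < n2 j" for j l
        unfolding r_def[abs_def] moment_combination[OF that(1)] using solp(3)[OF that] solq(2)[OF that] by simp
      show "coeff (r k) (n1 k - 1) = 0" using \<alpha> by (simp add: r_def c_def \<alpha>_def)
    qed
    then show "\<exists>c. \<forall>k\<le>m1. q k = smult c (p k)" by (intro exI[of _ c]) (simp add: r_def)
  qed
qed

end

theorem theorem1p2:
  fixes m1 m2 :: nat
    and \<Delta>1 \<Delta>2 :: "nat \<Rightarrow> real set"
    and \<sigma>1 \<sigma>2 :: "nat \<Rightarrow> smeasure"
  assumes "nikishin_generators m1 \<Delta>1 \<sigma>1"
    and "nikishin_generators m2 \<Delta>2 \<sigma>2"
    and "\<sigma>1 0 = \<sigma>2 0"
  shows "mixed_type_perfect m1 m2 (mixed_nikishin \<sigma>1 \<sigma>2) \<and>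
    (\<forall>n1 n2. admissible_index m1 m2 n1 n2 \<longrightarrow>
      (\<exists>a. mixed_type_poly m1 m2 (mixed_nikishin \<sigma>1 \<sigma>2) n1 n2 a \<and>
        (\<forall>b. mixed_type_poly m1 m2 (mixed_nikishin \<sigma>1 \<sigma>2) n1 n2 b \<longrightarrow>
          (\<exists>c. \<forall>k\<le>m1. b k = smult c (a k)))))"
proof -
  have s2: "\<sigma>2 0 \<in> measure_class (\<Delta>2 0)" and s1: "\<sigma>1 0 \<in> measure_class (\<Delta>1 0)"
    using assms(1,2) by (auto simp: nikishin_generators_def)
  have same: "\<Delta>1 0 = \<Delta>2 0" using s1 s2 assms(3) by (simp add: measure_class_def)
  obtain a b \<epsilon> where ab: "\<Delta>2 0 = {a..b}" "a \<le> b" and \<epsilon>: "\<epsilon> = 1 \<or> \<epsilon> = (-1::real)"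
    and \<nu>: "sets (total_variation (\<sigma>2 0)) = sets borel" "finite_measure (total_variation (\<sigma>2 0))"
      "emeasure (total_variation (\<sigma>2 0)) (- {a..b}) = 0"
      "\<And>S. finite S \<Longrightarrow> emeasure (total_variation (\<sigma>2 0)) (- S) \<noteq> 0"
      "\<And>f :: real \<Rightarrow> real. f \<in> borel_measurable borel \<Longrightarrow>
      sintegral (\<sigma>2 0) f = \<epsilon> * (\<integral>x. f x \<partial>total_variation (\<sigma>2 0))"
    and sint: "\<And>f :: real \<Rightarrow> complex. f \<in> borel_measurable borel \<Longrightarrow>
      sintegral (\<sigma>2 0) f = \<epsilon> *\<^sub>R (\<integral>x. f x \<partial>total_variation (\<sigma>2 0))"
  proof (rule measure_class_facts[OF s2], goal_cases)
    case (1 a b \<epsilon>)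
    show thesis by (rule 1(1)[OF 1(2-)])
  qed
  have \<epsilon>0: "\<epsilon> \<noteq> 0" using \<epsilon> by auto
  interpret finite_measure "total_variation (\<sigma>2 0)" by (rule \<nu>(2))
  interpret mixed_functions "total_variation (\<sigma>2 0)" a b m1 m2 \<Delta>1 \<Delta>2 \<sigma>1 \<sigma>2 \<epsilon>
    by unfold_locales (use \<nu>(1-4) assms ab same \<epsilon>0 sint in simp_all)
  show ?thesis by (rule perfect_and_unique)
qed

end
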